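(* Let $\sigma>0$ be known, $\alpha\in(0,1)$, $1/\sqrt2<\varrho<1$, $\rho_n=\sqrt{2\log n}$. Either (global case) let $\hat\lambda_{J_0}=\dots=\hat\lambda_{J_1}\equiv\hat\lambda$ be obtained by minimizing $S_n(\lambda)$ over a single constant $\varrho\rho_n\sigma/\sqrt n\le\lambda\le\rho_n\sigma/\sqrt n$ used at every level, or (levelwise case) let $\hat\lambda=(\hat\lambda_{J_0},\dots,\hat\lambda_{J_1})$ be obtained by minimizing $S_n(\lambda_{J_0},\dots,\lambda_{J_1})$ over $\varrho\rho_n\sigma/\sqrt n\le\lambda_j\le\rho_n\sigma/\sqrt n$ for each $j$. Let $\hat\mu_1,\dots,\hat\mu_n$ be the corresponding soft-threshold estimates $\hat\alpha_k=\tilde\alpha_k$, $\hat\beta_{j,k}=\operatorname{sgn}(\tilde\beta_{j,k})(|\tilde\beta_{j,k}|-\hat\lambda_j)_+$, and put $$s_n^2=\sigma^2\frac{z_\alpha}{\sqrt{n/2}}+S_n(\hat\lambda),\qquad \mathcal D_n=\Big\{\mu^n\in\mathbb R^n:\sum_{\ell=1}^n(\mu_\ell-\hat\mu_\ell)^2\le s_n^2\Big\},\qquad \mathcal A_n=\Big\{\sum_{\ell=1}^n\mu_\ell\phi_\ell:\mu^n\in\mathcal D_n\Big\}.$$ Then, in both cases: (i) for every Besov body $\mathcal B$ with $\gamma>1/2$ and radius $c>0$, $$\lim_{n\to\infty}\sup_{\mu^n\in\mathcal B^n}\big|\mathsf P\{\mu^n\in\mathcal D_n\}-(1-\alpha)\big|=0;$$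 (ii) for every such $\mathcal B$, with $f_n=\sum_{\ell=1}^n\mu_\ell\phi_\ell$, $$\lim_{n\to\infty}\sup_{\mu^n\in\mathcal B^n}\big|\mathsf P\{f_n\in\mathcal A_n\}-(1-\alpha)\big|=0;$$ (iii) for all $\eta,c,\delta>0$, the set $\mathcal C_n=\{f\in\mathcal F_{\eta,c}:\inf_{g\in\mathcal A_n}\|f-g\|_2\le\delta/\sqrt n\}$ satisfies $$\liminf_{n\to\infty}\inf_{f\in\mathcal F_{\eta,c}}\mathsf P_f\{f\in\mathcal C_n\}\ge1-\alpha.$$
   Context: Wavelets. $\phi,\psi$ are a father and mother wavelet, bounded, compactly supported, with derivatives of finite $L^2$ norm, generating (with the usual boundary adaptation) a complete orthonormal set of $L^2[0,1]$: $\phi_{J_0,k}(x)=2^{J_0/2}\phi(2^{J_0}x-k)$, $0\le k<2^{J_0}$, and $\psi_{j,k}(x)=2^{j/2}\psi(2^jx-k)$, $j\ge J_0$, $0\le k<2^j$, with $J_0$ fixed. They are enumerated as $\phi_1,\phi_2,\dots$: $\phi_{J_0,k}$ has index $k+1$ and $\psi_{j,k}$ has index $2^j+k+1$. For $f\in L^2[0,1]$, $\mu_\ell=\int f\phi_\ell$; the coefficients of $\phi_{J_0,k}$ and $\psi_{j,k}$ are also written $\alpha_k$ and $\beta_{j,k}$. Here $n=2^{J_1+1}$, so levels $J_0\le j\le J_1$ together with the father coefficients give exactly $n$ coefficients $\mu^n=(\mu_1,\dots,\mu_n)$; limits are along such $n$. Model. The underlying regression model is $Y_i=f(i/n)+\sigma\varepsilon_i$,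 $i=1,\dots,n$, $\varepsilon_i$ i.i.d. $N(0,1)$, and the data enter through $n$ empirical wavelet coefficients $\tilde\mu_1,\dots,\tilde\mu_n$ (written also $\tilde\alpha_k,\tilde\beta_{j,k}$), taken to be independent with known variance $\sigma^2/n$. In statements about $\mu^n$, $\mathsf P$ is the law under which $\tilde\mu_\ell\sim N(\mu_\ell,\sigma^2/n)$. In statements about $f$, $\mathsf P_f$ is the law under which $\tilde\mu_\ell\sim N(\bar\mu_\ell,\sigma^2/n)$, where $\bar\mu_\ell=\int\bar f_n\phi_\ell$ and $\bar f_n(x)=n\int_{(i-1)/n}^{i/n}f(t)\,dt$ for $x\in[(i-1)/n,i/n)$. Risk estimate (SURE). For thresholds $\lambda_{J_0},\dots,\lambda_{J_1}$ (all equal to $\lambda$ in the global case, when it is written $S_n(\lambda)$), $$S_n(\lambda_{J_0},\dots,\lambda_{J_1})=\frac{\sigma^2}{n}2^{J_0}+\sum_{j=J_0}^{J_1}\sum_{k=0}^{2^j-1}\Big[\frac{\sigma^2}{n}-2\frac{\sigma^2}{n}\mathbf 1\{|\tilde\beta_{j,k}|\le\lambda_j\}+\min(\tilde\beta_{j,k}^2,\lambda_j^2)\Big].$$ Besov bodies. For real $p,q\ge1$ and $\varsigma$, set $$\|\mu\|_{p,q}^\varsigma=\Big(\sum_k|\alpha_k|^p\Big)^{1/p}+\Big(\sum_{j\ge J_0}\Big(2^{j(\varsigma+1/2-1/p)}\Big(\sum_k|\beta_{j,k}|^p\Big)^{1/p}\Big)^q\Big)^{1/q},$$ and $\gamma=\varsigma$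 if $p\ge2$, $\gamma=\varsigma+\frac12-\frac1p$ if $1\le p<2$. A Besov body $\mathcal B$ with $\gamma>1/2$ and radius $c$ is the set of sequences $\{\mu:\|\mu\|_{p,q}^\varsigma\le c\}$ for some $p,q,\varsigma$ with $\gamma>1/2$; the corresponding Besov ball $\mathcal B_{p,q}^{\varsigma}(c)$ is the set of functions with coefficients in it. $\mathcal B^n$ is the set of vectors $(\mu_1,\dots,\mu_n)$, $\mu\in\mathcal B$. $\mathcal F_{\eta,c}=\bigcup_{p,q\ge1}\bigcup_{\gamma\ge1/2+\eta}\mathcal B_{p,q}^{\varsigma(\gamma)}(c)$, where $\varsigma(\gamma)$ is the value of $\varsigma$ corresponding to $\gamma$ and $p$. $z_\alpha$ is the upper-tail $\alpha$-quantile of the standard normal; $a_+=\max(a,0)$. *)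

theory Defs
  imports "HOL-Probability.Probability" "HOL-Library.Discrete_Functions"
begin

definition sq_integrable :: "'a measure \<Rightarrow> ('a \<Rightarrow> real) \<Rightarrow> bool" where
  "sq_integrable M f \<longleftrightarrow> f \<in> borel_measurable M \<and> integrable M (\<lambda>x. (f x)\<^sup>2)"

definition L2_inner :: "'a measure \<Rightarrow> ('a \<Rightarrow> real) \<Rightarrow> ('a \<Rightarrow> real) \<Rightarrow> real" where
  "L2_inner M f g = (LINT x|M. f x * g x)"

definition L2_norm :: "'a measure \<Rightarrow> ('a \<Rightarrow> real) \<Rightarrow> real" where
  "L2_norm M f = sqrt (LINT x|M. (f x)\<^sup>2)"

abbreviation unit_leb :: "real measure" where
  "unit_leb \<equiv> lebesgue_on {0..1}"

definition dil :: "(real \<Rightarrow> real) \<Rightarrow> nat \<Rightarrow> int \<Rightarrow> real \<Rightarrow> real" where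
  "dil w j k x = 2 powr (real j / 2) * w (2 ^ j * x - of_int k)"

definition mra_space :: "(real \<Rightarrow> real) \<Rightarrow> nat \<Rightarrow> (real \<Rightarrow> real) set" where
  "mra_space \<phi> j = {g. sq_integrable lebesgue g \<and>
     (\<forall>\<epsilon>>0. \<exists>F c. finite F \<and>
        L2_norm lebesgue (\<lambda>x. g x - (\<Sum>k\<in>F. c k * dil \<phi> j k x)) < \<epsilon>)}"

definition father_wavelet :: "(real \<Rightarrow> real) \<Rightarrow> bool" where
  "father_wavelet \<phi> \<longleftrightarrow> sq_integrable lebesgue \<phi> \<and>
     (\<forall>k l. L2_inner lebesgue (dil \<phi> 0 k) (dil \<phi> 0 l) = of_bool (k = l)) \<and>
     (\<forall>j. mra_space \<phi> j \<subseteq> mra_space \<phi> (Suc j)) \<and>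
     (\<forall>g \<epsilon>. sq_integrable lebesgue g \<and> 0 < \<epsilon> \<longrightarrow>
        (\<exists>j. \<exists>h\<in>mra_space \<phi> j. L2_norm lebesgue (\<lambda>x. g x - h x) < \<epsilon>))"

text \<open>The integer translates of \<open>\<psi>\<close> form an orthonormal basis of the orthogonal complement
  of level 0 in level 1.\<close>

definition mother_wavelet :: "(real \<Rightarrow> real) \<Rightarrow> (real \<Rightarrow> real) \<Rightarrow> bool" where
  "mother_wavelet \<phi> \<psi> \<longleftrightarrow> \<psi> \<in> mra_space \<phi> 1 \<and>
     (\<forall>k l. L2_inner lebesgue (dil \<psi> 0 k) (dil \<psi> 0 l) = of_bool (k = l)) \<and>
     (\<forall>k l. L2_inner lebesgue (dil \<phi> 0 k) (dil \<psi> 0 l) = 0) \<and>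
     (\<forall>g\<in>mra_space \<phi> 1. (\<forall>k. L2_inner lebesgue g (dil \<phi> 0 k) = 0) \<and>
        (\<forall>k. L2_inner lebesgue g (dil \<psi> 0 k) = 0) \<longrightarrow> (AE x in lebesgue. g x = 0))"

text \<open>Bounded, compactly supported, with a derivative of finite \<open>L\<^sup>2\<close> norm.  The derivative is
  understood in the sense of absolutely continuous functions, which includes piecewise smooth
  continuous \<open>w\<close> but excludes jumps.\<close>

definition regular_wavelet :: "(real \<Rightarrow> real) \<Rightarrow> bool" where
  "regular_wavelet w \<longleftrightarrow> bounded (range w) \<and> (\<exists>R. \<forall>x. \<bar>x\<bar> > R \<longrightarrow> w x = 0) \<and>
     (\<exists>w'. sq_integrable lebesgue w' \<and>
        (\<forall>a b. a \<le> b \<longrightarrow> (w' has_integral (w b - w a)) {a..b}))"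

text \<open>At every level the functions with \<open>K \<le> k < 2 ^ j - K\<close> are the dilated translates of \<open>w\<close>;
  the \<open>K\<close> leftmost and \<open>K\<close> rightmost ones are dilates of finitely many fixed regular functions
  anchored at the end points 0 (\<open>A\<close>) and 1 (\<open>B\<close>).  Genuine edge functions use one anchor only.
  Periodisation uses both, as a periodised boundary wavelet has a piece at each end.  Levels
  with \<open>2 ^ j < 2 * K\<close>, where both boundary zones overlap, are only restricted by the two-scale
  relations in the definition of \<open>boundary_adapted\<close>.\<close>

definition adapted_family ::
  "nat \<Rightarrow> nat \<Rightarrow> (real \<Rightarrow> real) \<Rightarrow> (nat \<Rightarrow> nat \<Rightarrow> real \<Rightarrow> real) \<Rightarrow> bool" where
  "adapted_family K J0 w W \<longleftrightarrow>
     (\<exists>A B. (\<forall>i<2 * K. regular_wavelet (A i) \<and> regular_wavelet (B i)) \<and>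
       (\<forall>j\<ge>J0. 2 * K \<le> 2 ^ j \<longrightarrow> (\<forall>k<2 ^ j. \<forall>x\<in>{0..1}.
          W j k x =
            (if K \<le> k \<and> k < 2 ^ j - K then dil w j (int k) x
             else let i = (if k < K then k else K + (2 ^ j - 1 - k))
                  in 2 powr (real j / 2) * (A i (2 ^ j * x) + B i (2 ^ j * (x - 1)))))))"

definition boundary_adapted ::
  "nat \<Rightarrow> (real \<Rightarrow> real) \<Rightarrow> (real \<Rightarrow> real) \<Rightarrow> (nat \<Rightarrow> nat \<Rightarrow> real \<Rightarrow> real) \<Rightarrow>
    (nat \<Rightarrow> nat \<Rightarrow> real \<Rightarrow> real) \<Rightarrow> bool" where
  "boundary_adapted J0 \<phi> \<psi> \<Phi> \<Psi> \<longleftrightarrow>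
     (\<exists>K. adapted_family K J0 \<phi> \<Phi> \<and> adapted_family K J0 \<psi> \<Psi>) \<and>
     (\<forall>j\<ge>J0. \<forall>k<2 ^ j.
        (\<exists>h. \<forall>x\<in>{0..1}. \<Phi> j k x = (\<Sum>m<2 ^ Suc j. h m * \<Phi> (Suc j) m x)) \<and>
        (\<exists>h. \<forall>x\<in>{0..1}. \<Psi> j k x = (\<Sum>m<2 ^ Suc j. h m * \<Phi> (Suc j) m x)))"

definition complete_orthonormal :: "(nat \<Rightarrow> real \<Rightarrow> real) \<Rightarrow> bool" where
  "complete_orthonormal e \<longleftrightarrow>
     (\<forall>l\<ge>1. sq_integrable unit_leb (e l)) \<and>
     (\<forall>l\<ge>1. \<forall>m\<ge>1. L2_inner unit_leb (e l) (e m) = of_bool (l = m)) \<and>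
     (\<forall>f. sq_integrable unit_leb f \<and> (\<forall>l\<ge>1. L2_inner unit_leb f (e l) = 0) \<longrightarrow>
        (AE x in unit_leb. f x = 0))"

text \<open>Index \<open>l = 2 ^ j + k + 1\<close> with \<open>k < 2 ^ j\<close> belongs to level \<open>j\<close>.\<close>

definition level :: "nat \<Rightarrow> nat" where
  "level l = floor_log (l - 1)"

lemma level_index: "k < 2 ^ j \<Longrightarrow> level (2 ^ j + k + 1) = j"
  unfolding level_def by (rule floor_log_eqI) auto

text \<open>\<open>e 1, e 2, \<dots>\<close> is the enumerated wavelet basis of \<open>L\<^sup>2\<close> of the unit interval; only the values
  on the unit interval matter.\<close>

definition wavelet_basis ::
  "nat \<Rightarrow> (real \<Rightarrow> real) \<Rightarrow> (real \<Rightarrow> real) \<Rightarrow> (nat \<Rightarrow> real \<Rightarrow> real) \<Rightarrow> bool" where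
  "wavelet_basis J0 \<phi> \<psi> e \<longleftrightarrow>
     father_wavelet \<phi> \<and> mother_wavelet \<phi> \<psi> \<and> regular_wavelet \<phi> \<and> regular_wavelet \<psi> \<and>
     (\<exists>\<Phi> \<Psi>. boundary_adapted J0 \<phi> \<psi> \<Phi> \<Psi> \<and>
        (\<forall>k<2 ^ J0. e (k + 1) = \<Phi> J0 k) \<and>
        (\<forall>j\<ge>J0. \<forall>k<2 ^ j. e (2 ^ j + k + 1) = \<Psi> j k)) \<and>
     complete_orthonormal e"

definition besov_norm :: "nat \<Rightarrow> real \<Rightarrow> real \<Rightarrow> real \<Rightarrow> (nat \<Rightarrow> real) \<Rightarrow> ereal" where
  "besov_norm J0 p q s \<mu> =
     (let b = (\<lambda>j. 2 powr (real j * (s + 1/2 - 1/p)) *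
                    (\<Sum>k<2 ^ j. \<bar>\<mu> (2 ^ j + k + 1)\<bar> powr p) powr (1/p))
      in ereal ((\<Sum>k<2 ^ J0. \<bar>\<mu> (k + 1)\<bar> powr p) powr (1/p)) +
         (if summable (\<lambda>i. b (J0 + i) powr q)
          then ereal ((\<Sum>i. b (J0 + i) powr q) powr (1/q)) else \<infinity>))"

definition besov_gamma :: "real \<Rightarrow> real \<Rightarrow> real" where
  "besov_gamma p s = (if 2 \<le> p then s else s + 1/2 - 1/p)"

definition besov_body :: "nat \<Rightarrow> real \<Rightarrow> real \<Rightarrow> real \<Rightarrow> real \<Rightarrow> (nat \<Rightarrow> real) set" where
  "besov_body J0 p q s c = {\<mu>. besov_norm J0 p q s \<mu> \<le> ereal c}"

definition truncated_body :: "nat \<Rightarrow> (nat \<Rightarrow> real) set \<Rightarrow> (nat \<Rightarrow> real) set" where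
  "truncated_body n B = (\<lambda>\<mu>. restrict \<mu> {1..n}) ` B"

definition wcoef :: "(nat \<Rightarrow> real \<Rightarrow> real) \<Rightarrow> (real \<Rightarrow> real) \<Rightarrow> nat \<Rightarrow> real" where
  "wcoef e f l = L2_inner unit_leb f (e l)"

definition besov_ball ::
  "nat \<Rightarrow> (nat \<Rightarrow> real \<Rightarrow> real) \<Rightarrow> real \<Rightarrow> real \<Rightarrow> real \<Rightarrow> real \<Rightarrow> (real \<Rightarrow> real) set" where
  "besov_ball J0 e p q s c =
     {f. sq_integrable unit_leb f \<and> wcoef e f \<in> besov_body J0 p q s c}"

definition function_class ::
  "nat \<Rightarrow> (nat \<Rightarrow> real \<Rightarrow> real) \<Rightarrow> real \<Rightarrow> real \<Rightarrow> (real \<Rightarrow> real) set" where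
  "function_class J0 e \<eta> c =
     (\<Union>p\<in>{1..}. \<Union>q\<in>{1..}. \<Union>s\<in>{s. besov_gamma p s \<ge> 1/2 + \<eta>}. besov_ball J0 e p q s c)"

definition sample_size :: "nat \<Rightarrow> nat" where
  "sample_size J1 = 2 ^ (J1 + 1)"

definition coef_law :: "real \<Rightarrow> nat \<Rightarrow> (nat \<Rightarrow> real) \<Rightarrow> (nat \<Rightarrow> real) measure" where
  "coef_law \<sigma> n \<mu> = (\<Pi>\<^sub>M l\<in>{1..n}. density lborel (normal_density (\<mu> l) (\<sigma> / sqrt (real n))))"

definition cell_average :: "nat \<Rightarrow> (real \<Rightarrow> real) \<Rightarrow> real \<Rightarrow> real" where
  "cell_average n f x =
     real n * (LINT t:{\<lfloor>real n * x\<rfloor> / real n..(\<lfloor>real n * x\<rfloor> + 1) / real n}|unit_leb. f t)"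

definition upper_normal_quantile :: "real \<Rightarrow> real" where
  "upper_normal_quantile \<alpha> = (THE z. measure std_normal_distribution {z<..} = \<alpha>)"

text \<open>\<open>y\<close> is the vector of empirical coefficients and \<open>t j\<close> the threshold at level \<open>j\<close>.\<close>

definition sure :: "real \<Rightarrow> nat \<Rightarrow> nat \<Rightarrow> (nat \<Rightarrow> real) \<Rightarrow> (nat \<Rightarrow> real) \<Rightarrow> real" where
  "sure \<sigma> J0 J1 t y =
     (let v = \<sigma>\<^sup>2 / real (sample_size J1) in
      v * 2 ^ J0 +
      (\<Sum>j=J0..J1. \<Sum>k<2 ^ j. let b = y (2 ^ j + k + 1) in
         v - 2 * v * of_bool (\<bar>b\<bar> \<le> t j) + min (b\<^sup>2) ((t j)\<^sup>2)))"

definition threshold_range :: "real \<Rightarrow> real \<Rightarrow> nat \<Rightarrow> real set" where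
  "threshold_range \<sigma> \<rho> n =
     (let u = sqrt (2 * ln (real n)) * \<sigma> / sqrt (real n) in {\<rho> * u..u})"

abbreviation data_space :: "nat \<Rightarrow> (nat \<Rightarrow> real) measure" where
  "data_space n \<equiv> (\<Pi>\<^sub>M l\<in>{1..n}. borel)"

text \<open>\<open>lam J1 y j\<close> is the level-\<open>j\<close> threshold computed from data \<open>y\<close> of size \<open>sample_size J1\<close>.
  Minimisers need not be unique; any measurable selection is admitted.\<close>

definition global_thresholds ::
  "real \<Rightarrow> real \<Rightarrow> nat \<Rightarrow> (nat \<Rightarrow> (nat \<Rightarrow> real) \<Rightarrow> nat \<Rightarrow> real) \<Rightarrow> bool" where
  "global_thresholds \<sigma> \<rho> J0 lam \<longleftrightarrow>
     (\<forall>J1\<ge>J0. let n = sample_size J1 in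
        \<exists>g\<in>borel_measurable (data_space n). \<forall>y\<in>space (data_space n).
          is_arg_min (\<lambda>u. sure \<sigma> J0 J1 (\<lambda>_. u) y) (\<lambda>u. u \<in> threshold_range \<sigma> \<rho> n) (g y) \<and>
          (\<forall>j\<in>{J0..J1}. lam J1 y j = g y))"

definition levelwise_thresholds ::
  "real \<Rightarrow> real \<Rightarrow> nat \<Rightarrow> (nat \<Rightarrow> (nat \<Rightarrow> real) \<Rightarrow> nat \<Rightarrow> real) \<Rightarrow> bool" where
  "levelwise_thresholds \<sigma> \<rho> J0 lam \<longleftrightarrow>
     (\<forall>J1\<ge>J0. let n = sample_size J1 in
        (\<forall>j\<in>{J0..J1}. (\<lambda>y. lam J1 y j) \<in> borel_measurable (data_space n)) \<and>
        (\<forall>y\<in>space (data_space n).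
          is_arg_min (\<lambda>t. sure \<sigma> J0 J1 t y)
            (\<lambda>t. \<forall>j\<in>{J0..J1}. t j \<in> threshold_range \<sigma> \<rho> n) (lam J1 y)))"

definition soft :: "real \<Rightarrow> real \<Rightarrow> real" where
  "soft t x = sgn x * max (\<bar>x\<bar> - t) 0"

definition soft_estimate :: "nat \<Rightarrow> (nat \<Rightarrow> real) \<Rightarrow> (nat \<Rightarrow> real) \<Rightarrow> nat \<Rightarrow> real" where
  "soft_estimate J0 t y l = (if l \<le> 2 ^ J0 then y l else soft (t (level l)) (y l))"

definition sq_radius ::
  "real \<Rightarrow> real \<Rightarrow> nat \<Rightarrow> nat \<Rightarrow> (nat \<Rightarrow> real) \<Rightarrow> (nat \<Rightarrow> real) \<Rightarrow> real" where
  "sq_radius \<sigma> \<alpha> J0 J1 t y =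
     \<sigma>\<^sup>2 * upper_normal_quantile \<alpha> / sqrt (real (sample_size J1) / 2) + sure \<sigma> J0 J1 t y"

definition conf_D ::
  "real \<Rightarrow> real \<Rightarrow> nat \<Rightarrow> (nat \<Rightarrow> (nat \<Rightarrow> real) \<Rightarrow> nat \<Rightarrow> real) \<Rightarrow> nat \<Rightarrow> (nat \<Rightarrow> real) \<Rightarrow>
    (nat \<Rightarrow> real) set" where
  "conf_D \<sigma> \<alpha> J0 lam J1 y =
     {\<mu> \<in> {1..sample_size J1} \<rightarrow>\<^sub>E UNIV.
        (\<Sum>l=1..sample_size J1. (\<mu> l - soft_estimate J0 (lam J1 y) y l)\<^sup>2)
          \<le> sq_radius \<sigma> \<alpha> J0 J1 (lam J1 y) y}"

definition wavelet_sum :: "(nat \<Rightarrow> real \<Rightarrow> real) \<Rightarrow> nat \<Rightarrow> (nat \<Rightarrow> real) \<Rightarrow> real \<Rightarrow> real" where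
  "wavelet_sum e n \<mu> x = (\<Sum>l=1..n. \<mu> l * e l x)"

definition conf_A ::
  "(nat \<Rightarrow> real \<Rightarrow> real) \<Rightarrow> real \<Rightarrow> real \<Rightarrow> nat \<Rightarrow> (nat \<Rightarrow> (nat \<Rightarrow> real) \<Rightarrow> nat \<Rightarrow> real) \<Rightarrow>
    nat \<Rightarrow> (nat \<Rightarrow> real) \<Rightarrow> (real \<Rightarrow> real) set" where
  "conf_A e \<sigma> \<alpha> J0 lam J1 y =
     wavelet_sum e (sample_size J1) ` conf_D \<sigma> \<alpha> J0 lam J1 y"

text \<open>The infimum is taken in \<open>ennreal\<close> since \<open>conf_A\<close> is empty when the squared radius is
  negative; the distance to the empty set is infinite.\<close>

definition conf_C ::
  "(nat \<Rightarrow> real \<Rightarrow> real) \<Rightarrow> real \<Rightarrow> real \<Rightarrow> nat \<Rightarrow> (nat \<Rightarrow> (nat \<Rightarrow> real) \<Rightarrow> nat \<Rightarrow> real) \<Rightarrow>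
    real \<Rightarrow> real \<Rightarrow> real \<Rightarrow> nat \<Rightarrow> (nat \<Rightarrow> real) \<Rightarrow> (real \<Rightarrow> real) set" where
  "conf_C e \<sigma> \<alpha> J0 lam \<eta> c \<delta> J1 y =
     {f \<in> function_class J0 e \<eta> c.
        (INF g\<in>conf_A e \<sigma> \<alpha> J0 lam J1 y. ennreal (L2_norm unit_leb (\<lambda>x. f x - g x)))
          \<le> ennreal (\<delta> / sqrt (real (sample_size J1)))}"

definition cover_prob ::
  "real \<Rightarrow> nat \<Rightarrow> (nat \<Rightarrow> real) \<Rightarrow> 'a \<Rightarrow> ((nat \<Rightarrow> real) \<Rightarrow> 'a set) \<Rightarrow> real" where
  "cover_prob \<sigma> n \<mu> a S =
     measure (coef_law \<sigma> n \<mu>) {y \<in> space (coef_law \<sigma> n \<mu>). a \<in> S y}"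

end

theory Submission
  imports Defs "HOL-Real_Asymp.Real_Asymp"
begin

text \<open>Measure everything in units of the noise level.  With \<open>X = \<tau> + w\<close> the observation of a
  coefficient \<open>\<tau>\<close> and \<open>r\<close> its threshold, the contribution of one wavelet coefficient to loss minus
  risk estimate is \<open>(1 - w\<^sup>2) + 2 (w (soft r X - \<tau>) - 1{\<bar>X\<bar> > r})\<close>.  The sum of the first terms
  does not depend on the coefficients and is handled by the central limit theorem.  The sum of the
  second terms is \<open>o(sqrt n)\<close> uniformly in the thresholds, by moment bounds alone.  A coefficient
  larger than a small multiple of the smallest threshold contributes \<open>O(sqrt (log n))\<close>, and
  smoothness \<open>\<gamma> > 1/2\<close> leaves, up to logarithms, at most \<open>n powr (1 / (1 + 2 \<gamma>))\<close> of them, which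
  is \<open>o(sqrt n)\<close>.  The others produce a linear term of variance \<open>o(n)\<close> and exceed the threshold
  with probability about \<open>n powr (- \<rho>\<^sup>2)\<close>, where \<open>\<rho>\<^sup>2 > 1/2\<close>.

  For functions it suffices that replacing \<open>f\<close> by its cell averages and truncating its expansion
  both cost \<open>O(n powr (- \<gamma>))\<close> with \<open>\<gamma> > 1/2\<close>: the coefficients of the cell averages then still
  decay like those of a Besov ball, and the error is absorbed by \<open>\<delta> / sqrt n\<close>.\<close>

section \<open>Independent Gaussian coordinates\<close>

text \<open>The laws of the data differ from one mean vector to another. Realised on one Gaussian
  space as \<open>\<mu> l + s * \<omega> l\<close>, they make the leading sum literally the same
  random variable for all \<open>\<mu>\<close>, so uniformity in \<open>\<mu>\<close> concerns the
  remainder only. The obstacle there is that the thresholds are functions of the same noise. Each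
  summand is therefore bounded pointwise by a quantity that knows its threshold only through the end
  points of the admissible range; this removes the dependence before any expectation is taken and
  treats both threshold rules at once. The condition \<gamma> > 1/2 enters twice: it makes
  \<open>1 / (1 + 2 * \<gamma>)\<close> smaller than 1/2, and \<open>n powr (- \<gamma>)\<close>
  smaller than any multiple of \<open>1 / sqrt n\<close>. The first exponent arises at each level by
  interpolating between the number \<open>2 ^ j\<close> of coefficients and their energy, which is
  of order \<open>n * 2 powr (- 2 * \<gamma> * j)\<close> in noise units.\<close>

definition gauss_seq :: "(nat \<Rightarrow> real) measure" where
  "gauss_seq = (\<Pi>\<^sub>M l\<in>UNIV. std_normal_distribution)"

interpretation std_normal: prob_space std_normal_distribution
  by (rule prob_space_normal_density) simp

interpretation gauss_prod: product_prob_space "\<lambda>_::nat. std_normal_distribution" UNIV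
  by unfold_locales

interpretation gauss: prob_space gauss_seq
  unfolding gauss_seq_def by (rule gauss_prod.prob_space_axioms)

lemma space_gauss_seq [simp]: "space gauss_seq = UNIV"
  by (simp add: gauss_seq_def space_PiM)

lemma sets_gauss_seq [measurable_cong]: "sets gauss_seq = sets (\<Pi>\<^sub>M l\<in>(UNIV::nat set). (borel::real measure))"
  unfolding gauss_seq_def by (intro sets_PiM_cong) auto

lemma gauss_coordinate_measurable [measurable]: "(\<lambda>\<omega>. \<omega> i) \<in> borel_measurable gauss_seq"
  by measurable

lemma distr_gauss_coordinate: "distr gauss_seq borel (\<lambda>\<omega>. \<omega> i) = std_normal_distribution"
proof -
  have "distr gauss_seq borel (\<lambda>\<omega>. \<omega> i) = distr gauss_seq std_normal_distribution (\<lambda>\<omega>. \<omega> i)"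
    by (intro distr_cong) auto
  also have "\<dots> = std_normal_distribution"
    unfolding gauss_seq_def by (rule gauss_prod.PiM_component) simp
  finally show ?thesis .
qed

lemma indep_gauss_coordinates:
  "gauss.indep_vars (\<lambda>_. borel) (\<lambda>i \<omega>. \<omega> i) UNIV"
proof (subst gauss.indep_vars_iff_distr_eq_PiM)
  have "distr gauss_seq (\<Pi>\<^sub>M i\<in>UNIV. borel) (\<lambda>x. \<lambda>i\<in>UNIV. x i) = distr gauss_seq gauss_seq (\<lambda>x. x)"
    by (intro distr_cong) (auto simp: sets_gauss_seq)
  also have "\<dots> = gauss_seq" by simp
  also have "\<dots> = (\<Pi>\<^sub>M i\<in>UNIV. distr gauss_seq borel (\<lambda>\<omega>. \<omega> i))"
    unfolding distr_gauss_coordinate by (simp add: gauss_seq_def)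
  finally show "distr gauss_seq (\<Pi>\<^sub>M i\<in>UNIV. borel) (\<lambda>x. \<lambda>i\<in>UNIV. x i) =
    (\<Pi>\<^sub>M i\<in>UNIV. distr gauss_seq borel (\<lambda>\<omega>. \<omega> i))" .
qed auto

lemma gauss_integrable_coordinate:
  fixes g :: "real \<Rightarrow> real"
  assumes "g \<in> borel_measurable borel"
  shows "integrable gauss_seq (\<lambda>\<omega>. g (\<omega> i)) \<longleftrightarrow> integrable lborel (\<lambda>x. std_normal_density x * g x)"
proof -
  have "integrable gauss_seq (\<lambda>\<omega>. g (\<omega> i)) \<longleftrightarrow> integrable (distr gauss_seq borel (\<lambda>\<omega>. \<omega> i)) g"
    using assms by (subst integrable_distr_eq) auto
  then show ?thesis
    unfolding distr_gauss_coordinate using assms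
    by (subst (asm) integrable_real_density) auto
qed

lemma gauss_integral_coordinate:
  fixes g :: "real \<Rightarrow> real"
  assumes "g \<in> borel_measurable borel"
  shows "(\<integral>\<omega>. g (\<omega> i) \<partial>gauss_seq) = (\<integral>x. std_normal_density x * g x \<partial>lborel)"
proof -
  have "(\<integral>\<omega>. g (\<omega> i) \<partial>gauss_seq) = (\<integral>x. g x \<partial>distr gauss_seq borel (\<lambda>\<omega>. \<omega> i))"
    using assms by (subst integral_distr) auto
  then show ?thesis
    unfolding distr_gauss_coordinate using assms
    by (subst (asm) integral_real_density) auto
qed

lemma gauss_integrable_power: "integrable gauss_seq (\<lambda>\<omega>. \<omega> i ^ m)"
  by (subst gauss_integrable_coordinate[where g="\<lambda>x. x ^ m"]) (auto intro: integrable_std_normal_moment)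

lemma gauss_integrable_id [simp]: "integrable gauss_seq (\<lambda>\<omega>. \<omega> i)"
  using gauss_integrable_power[of i 1] by simp

lemma gauss_integrable_square [simp]: "integrable gauss_seq (\<lambda>\<omega>. (\<omega> i)\<^sup>2)"
  by (rule gauss_integrable_power)

lemma gauss_moments:
  "(\<integral>\<omega>. \<omega> i \<partial>gauss_seq) = 0" "(\<integral>\<omega>. (\<omega> i)\<^sup>2 \<partial>gauss_seq) = 1" "(\<integral>\<omega>. (\<omega> i) ^ 4 \<partial>gauss_seq) = 3"
proof -
  show "(\<integral>\<omega>. \<omega> i \<partial>gauss_seq) = 0"
    using gauss_integral_coordinate[of "\<lambda>x. x" i] integral_std_normal_moment_odd[of 0] by simp
  show "(\<integral>\<omega>. (\<omega> i)\<^sup>2 \<partial>gauss_seq) = 1"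
    using gauss_integral_coordinate[of "\<lambda>x. x\<^sup>2" i] integral_std_normal_moment_even[of 1] by simp
  show "(\<integral>\<omega>. (\<omega> i) ^ 4 \<partial>gauss_seq) = 3"
    using gauss_integral_coordinate[of "\<lambda>x. x ^ 4" i] integral_std_normal_moment_even[of 2]
    by (simp add: fact_numeral)
qed

text \<open>Independence of the affine images of the coordinates makes their joint law the product
  of one-dimensional normal laws.\<close>

lemma coef_law_eq_distr:
  assumes "0 < \<sigma>" "0 < n"
  shows "coef_law \<sigma> n \<mu> =
    distr gauss_seq (data_space n) (\<lambda>\<omega>. \<lambda>l\<in>{1..n}. \<mu> l + \<sigma> / sqrt (real n) * \<omega> l)"
proof -
  define s where "s = \<sigma> / sqrt (real n)"
  have s: "s > 0" using assms by (simp add: s_def)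
  have ind: "gauss.indep_vars (\<lambda>_. borel) (\<lambda>l \<omega>. \<mu> l + s * \<omega> l) {1..n}"
    by (rule gauss.indep_vars_compose2[OF gauss.indep_vars_subset[OF indep_gauss_coordinates], where Y="\<lambda>l x. \<mu> l + s * x"])
       auto
  have law: "distr gauss_seq borel (\<lambda>\<omega>. \<mu> l + s * \<omega> l) = density lborel (normal_density (\<mu> l) s)" for l
  proof -
    have "distributed gauss_seq lborel (\<lambda>\<omega>. \<omega> l) std_normal_density"
      unfolding distributed_def using distr_gauss_coordinate[of l]
      by (auto cong: distr_cong simp: distr_cong[of gauss_seq gauss_seq lborel borel])
    from gauss.normal_density_affine[OF this, of s "\<mu> l"] s
    have "distributed gauss_seq lborel (\<lambda>\<omega>. \<mu> l + s * \<omega> l) (normal_density (\<mu> l) s)" by simp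
    then have "distr gauss_seq lborel (\<lambda>\<omega>. \<mu> l + s * \<omega> l) = density lborel (normal_density (\<mu> l) s)"
      by (simp add: distributed_def)
    then show ?thesis by (metis (no_types, lifting) distr_cong sets_lborel)
  qed
  have "coef_law \<sigma> n \<mu> = (\<Pi>\<^sub>M l\<in>{1..n}. distr gauss_seq borel (\<lambda>\<omega>. \<mu> l + s * \<omega> l))"
    unfolding coef_law_def law unfolding s_def ..
  also have "\<dots> = distr gauss_seq (data_space n) (\<lambda>\<omega>. \<lambda>l\<in>{1..n}. \<mu> l + s * \<omega> l)"
    using assms ind by (subst (asm) gauss.indep_vars_iff_distr_eq_PiM) auto
  finally show ?thesis by (simp add: s_def)
qed

lemma gauss_product_moment:
  "integrable gauss_seq (\<lambda>\<omega>. \<omega> i * \<omega> j)"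
  "(\<integral>\<omega>. \<omega> i * \<omega> j \<partial>gauss_seq) = of_bool (i = j)"
proof -
  have "integrable gauss_seq (\<lambda>\<omega>. \<omega> i * \<omega> j) \<and>
    (\<integral>\<omega>. \<omega> i * \<omega> j \<partial>gauss_seq) = of_bool (i = j)"
  proof (cases "i = j")
    case True
    then show ?thesis
      using gauss_integrable_square[of j] gauss_moments(2)[of j] by (simp add: power2_eq_square)
  next
    case False
    have ind: "gauss.indep_vars (\<lambda>_. borel) (\<lambda>i \<omega>. \<omega> i) {i, j}"
      by (rule gauss.indep_vars_subset[OF indep_gauss_coordinates]) simp
    show ?thesis
      using gauss.indep_vars_integrable[OF _ ind] gauss.indep_vars_lebesgue_integral[OF _ ind]
        False gauss_moments(1) by simp
  qed
  then show "integrable gauss_seq (\<lambda>\<omega>. \<omega> i * \<omega> j)"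
    "(\<integral>\<omega>. \<omega> i * \<omega> j \<partial>gauss_seq) = of_bool (i = j)" by auto
qed

lemma gauss_linear_combination_square:
  assumes "finite I"
  shows "integrable gauss_seq (\<lambda>\<omega>. (\<Sum>l\<in>I. a l * \<omega> l)\<^sup>2)"
    and "(\<integral>\<omega>. (\<Sum>l\<in>I. a l * \<omega> l)\<^sup>2 \<partial>gauss_seq) = (\<Sum>l\<in>I. (a l)\<^sup>2)"
proof -
  have eq: "(\<Sum>l\<in>I. a l * \<omega> l)\<^sup>2 = (\<Sum>l\<in>I. \<Sum>m\<in>I. (a l * a m) * (\<omega> l * \<omega> m))"
    for \<omega> :: "nat \<Rightarrow> real"
    by (simp add: power2_eq_square sum_product algebra_simps)
  show "integrable gauss_seq (\<lambda>\<omega>. (\<Sum>l\<in>I. a l * \<omega> l)\<^sup>2)"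
    unfolding eq by (intro Bochner_Integration.integrable_sum integrable_mult_right gauss_product_moment)
  have "(\<integral>\<omega>. (\<Sum>l\<in>I. a l * \<omega> l)\<^sup>2 \<partial>gauss_seq) = (\<Sum>l\<in>I. \<Sum>m\<in>I. (a l * a m) * of_bool (l = m))"
    unfolding eq
    by (subst Bochner_Integration.integral_sum, intro Bochner_Integration.integrable_sum integrable_mult_right gauss_product_moment)
       (intro sum.cong refl, subst Bochner_Integration.integral_sum,
        auto intro!: integrable_mult_right gauss_product_moment sum.cong simp: gauss_product_moment)
  also have "\<dots> = (\<Sum>l\<in>I. (a l)\<^sup>2)"
    using assms by (auto simp: power2_eq_square intro!: sum.cong)
  finally show "(\<integral>\<omega>. (\<Sum>l\<in>I. a l * \<omega> l)\<^sup>2 \<partial>gauss_seq) = (\<Sum>l\<in>I. (a l)\<^sup>2)" .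
qed

text \<open>Density times exponential is, up to the factor \<open>s\<close>, the centred normal
  density of variance \<open>1 / (1 - \<theta>)\<close>. This moment later carries the tail bound
  for noise above the threshold.\<close>

lemma gauss_integrable_exp_square:
  assumes "\<theta> < 1"
  shows "integrable gauss_seq (\<lambda>\<omega>. exp (\<theta> * (\<omega> i)\<^sup>2 / 2))"
proof (subst gauss_integrable_coordinate[where g = "\<lambda>x. exp (\<theta> * x\<^sup>2 / 2)"])
  define s where "s = 1 / sqrt (1 - \<theta>)"
  have s: "s > 0" and s2: "s\<^sup>2 = 1 / (1 - \<theta>)" using assms by (auto simp: s_def power_divide)
  have "std_normal_density x * exp (\<theta> * x\<^sup>2 / 2) = s * normal_density 0 s x" for x
  proof -
    have "exp (- x\<^sup>2 / 2) * exp (\<theta> * x\<^sup>2 / 2) = exp (- x\<^sup>2 / (2 * s\<^sup>2))"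
      using assms unfolding exp_add[symmetric] s2 by (simp add: field_simps)
    moreover have "s / sqrt (2 * pi * s\<^sup>2) = 1 / sqrt (2 * pi)"
      using s by (simp add: real_sqrt_mult)
    ultimately show ?thesis
      unfolding normal_density_def by (simp add: field_simps)
  qed
  then show "integrable lborel (\<lambda>x. std_normal_density x * exp (\<theta> * x\<^sup>2 / 2))"
    using integrable_normal_density[of s 0] s by simp
qed auto

section \<open>Normal quantiles and the central limit theorem for the leading term\<close>

lemma std_normal_singleton_null: "measure std_normal_distribution {x} = 0"
proof -
  have "emeasure std_normal_distribution {x} = 0"
    by (subst emeasure_density) (auto intro!: nn_integral_null_set)
  then show ?thesis by (simp add: measure_def)
qed

interpretation std_normal_real: real_distribution std_normal_distribution
  by (rule real_dist_normal_dist)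

lemma isCont_std_normal_cdf: "isCont (cdf std_normal_distribution) x"
  by (simp add: std_normal_real.isCont_cdf std_normal_singleton_null)

lemma measure_std_normal_greaterThan:
  "measure std_normal_distribution {z<..} = 1 - cdf std_normal_distribution z"
proof -
  have "{z<..} = space std_normal_distribution - {..z}" by auto
  then show ?thesis
    unfolding cdf_def2 using std_normal.prob_compl[of "{..z}"] by simp
qed

text \<open>Since the density is positive, an interval of measure zero would be Lebesgue null.
  Strictness is what makes the quantile, a definite description, unique.\<close>

lemma std_normal_cdf_strict_mono:
  assumes "x < y"
  shows "cdf std_normal_distribution x < cdf std_normal_distribution y"
proof -
  have "emeasure std_normal_distribution {x<..y} \<noteq> 0"
  proof
    assume "emeasure std_normal_distribution {x<..y} = 0"
    then have "(\<integral>\<^sup>+ u. ennreal (std_normal_density u) * indicator {x<..y} u \<partial>lborel) = 0"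
      by (subst (asm) emeasure_density) auto
    then have "AE u in lborel. ennreal (std_normal_density u) * indicator {x<..y} u = 0"
      by (subst (asm) nn_integral_0_iff_AE) auto
    then have "AE u in lborel. u \<notin> {x<..y}"
      by (rule eventually_mono)
         (metis ennreal_eq_0_iff indicator_simps(1) mult.right_neutral normal_density_pos not_le zero_less_one)
    then have "emeasure lborel {x<..y} = 0"
      by (subst (asm) AE_iff_measurable[of "{x<..y}"]) auto
    then show False using assms by simp
  qed
  then have "measure std_normal_distribution {x<..y} > 0"
    by (simp add: std_normal.emeasure_eq_measure zero_less_measure_iff)
  then show ?thesis
    using std_normal_real.cdf_diff_eq[OF assms] by simp
qed

text \<open>Continuity together with the limits 0 and 1 gives existence, strict monotonicity gives
  uniqueness.\<close>

lemma std_normal_cdf_quantile: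
  assumes "0 < \<alpha>" "\<alpha> < 1"
  shows "cdf std_normal_distribution (upper_normal_quantile \<alpha>) = 1 - \<alpha>"
proof -
  let ?F = "cdf std_normal_distribution"
  have "eventually (\<lambda>x. ?F x < 1 - \<alpha>) at_bot" "eventually (\<lambda>x. ?F x > 1 - \<alpha>) at_top"
    using order_tendstoD(2)[OF std_normal_real.cdf_lim_at_bot, of "1 - \<alpha>"]
      order_tendstoD(1)[OF std_normal_real.cdf_lim_at_top_prob, of "1 - \<alpha>"] assms by auto
  then obtain a b where ab: "\<And>x. x \<le> a \<Longrightarrow> ?F x < 1 - \<alpha>" "\<And>x. b \<le> x \<Longrightarrow> ?F x > 1 - \<alpha>"
    by (auto simp: eventually_at_bot_linorder eventually_at_top_linorder)
  have "a \<le> max a b" by simp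
  then obtain z where z: "?F z = 1 - \<alpha>"
    using IVT[of ?F a "1 - \<alpha>" "max a b"] ab(1)[of a] ab(2)[of "max a b"] isCont_std_normal_cdf
    by (metis less_eq_real_def max.cobounded2 order_refl)
  have "\<exists>!z. measure std_normal_distribution {z<..} = \<alpha>"
    unfolding measure_std_normal_greaterThan
  proof (rule ex1I[of _ z])
    show "w = z" if "1 - ?F w = \<alpha>" for w
      using that z std_normal_cdf_strict_mono[of w z] std_normal_cdf_strict_mono[of z w] by linarith
  qed (use z in simp)
  then have "measure std_normal_distribution {upper_normal_quantile \<alpha><..} = \<alpha>"
    unfolding upper_normal_quantile_def by (rule theI')
  then show ?thesis by (simp add: measure_std_normal_greaterThan)
qed

text \<open>\<open>1 - (\<omega> l)\<^sup>2\<close> has mean 0 and variance 2, so this is a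
  standardised chi-square variable with reversed sign, the sign with which the noise enters loss
  minus risk estimate.\<close>

definition chi_sum :: "nat \<Rightarrow> (nat \<Rightarrow> real) \<Rightarrow> real" where
  "chi_sum n \<omega> = (\<Sum>l=1..n. 1 - (\<omega> l)\<^sup>2) / sqrt (2 * real n)"

lemma chi_sum_measurable [measurable]: "chi_sum n \<in> borel_measurable gauss_seq"
  unfolding chi_sum_def by measurable

lemma chi_sum_clt:
  "(\<lambda>n. measure gauss_seq {\<omega>. chi_sum n \<omega> \<le> x}) \<longlonglongrightarrow> cdf std_normal_distribution x"
proof -
  \<comment> \<open>The limit theorem sums over \<open>i < n\<close>, \<open>chi_sum\<close> over
    \<open>1..n\<close>; hence the shift by one.\<close>
  define X :: "nat \<Rightarrow> (nat \<Rightarrow> real) \<Rightarrow> real" where "X i \<omega> = 1 - (\<omega> (Suc i))\<^sup>2" for i \<omega>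
  have sq: "(X i \<omega>)\<^sup>2 = 1 - 2 * (\<omega> (Suc i))\<^sup>2 + (\<omega> (Suc i)) ^ 4" for i \<omega>
    by (simp add: X_def power2_eq_square power4_eq_xxxx algebra_simps)
  have ind: "gauss.indep_vars (\<lambda>_. borel) X UNIV"
  proof -
    \<comment> \<open>Singleton blocks reindex the coordinates by \<open>Suc\<close>; a function of
      each block keeps independence.\<close>
    have "gauss.indep_vars (\<lambda>j. \<Pi>\<^sub>M i\<in>{Suc j}. borel)
       (\<lambda>j \<omega>. restrict (\<lambda>i. \<omega> i) {Suc j}) (UNIV::nat set)"
      by (rule gauss.indep_vars_restrict[OF indep_gauss_coordinates])
         (auto simp: disjoint_family_on_def)
    then have "gauss.indep_vars (\<lambda>_. borel)
       (\<lambda>j \<omega>. 1 - (restrict (\<lambda>i. \<omega> i) {Suc j} (Suc j))\<^sup>2) (UNIV::nat set)"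
      by (rule gauss.indep_vars_compose2[where Y = "\<lambda>j x. 1 - (x (Suc j))\<^sup>2"]) measurable
    then show ?thesis by (simp add: X_def[abs_def])
  qed
  have mean: "gauss.expectation (X i) = 0" for i
    unfolding X_def by (subst Bochner_Integration.integral_diff) (use gauss.prob_space in \<open>auto simp: gauss_moments\<close>)
  have int: "integrable gauss_seq (\<lambda>\<omega>. (X i \<omega>)\<^sup>2)" for i
    unfolding sq by (intro Bochner_Integration.integrable_add Bochner_Integration.integrable_diff
        integrable_mult_right gauss_integrable_power gauss_integrable_square) auto
  have var: "gauss.variance (X i) = (sqrt 2)\<^sup>2" for i
    unfolding mean using gauss_integrable_power[of "Suc i" 4] gauss.prob_space
    by (simp add: sq gauss_moments)
  have dist: "distr gauss_seq borel (X i) = distr std_normal_distribution borel (\<lambda>x. 1 - x\<^sup>2)" for i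
    unfolding distr_gauss_coordinate[of "Suc i", symmetric]
    by (subst distr_distr) (auto simp: comp_def X_def[abs_def])
  have "weak_conv_m (\<lambda>n. distr gauss_seq borel (\<lambda>\<omega>. (\<Sum>i<n. X i \<omega>) / sqrt (real n * (sqrt 2)\<^sup>2)))
      std_normal_distribution"
    by (rule gauss.central_limit_theorem_zero_mean[OF ind mean _ int var dist]) simp
  then have "(\<lambda>n. cdf (distr gauss_seq borel (\<lambda>\<omega>. (\<Sum>i<n. X i \<omega>) / sqrt (real n * (sqrt 2)\<^sup>2))) x)
     \<longlonglongrightarrow> cdf std_normal_distribution x"
    unfolding weak_conv_m_def weak_conv_def using isCont_std_normal_cdf by blast
  moreover have "(\<Sum>i<n. X i \<omega>) / sqrt (real n * (sqrt 2)\<^sup>2) = chi_sum n \<omega>" for n \<omega>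
    unfolding chi_sum_def X_def
    by (simp add: mult.commute sum.shift_bounds_cl_Suc_ivl[symmetric] lessThan_Suc_atMost atLeast0LessThan
        sum.atLeast1_atMost_eq)
  ultimately have "(\<lambda>n. cdf (distr gauss_seq borel (chi_sum n)) x)
     \<longlonglongrightarrow> cdf std_normal_distribution x" by simp
  moreover have "cdf (distr gauss_seq borel (chi_sum n)) x = measure gauss_seq {\<omega>. chi_sum n \<omega> \<le> x}" for n
    unfolding cdf_def2 by (subst measure_distr) (auto simp: vimage_def)
  ultimately show ?thesis by simp
qed

section \<open>Uniform coverage in the sequence model\<close>

text \<open>Level \<open>j\<close> occupies exactly the block from \<open>2 ^ j + 1\<close> to
  \<open>2 ^ Suc j\<close>, so consecutive levels follow each other without gaps.\<close>

lemma sum_dyadic_levels: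
  fixes F :: "nat \<Rightarrow> 'a::comm_monoid_add"
  assumes "J0 \<le> J1"
  shows "(\<Sum>l=2 ^ J0 + 1..sample_size J1. F l) = (\<Sum>j=J0..J1. \<Sum>k<2 ^ j. F (2 ^ j + k + 1))"
proof -
  have step: "(\<Sum>l=2 ^ j + 1..2 ^ Suc j. F l) = (\<Sum>k<2 ^ j. F (2 ^ j + k + 1))" for j
    by (rule sum.reindex_bij_witness[of _ "\<lambda>k. 2 ^ j + k + 1" "\<lambda>l. l - 2 ^ j - 1"]) auto
  have "(\<Sum>l=2 ^ J0 + 1..2 ^ Suc J1. F l) = (\<Sum>j=J0..J1. \<Sum>k<2 ^ j. F (2 ^ j + k + 1))"
    using assms
  proof (induction J1 rule: dec_induct)
    case base
    then show ?case using step[of J0] by simp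
  next
    case (step m)
    have le: "(2::nat) ^ J0 \<le> 2 ^ Suc m"
      using step.hyps by (intro power_increasing) auto
    have "{2 ^ J0 + 1..2 ^ Suc (Suc m)} = {2 ^ J0 + 1..2 ^ Suc m} \<union> {2 ^ Suc m + 1..(2::nat) ^ Suc (Suc m)}"
      using le by auto
    then have "(\<Sum>l=2 ^ J0 + 1..2 ^ Suc (Suc m). F l) =
      (\<Sum>l=2 ^ J0 + 1..2 ^ Suc m. F l) + (\<Sum>l=2 ^ Suc m + 1..2 ^ Suc (Suc m). F l)"
      by (simp only:) (subst sum.union_disjoint, auto)
    then show ?case
      using step.IH step.hyps \<open>\<And>j. (\<Sum>l=2 ^ j + 1..2 ^ Suc j. F l) = (\<Sum>k<2 ^ j. F (2 ^ j + k + 1))\<close>[of "Suc m"]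
      by (simp add: sum.cl_ivl_Suc)
  qed
  then show ?thesis by (simp add: sample_size_def)
qed

lemma sum_father_wavelet:
  fixes F :: "nat \<Rightarrow> 'a::comm_monoid_add"
  assumes "J0 \<le> J1"
  shows "(\<Sum>l=1..sample_size J1. F l) = (\<Sum>l=1..2 ^ J0. F l) + (\<Sum>l=2 ^ J0 + 1..sample_size J1. F l)"
proof -
  have "(2::nat) ^ J0 \<le> sample_size J1"
    using assms unfolding sample_size_def by (intro power_increasing) auto
  then have "{1..sample_size J1} = {1..2 ^ J0} \<union> {2 ^ J0 + 1..sample_size J1}" by auto
  then show ?thesis by (simp only:) (subst sum.union_disjoint, auto)
qed

lemma wavelet_index_cases:
  assumes "2 ^ J0 < l" "l \<le> sample_size J1"
  obtains k where "level l \<in> {J0..J1}" "k < 2 ^ level l" "l = 2 ^ level l + k + 1"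
proof -
  have l: "0 < l - 1" using assms(1) one_le_power[of "2::nat" J0] by linarith
  have "2 ^ level l \<le> l - 1" "l - 1 < 2 * 2 ^ level l"
    unfolding level_def using floor_log_exp2_le[OF l] floor_log_exp2_gt[of "l - 1"] by auto
  moreover from calculation have "(2::nat) ^ J0 < 2 ^ Suc (level l)" "(2::nat) ^ level l < 2 ^ Suc J1"
    using assms unfolding sample_size_def by auto
  then have "J0 < Suc (level l)" "level l < Suc J1"
    by (metis one_less_numeral_iff power_less_imp_less_exp semiring_norm(76))+
  ultimately show ?thesis
    using that[of "l - 1 - 2 ^ level l"] l by auto
qed

section \<open>Soft thresholding and its risk estimate for one coefficient\<close>

lemma soft_scale: "0 < s \<Longrightarrow> soft (s * r) (s * x) = s * soft r x"
  by (auto simp: soft_def abs_mult sgn_mult max_def algebra_simps)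

lemma abs_soft_diff_le:
  assumes "0 \<le> r"
  shows "\<bar>soft r x - x\<bar> \<le> r"
  using assms by (auto simp: soft_def max_def sgn_if)

lemma abs_soft: "0 \<le> r \<Longrightarrow> \<bar>soft r x\<bar> = max (\<bar>x\<bar> - r) 0"
  by (auto simp: soft_def max_def sgn_if)

text \<open>Soft thresholding subtracts the clipped value of the observation; after completing the
  square the leading noise term changes sign, because almost all coefficients are below the
  threshold.\<close>

lemma soft_loss_minus_sure:
  fixes s r \<tau> w :: real
  assumes "0 < s" "0 \<le> r"
  defines "x \<equiv> \<tau> + w"
  shows "(s * \<tau> - soft (s * r) (s * x))\<^sup>2 -
      (s\<^sup>2 - 2 * s\<^sup>2 * of_bool (\<bar>s * x\<bar> \<le> s * r) + min ((s * x)\<^sup>2) ((s * r)\<^sup>2))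
    = s\<^sup>2 * ((1 - w\<^sup>2) + 2 * (w * (soft r x - \<tau>) - of_bool (r < \<bar>x\<bar>)))"
proof -
  have le: "\<bar>s * x\<bar> \<le> s * r \<longleftrightarrow> \<bar>x\<bar> \<le> r" using assms(1) by (simp add: abs_mult)
  have m: "min ((s * x)\<^sup>2) ((s * r)\<^sup>2) = s\<^sup>2 * min (x\<^sup>2) (r\<^sup>2)"
    using assms(1) by (simp add: power_mult_distrib min_mult_distrib_left)
  have m2: "min (x\<^sup>2) (r\<^sup>2) = (if \<bar>x\<bar> \<le> r then x\<^sup>2 else r\<^sup>2)"
    using assms(2) by (auto simp: min_def abs_le_square_iff[symmetric])
  have w: "w = x - \<tau>" by (simp add: x_def)
  have "(\<tau> - soft r x)\<^sup>2 - (1 - 2 * of_bool (\<bar>x\<bar> \<le> r) + min (x\<^sup>2) (r\<^sup>2))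
    = (1 - w\<^sup>2) + 2 * (w * (soft r x - \<tau>) - of_bool (r < \<bar>x\<bar>))"
    unfolding m2 w using assms(2)
    by (auto simp: soft_def max_def sgn_if power2_eq_square algebra_simps)
  then have "s\<^sup>2 * ((\<tau> - soft r x)\<^sup>2 - (1 - 2 * of_bool (\<bar>x\<bar> \<le> r) + min (x\<^sup>2) (r\<^sup>2)))
    = s\<^sup>2 * ((1 - w\<^sup>2) + 2 * (w * (soft r x - \<tau>) - of_bool (r < \<bar>x\<bar>)))" by simp
  moreover have "(s * \<tau> - s * soft r x)\<^sup>2 = s\<^sup>2 * (\<tau> - soft r x)\<^sup>2"
    by (simp add: power2_eq_square algebra_simps)
  ultimately show ?thesis
    unfolding soft_scale[OF assms(1)] le m by (simp only: ring_distribs mult_1_right)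
qed

text \<open>Soft thresholding moves the observation by at most \<open>r\<close>, so its error is at
  most \<open>r1 + \<bar>w\<bar>\<close>, whatever \<open>\<tau>\<close> is. Only the upper end
  \<open>r1\<close> survives, which lets the threshold depend on the noise.\<close>

lemma remainder_large_bound:
  fixes r r1 \<tau> w :: real
  assumes "0 \<le> r" "r \<le> r1"
  shows "\<bar>w * (soft r (\<tau> + w) - \<tau>) - of_bool (r < \<bar>\<tau> + w\<bar>)\<bar> \<le> (1 + r1) * (1 + w\<^sup>2)"
proof -
  have "\<bar>soft r (\<tau> + w) - \<tau>\<bar> \<le> r1 + \<bar>w\<bar>"
    using abs_soft_diff_le[OF assms(1), of "\<tau> + w"] assms(2) by linarith
  then have "\<bar>w * (soft r (\<tau> + w) - \<tau>)\<bar> \<le> \<bar>w\<bar> * (r1 + \<bar>w\<bar>)"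
    by (simp add: abs_mult mult_left_mono)
  also have "\<dots> = r1 * \<bar>w\<bar> + w\<^sup>2" by (simp add: power2_eq_square algebra_simps)
  also have "r1 * \<bar>w\<bar> \<le> r1 * (1 + w\<^sup>2)"
  proof (intro mult_left_mono)
    have "0 \<le> (\<bar>w\<bar> - 1)\<^sup>2" by simp
    then show "\<bar>w\<bar> \<le> 1 + w\<^sup>2" by (simp add: power2_eq_square algebra_simps)
  qed (use assms in auto)
  finally have "\<bar>w * (soft r (\<tau> + w) - \<tau>)\<bar> \<le> r1 * (1 + w\<^sup>2) + w\<^sup>2" by simp
  moreover have "(1 + r1) * (1 + w\<^sup>2) = r1 * (1 + w\<^sup>2) + w\<^sup>2 + 1" by (simp add: algebra_simps)
  ultimately show ?thesis
    by (simp only: abs_le_iff of_bool_def split: if_splits) linarith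
qed

text \<open>Below the threshold the estimate vanishes, and adding \<open>\<tau> * w\<close> leaves
  exactly 0. Above it the noise has size at least \<open>a\<close>, because the coefficient accounts
  for at most \<open>A\<close>; the rate \<theta> then buys the factor
  \<open>exp (- \<theta> * a\<^sup>2 / 2)\<close>, and the extra rate \<open>t\<close> pays for
  quadratic growth in \<open>w\<close>.\<close>

lemma remainder_small_bound:
  fixes r r0 A \<tau> w :: real
  assumes "r0 \<le> r" "\<bar>\<tau>\<bar> \<le> A" "a \<le> r0 - A" "1 \<le> a" "0 < \<theta>" "0 < t"
  shows "\<bar>w * (soft r (\<tau> + w) - \<tau>) - of_bool (r < \<bar>\<tau> + w\<bar>) + \<tau> * w\<bar>
     \<le> 4 / t * exp (- \<theta> * a\<^sup>2 / 2) * exp ((\<theta> + t) * w\<^sup>2 / 2)"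
proof (cases "r < \<bar>\<tau> + w\<bar>")
  case False
  then have "soft r (\<tau> + w) = 0" by (auto simp: soft_def)
  then show ?thesis using False assms by simp
next
  case True
  have r: "0 \<le> r" using assms by linarith
  have w: "a \<le> \<bar>w\<bar>" using True assms by linarith
  \<comment> \<open>The coefficient is smaller than the threshold, so subtracting \<open>r\<close>
    more than removes it.\<close>
  have "\<bar>soft r (\<tau> + w)\<bar> \<le> \<bar>w\<bar>"
    unfolding abs_soft[OF r] using True assms by auto
  then have 1: "\<bar>w * soft r (\<tau> + w)\<bar> \<le> w\<^sup>2"
    by (simp add: abs_mult power2_eq_square) (metis abs_ge_zero abs_mult abs_mult_self_eq mult_left_mono)
  have "a\<^sup>2 \<le> \<bar>w\<bar>\<^sup>2" using w assms by (intro power_mono) auto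
  then have a2: "a\<^sup>2 \<le> w\<^sup>2" by simp
  moreover have "1 \<le> a\<^sup>2" using assms by simp
  ultimately have 2: "1 \<le> w\<^sup>2" by linarith
  \<comment> \<open>A square is traded for an exponential of small rate \<open>t\<close>.\<close>
  have "t * w\<^sup>2 / 2 \<le> exp (t * w\<^sup>2 / 2)"
    using exp_ge_add_one_self[of "t * w\<^sup>2 / 2"] by linarith
  then have 3: "2 * w\<^sup>2 \<le> 4 / t * exp (t * w\<^sup>2 / 2)"
    using assms by (simp add: field_simps)
  \<comment> \<open>The exponential majorant of the indicator of
    \<open>a\<^sup>2 \<le> w\<^sup>2\<close>.\<close>
  have 4: "1 \<le> exp (- \<theta> * a\<^sup>2 / 2) * exp (\<theta> * w\<^sup>2 / 2)"
    unfolding exp_add[symmetric] using a2 assms by (simp add: field_simps)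
  have "\<bar>w * (soft r (\<tau> + w) - \<tau>) - of_bool (r < \<bar>\<tau> + w\<bar>) + \<tau> * w\<bar> = \<bar>w * soft r (\<tau> + w) - 1\<bar>"
    using True by (simp add: algebra_simps)
  also have "\<dots> \<le> 2 * w\<^sup>2" using 1 2 by linarith
  also have "\<dots> \<le> (4 / t * exp (t * w\<^sup>2 / 2)) * (exp (- \<theta> * a\<^sup>2 / 2) * exp (\<theta> * w\<^sup>2 / 2))"
  proof -
    have "(2 * w\<^sup>2) * 1 \<le> (4 / t * exp (t * w\<^sup>2 / 2)) * (exp (- \<theta> * a\<^sup>2 / 2) * exp (\<theta> * w\<^sup>2 / 2))"
      by (rule mult_mono[OF 3 4]) (use assms in auto)
    then show ?thesis by simp
  qed
  also have "\<dots> = 4 / t * exp (- \<theta> * a\<^sup>2 / 2) * exp ((\<theta> + t) * w\<^sup>2 / 2)"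
    by (simp add: exp_add[symmetric] algebra_simps add_divide_distrib)
  finally show ?thesis .
qed

section \<open>The coverage event in terms of the noise\<close>

lemma sample_size_pos [simp]: "0 < sample_size J1"
  by (simp add: sample_size_def)

text \<open>Father coefficients are not thresholded and contribute \<open>w\<^sup>2 - 1\<close> to
  loss minus risk estimate. Writing this as \<open>(1 - w\<^sup>2) + 2 * (w\<^sup>2 - 1)\<close>
  lets the leading sum run over all \<open>n\<close> coefficients.\<close>

definition remainder :: "nat \<Rightarrow> (nat \<Rightarrow> real) \<Rightarrow> (nat \<Rightarrow> real) \<Rightarrow> (nat \<Rightarrow> real) \<Rightarrow> nat \<Rightarrow> real" where
  "remainder J0 r \<tau> w l =
     (if l \<le> 2 ^ J0 then (w l)\<^sup>2 - 1
      else w l * (soft (r (level l)) (\<tau> l + w l) - \<tau> l) - of_bool (r (level l) < \<bar>\<tau> l + w l\<bar>))"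

text \<open>The identity of \<open>soft_loss_minus_sure\<close> is summed and divided by
  \<open>s\<^sup>2 * sqrt (2 * n)\<close>; the margin that \<open>sq_radius\<close> adds to the risk
  estimate then becomes the quantile itself.\<close>

lemma loss_le_radius_iff:
  fixes \<mu> w :: "nat \<Rightarrow> real"
  assumes "0 < \<sigma>" "J0 \<le> J1"
  defines "n \<equiv> sample_size J1"
  defines "s \<equiv> \<sigma> / sqrt (real n)"
  defines "y \<equiv> \<lambda>l\<in>{1..n}. \<mu> l + s * w l"
  assumes "\<And>j. j \<in> {J0..J1} \<Longrightarrow> 0 \<le> t j"
  shows "(\<Sum>l=1..n. (\<mu> l - soft_estimate J0 t y l)\<^sup>2) \<le> sq_radius \<sigma> \<alpha> J0 J1 t y \<longleftrightarrow>
    chi_sum n w + 2 * (\<Sum>l=1..n. remainder J0 (\<lambda>j. t j / s) (\<lambda>l. \<mu> l / s) w l) / sqrt (2 * real n)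
      \<le> upper_normal_quantile \<alpha>"
proof -
  have n: "0 < n" by (simp add: n_def)
  have s: "0 < s" using assms(1) n by (simp add: s_def)
  have s2: "s\<^sup>2 = \<sigma>\<^sup>2 / real n" using n by (simp add: s_def power_divide)
  let ?r = "\<lambda>j. t j / s" and ?\<tau> = "\<lambda>l. \<mu> l / s"
  let ?S = "\<lambda>l. if l \<le> 2 ^ J0 then s\<^sup>2 else
      s\<^sup>2 - 2 * s\<^sup>2 * of_bool (\<bar>y l\<bar> \<le> t (level l)) + min ((y l)\<^sup>2) ((t (level l))\<^sup>2)"
  have J0n: "2 ^ J0 \<le> n"
    using assms(2) unfolding n_def sample_size_def by (intro power_increasing) auto
  have sure_eq: "sure \<sigma> J0 J1 t y = (\<Sum>l=1..n. ?S l)"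
  proof -
    have "(\<Sum>l=1..n. ?S l) = s\<^sup>2 * 2 ^ J0 + (\<Sum>j=J0..J1. \<Sum>k<2 ^ j. ?S (2 ^ j + k + 1))"
      unfolding n_def sum_father_wavelet[OF assms(2)] sum_dyadic_levels[OF assms(2)] by simp
    also have "(\<Sum>j=J0..J1. \<Sum>k<2 ^ j. ?S (2 ^ j + k + 1)) = (\<Sum>j=J0..J1. \<Sum>k<2 ^ j.
      s\<^sup>2 - 2 * s\<^sup>2 * of_bool (\<bar>y (2 ^ j + k + 1)\<bar> \<le> t j) + min ((y (2 ^ j + k + 1))\<^sup>2) ((t j)\<^sup>2))"
    proof (intro sum.cong refl)
      fix j k :: nat assume "j \<in> {J0..J1}" "k \<in> {..<2 ^ j}"
      then have le: "(2::nat) ^ J0 \<le> 2 ^ j" by (intro power_increasing) auto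
      have "level (2 ^ j + k + 1) = j" using \<open>k \<in> {..<2 ^ j}\<close> by (intro level_index) simp
      moreover have "\<not> 2 ^ j + k + 1 \<le> 2 ^ J0" using le by linarith
      ultimately      show "?S (2 ^ j + k + 1) =
        s\<^sup>2 - 2 * s\<^sup>2 * of_bool (\<bar>y (2 ^ j + k + 1)\<bar> \<le> t j) + min ((y (2 ^ j + k + 1))\<^sup>2) ((t j)\<^sup>2)"
        by (simp only: if_False)
    qed
    finally show ?thesis by (simp add: sure_def s2 n_def Let_def)
  qed
  have summand: "(\<mu> l - soft_estimate J0 t y l)\<^sup>2 - ?S l =
      s\<^sup>2 * ((1 - (w l)\<^sup>2) + 2 * remainder J0 ?r ?\<tau> w l)" if l: "l \<in> {1..n}" for l
  proof (cases "l \<le> 2 ^ J0")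
    case True
    then show ?thesis using l
      by (simp add: soft_estimate_def y_def remainder_def power2_eq_square algebra_simps)
  next
    case False
    then obtain k where "level l \<in> {J0..J1}"
      using l unfolding n_def by (meson wavelet_index_cases not_le atLeastAtMost_iff)
    then have r: "0 \<le> ?r (level l)" using assms(6) s by simp
    have "y l = s * (?\<tau> l + w l)" using l s by (simp add: y_def algebra_simps)
    moreover have "t (level l) = s * ?r (level l)" "\<mu> l = s * ?\<tau> l" using s by auto
    ultimately show ?thesis
      using soft_loss_minus_sure[OF s r, of "?\<tau> l" "w l"] False
      by (simp only: soft_estimate_def remainder_def if_False)
  qed
  have "(\<Sum>l=1..n. (\<mu> l - soft_estimate J0 t y l)\<^sup>2) - sure \<sigma> J0 J1 t y =
     s\<^sup>2 * (sqrt (2 * real n) * chi_sum n w + 2 * (\<Sum>l=1..n. remainder J0 ?r ?\<tau> w l))"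
  proof -
    have "sqrt (2 * real n) * chi_sum n w = (\<Sum>l=1..n. 1 - (w l)\<^sup>2)"
      using n by (simp add: chi_sum_def)
    moreover have "(\<Sum>l=1..n. (\<mu> l - soft_estimate J0 t y l)\<^sup>2) - (\<Sum>l=1..n. ?S l) =
      (\<Sum>l=1..n. s\<^sup>2 * ((1 - (w l)\<^sup>2) + 2 * remainder J0 ?r ?\<tau> w l))"
      unfolding sum_subtractf[symmetric] by (rule sum.cong[OF refl summand])
    ultimately show ?thesis
      unfolding sure_eq by (simp only: sum.distrib sum_distrib_left[symmetric])
  qed
  \<comment> \<open>Here the divisor \<open>sqrt (n / 2)\<close> of the radius matters: its product
    with \<open>sqrt (2 * n)\<close> is \<open>n\<close>.\<close>
  moreover have "\<sigma>\<^sup>2 * upper_normal_quantile \<alpha> / sqrt (real n / 2) =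
      s\<^sup>2 * (sqrt (2 * real n) * upper_normal_quantile \<alpha>)"
  proof -
    have "real n = sqrt (real n / 2) * sqrt (2 * real n)"
      by (simp add: real_sqrt_mult[symmetric])
    then have "\<sigma>\<^sup>2 / sqrt (real n / 2) = s\<^sup>2 * sqrt (2 * real n)"
      unfolding s2 using n by (simp add: field_simps)
    moreover have "\<sigma>\<^sup>2 * upper_normal_quantile \<alpha> / sqrt (real n / 2) =
      \<sigma>\<^sup>2 / sqrt (real n / 2) * upper_normal_quantile \<alpha>" by simp
    ultimately show ?thesis by (simp only: mult.assoc)
  qed
  ultimately have "(\<Sum>l=1..n. (\<mu> l - soft_estimate J0 t y l)\<^sup>2) \<le> sq_radius \<sigma> \<alpha> J0 J1 t y \<longleftrightarrow>
     s\<^sup>2 * (sqrt (2 * real n) * chi_sum n w + 2 * (\<Sum>l=1..n. remainder J0 ?r ?\<tau> w l))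
     \<le> s\<^sup>2 * (sqrt (2 * real n) * upper_normal_quantile \<alpha>)"
    unfolding sq_radius_def n_def[symmetric] by linarith
  also have "\<dots> \<longleftrightarrow> sqrt (2 * real n) * chi_sum n w + 2 * (\<Sum>l=1..n. remainder J0 ?r ?\<tau> w l)
     \<le> sqrt (2 * real n) * upper_normal_quantile \<alpha>"
    using s by simp
  also have "\<dots> \<longleftrightarrow> chi_sum n w + 2 * (\<Sum>l=1..n. remainder J0 ?r ?\<tau> w l) / sqrt (2 * real n)
     \<le> upper_normal_quantile \<alpha>"
    using n by (simp add: field_simps)
  finally show ?thesis .
qed

lemma dyadic_index_le_sample_size:
  assumes "j \<le> J1" "k < 2 ^ j"
  shows "2 ^ j + k + 1 \<in> {1..sample_size J1}"
proof -
  have "(2::nat) ^ j \<le> 2 ^ J1" using assms(1) by (intro power_increasing) auto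
  then have "2 ^ j + k + 1 \<le> 2 * 2 ^ J1" using assms(2) by linarith
  then show ?thesis by (simp add: sample_size_def)
qed

text \<open>What the two minimisation rules share. In the global case \<open>lam\<close> agrees with
  the measurable selection \<open>g\<close> on the data space only, so measurability is transferred
  by congruence there.\<close>

lemma threshold_selection:
  assumes "global_thresholds \<sigma> \<rho> J0 lam \<or> levelwise_thresholds \<sigma> \<rho> J0 lam" "J0 \<le> J1"
    and "j \<in> {J0..J1}"
  shows "(\<lambda>y. lam J1 y j) \<in> borel_measurable (data_space (sample_size J1))"
    and "y \<in> space (data_space (sample_size J1)) \<Longrightarrow>
      lam J1 y j \<in> threshold_range \<sigma> \<rho> (sample_size J1)"
proof -
  let ?M = "data_space (sample_size J1)"
  have "(\<lambda>y. lam J1 y j) \<in> borel_measurable ?M \<and>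
    (\<forall>y\<in>space ?M. lam J1 y j \<in> threshold_range \<sigma> \<rho> (sample_size J1))"
    using assms(1)
  proof
    assume "global_thresholds \<sigma> \<rho> J0 lam"
    then obtain g where g: "g \<in> borel_measurable ?M" and
      y: "\<And>y. y \<in> space ?M \<Longrightarrow>
        is_arg_min (\<lambda>u. sure \<sigma> J0 J1 (\<lambda>_. u) y) (\<lambda>u. u \<in> threshold_range \<sigma> \<rho> (sample_size J1)) (g y)
        \<and> (\<forall>j\<in>{J0..J1}. lam J1 y j = g y)"
      using assms(2) unfolding global_thresholds_def Let_def by blast
    have "(\<lambda>y. lam J1 y j) \<in> borel_measurable ?M"
      by (subst measurable_cong[where g = g]) (use y assms(3) g in auto)
    moreover have "lam J1 y j \<in> threshold_range \<sigma> \<rho> (sample_size J1)" if "y \<in> space ?M" for y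
      using y[OF that] assms(3) by (auto simp: is_arg_min_def)
    ultimately show ?thesis by blast
  next
    assume "levelwise_thresholds \<sigma> \<rho> J0 lam"
    then show ?thesis
      using assms(2,3) unfolding levelwise_thresholds_def Let_def is_arg_min_def by blast
  qed
  then show "(\<lambda>y. lam J1 y j) \<in> borel_measurable ?M"
    "y \<in> space ?M \<Longrightarrow> lam J1 y j \<in> threshold_range \<sigma> \<rho> (sample_size J1)" by auto
qed

section \<open>Measurability of the estimate, the radius and the transported events\<close>

lemma data_component_measurable:
  "l \<in> {1..n} \<Longrightarrow> (\<lambda>y. y l) \<in> borel_measurable (data_space n)"
  by (rule measurable_component_singleton)

lemma sure_measurable:
  assumes "\<And>j. j \<in> {J0..J1} \<Longrightarrow> (\<lambda>y. t y j) \<in> borel_measurable (data_space (sample_size J1))"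
  shows "(\<lambda>y. sure \<sigma> J0 J1 (t y) y) \<in> borel_measurable (data_space (sample_size J1))"
proof -
  have "(\<lambda>y. v - 2 * v * of_bool (\<bar>y (2 ^ j + k + 1)\<bar> \<le> t y j) + min ((y (2 ^ j + k + 1))\<^sup>2) ((t y j)\<^sup>2))
    \<in> borel_measurable (data_space (sample_size J1))" if "j \<in> {J0..J1}" "k \<in> {..<2 ^ j}" for j k and v :: real
  proof -
    have [measurable]: "(\<lambda>y. t y j) \<in> borel_measurable (data_space (sample_size J1))"
      "(\<lambda>y. y (2 ^ j + k + 1)) \<in> borel_measurable (data_space (sample_size J1))"
      using assms that by (auto intro: data_component_measurable[OF dyadic_index_le_sample_size, simplified])
    show ?thesis unfolding of_bool_def by measurable
  qed
  then show ?thesis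
    unfolding sure_def Let_def
    by (intro borel_measurable_add[OF borel_measurable_const] borel_measurable_sum) blast
qed

lemma soft_estimate_measurable:
  assumes "\<And>j. j \<in> {J0..J1} \<Longrightarrow> (\<lambda>y. t y j) \<in> borel_measurable (data_space (sample_size J1))"
    and l: "l \<in> {1..sample_size J1}"
  shows "(\<lambda>y. soft_estimate J0 (t y) y l) \<in> borel_measurable (data_space (sample_size J1))"
proof (cases "l \<le> 2 ^ J0")
  case True
  then show ?thesis
    unfolding soft_estimate_def using data_component_measurable[OF l] by simp
next
  case False
  then have "level l \<in> {J0..J1}"
    using l by (meson wavelet_index_cases not_le atLeastAtMost_iff)
  then have [measurable]: "(\<lambda>y. t y (level l)) \<in> borel_measurable (data_space (sample_size J1))"
    "(\<lambda>y. y l) \<in> borel_measurable (data_space (sample_size J1))"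
    using assms data_component_measurable[OF l] by auto
  have "(\<lambda>y. (if y l = 0 then 0 else if 0 < y l then 1 else - 1) * max (\<bar>y l\<bar> - t y (level l)) 0)
    \<in> borel_measurable (data_space (sample_size J1))" by measurable
  then show ?thesis using False by (simp add: soft_estimate_def soft_def sgn_if)
qed

lemma sq_radius_measurable:
  assumes "\<And>j. j \<in> {J0..J1} \<Longrightarrow> (\<lambda>y. t y j) \<in> borel_measurable (data_space (sample_size J1))"
  shows "(\<lambda>y. sq_radius \<sigma> \<alpha> J0 J1 (t y) y) \<in> borel_measurable (data_space (sample_size J1))"
  unfolding sq_radius_def
  by (intro borel_measurable_add borel_measurable_const sure_measurable assms)

lemma measure_coef_law:
  assumes "0 < \<sigma>" "A \<in> sets (data_space n)" "0 < n"
  shows "measure (coef_law \<sigma> n \<mu>) A =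
    measure gauss_seq {w. (\<lambda>l\<in>{1..n}. \<mu> l + \<sigma> / sqrt (real n) * w l) \<in> A}"
    and "{w. (\<lambda>l\<in>{1..n}. \<mu> l + \<sigma> / sqrt (real n) * w l) \<in> A} \<in> sets gauss_seq"
proof -
  have "(\<lambda>w. \<lambda>l\<in>{1..n}. \<mu> l + \<sigma> / sqrt (real n) * w l) \<in> measurable gauss_seq (data_space n)"
    by (intro measurable_restrict) measurable
  note m = this
  show "measure (coef_law \<sigma> n \<mu>) A =
    measure gauss_seq {w. (\<lambda>l\<in>{1..n}. \<mu> l + \<sigma> / sqrt (real n) * w l) \<in> A}"
    unfolding coef_law_eq_distr[OF assms(1,3)]
    by (subst measure_distr[OF m assms(2)]) (simp add: vimage_def)
  show "{w. (\<lambda>l\<in>{1..n}. \<mu> l + \<sigma> / sqrt (real n) * w l) \<in> A} \<in> sets gauss_seq"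
    using measurable_sets[OF m assms(2)] by (simp add: vimage_def)
qed

text \<open>The weighted geometric mean makes the bound independent of the level.\<close>

lemma truncated_energy_level_bound:
  fixes \<tau> :: "nat \<Rightarrow> real"
  assumes "1 \<le> A" "0 \<le> C" "0 \<le> \<gamma>"
    and "(\<Sum>k<2 ^ j. (\<tau> k)\<^sup>2) \<le> C * 2 powr (- 2 * \<gamma> * real j)"
  shows "(\<Sum>k<2 ^ j. min ((\<tau> k)\<^sup>2) (A\<^sup>2)) \<le> A\<^sup>2 * C powr (1 / (1 + 2 * \<gamma>))"
proof -
  \<comment> \<open>The weight for which the growth \<open>2 powr j\<close> of the count and the
    decay \<open>2 powr (- 2 * \<gamma> * j)\<close> of the energy cancel.\<close>
  define w where "w = 1 / (1 + 2 * \<gamma>)"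
  have w: "0 < w" "w \<le> 1" "1 - w = 2 * \<gamma> * w" using assms(3) by (auto simp: w_def field_simps)
  let ?s = "\<Sum>k<2 ^ j. min ((\<tau> k)\<^sup>2) (A\<^sup>2)"
  have s0: "0 \<le> ?s" by (intro sum_nonneg) auto
  have "?s \<le> (\<Sum>k<(2::nat) ^ j. A\<^sup>2)" by (intro sum_mono) auto
  then have s1: "?s \<le> 2 powr real j * A\<^sup>2" by (simp add: powr_realpow)
  have "?s \<le> (\<Sum>k<2 ^ j. (\<tau> k)\<^sup>2)" by (intro sum_mono) auto
  then have s2: "?s \<le> C * 2 powr (- 2 * \<gamma> * real j)" using assms(4) by linarith
  have "?s = ?s powr (1 - w) * ?s powr w"
    using s0 by (cases "?s = 0") (auto simp: powr_add[symmetric])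
  also have "\<dots> \<le> (2 powr real j * A\<^sup>2) powr (1 - w) * (C * 2 powr (- 2 * \<gamma> * real j)) powr w"
    using s0 s1 s2 w by (intro mult_mono powr_mono2) auto
  also have "\<dots> = (2 powr (real j * (1 - w)) * 2 powr (- 2 * \<gamma> * real j * w)) * (A\<^sup>2) powr (1 - w) * C powr w"
    using assms by (simp add: powr_mult powr_powr mult_ac)
  also have "2 powr (real j * (1 - w)) * 2 powr (- 2 * \<gamma> * real j * w) = (1::real)"
    unfolding powr_add[symmetric] w(3) by (simp add: algebra_simps)
  also have "(A\<^sup>2) powr (1 - w) \<le> (A\<^sup>2) powr 1"
    using assms w by (intro powr_mono) auto
  finally show ?thesis
    using assms(1) by (simp add: w_def mult_right_mono)
qed

text \<open>The bound for one level does not depend on the level, so the sum costs only the number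
  of levels, which is logarithmic in the sample size.\<close>

lemma truncated_energy_bound:
  fixes \<tau> :: "nat \<Rightarrow> real"
  assumes "1 \<le> A" "0 \<le> C" "0 \<le> \<gamma>" "J0 \<le> J1"
    and "\<And>j. j \<in> {J0..J1} \<Longrightarrow>
      (\<Sum>k<2 ^ j. (\<tau> (2 ^ j + k + 1))\<^sup>2) \<le> C * 2 powr (- 2 * \<gamma> * real j)"
  shows "(\<Sum>l=2 ^ J0 + 1..sample_size J1. min ((\<tau> l)\<^sup>2) (A\<^sup>2))
    \<le> real (J1 + 1) * (A\<^sup>2 * C powr (1 / (1 + 2 * \<gamma>)))"
proof -
  have "(\<Sum>l=2 ^ J0 + 1..sample_size J1. min ((\<tau> l)\<^sup>2) (A\<^sup>2))
     \<le> (\<Sum>j=J0..J1. A\<^sup>2 * C powr (1 / (1 + 2 * \<gamma>)))"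
    unfolding sum_dyadic_levels[OF assms(4)]
    using assms by (intro sum_mono truncated_energy_level_bound) auto
  also have "\<dots> = real (card {J0..J1}) * (A\<^sup>2 * C powr (1 / (1 + 2 * \<gamma>)))" by simp
  also have "\<dots> \<le> real (J1 + 1) * (A\<^sup>2 * C powr (1 / (1 + 2 * \<gamma>)))"
    using assms by (intro mult_right_mono) auto
  finally show ?thesis .
qed

section \<open>Constants, rates and perturbation of the limit law\<close>

text \<open>The cube collects one factor \<open>1 - \<kappa>\<close> from the Chernoff rate and two
  from the squared margin between threshold and coefficient. The bound
  \<open>\<kappa> \<le> 1 / 2\<close> keeps this margin at least as large as the cut-off for small
  coefficients.\<close>

lemma chernoff_parameters:
  fixes \<rho> :: real
  assumes "1 / sqrt 2 < \<rho>"
  obtains \<kappa> where "0 < \<kappa>" "\<kappa> \<le> 1 / 2" "1 / 2 < (1 - \<kappa>) ^ 3 * \<rho>\<^sup>2"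
proof -
  have "(1 / sqrt 2)\<^sup>2 < \<rho>\<^sup>2" using assms by (intro power_strict_mono) auto
  then have \<rho>: "1 / 2 < \<rho>\<^sup>2" by (simp add: power_divide)
  have "((\<lambda>\<kappa>. (1 - \<kappa>) ^ 3 * \<rho>\<^sup>2) \<longlongrightarrow> (1 - 0) ^ 3 * \<rho>\<^sup>2) (at_right 0)"
    by (intro tendsto_intros)
  then have "eventually (\<lambda>\<kappa>. 1 / 2 < (1 - \<kappa>) ^ 3 * \<rho>\<^sup>2) (at_right 0)"
    by (rule order_tendstoD) (use \<rho> in simp)
  moreover have "eventually (\<lambda>\<kappa>::real. 0 < \<kappa> \<and> \<kappa> \<le> 1 / 2) (at_right 0)"
    by (auto simp: eventually_at_right_field intro!: exI[of _ "1/2"])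
  ultimately have "eventually (\<lambda>\<kappa>. 1 / 2 < (1 - \<kappa>) ^ 3 * \<rho>\<^sup>2 \<and> 0 < \<kappa> \<and> \<kappa> \<le> 1 / 2) (at_right 0)"
    by eventually_elim auto
  then obtain \<kappa> where "1 / 2 < (1 - \<kappa>) ^ 3 * \<rho>\<^sup>2 \<and> 0 < \<kappa> \<and> \<kappa> \<le> (1 / 2 :: real)"
    using eventually_happens'[OF trivial_limit_at_right_real] by blast
  then show ?thesis using that by blast
qed

text \<open>In this order, after normalisation: the large coefficients, the variance of the linear
  term of the small ones, and the noise that exceeds the threshold.\<close>

lemma rate_limits:
  fixes B D w z :: real
  assumes "w < 1 / 2" "1 / 2 < z"
  shows "((\<lambda>N. (1 + sqrt (2 * ln N)) * (B + D * ((ln N)\<^sup>2 * N powr w)) / sqrt N) \<longlongrightarrow> 0) at_top"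
    and "((\<lambda>N. D * ((ln N)\<^sup>2 * N powr w) / N) \<longlongrightarrow> 0) at_top"
    and "((\<lambda>N. sqrt N * N powr (- z)) \<longlongrightarrow> 0) at_top"
proof -
  have "((\<lambda>N. (1 + sqrt (2 * ln N)) / sqrt N) \<longlongrightarrow> 0) at_top" by real_asymp
  moreover have "((\<lambda>N::real. (1 + sqrt (2 * ln N)) * ((ln N)\<^sup>2 * N powr w) / sqrt N) \<longlongrightarrow> 0) at_top"
    using assms by real_asymp
  ultimately have "((\<lambda>N. B * ((1 + sqrt (2 * ln N)) / sqrt N) +
      D * ((1 + sqrt (2 * ln N)) * ((ln N)\<^sup>2 * N powr w) / sqrt N)) \<longlongrightarrow> B * 0 + D * 0) at_top"
    by (intro tendsto_intros)
  then show "((\<lambda>N. (1 + sqrt (2 * ln N)) * (B + D * ((ln N)\<^sup>2 * N powr w)) / sqrt N) \<longlongrightarrow> 0) at_top"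
    by (simp add: field_simps add_divide_distrib)
  have "((\<lambda>N::real. (ln N)\<^sup>2 * N powr w / N) \<longlongrightarrow> 0) at_top"
    using assms by real_asymp
  from tendsto_mult[OF tendsto_const[of D] this]
  show "((\<lambda>N. D * ((ln N)\<^sup>2 * N powr w) / N) \<longlongrightarrow> 0) at_top" by simp
  show "((\<lambda>N::real. sqrt N * N powr (- z)) \<longlongrightarrow> 0) at_top"
    using assms by real_asymp
qed

lemma filterlim_sample_size: "filterlim (\<lambda>J1. real (sample_size J1)) at_top sequentially"
  unfolding sample_size_def by simp real_asymp

text \<open>Markov's inequality for \<open>W\<close> and for the square of \<open>R\<close>: outside
  two events of total probability at most \<open>p\<close>, the perturbation is at most
  \<open>2 * h\<close> and only shifts the argument of the distribution function.\<close>

lemma perturbed_probability: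
  fixes d W R :: "(nat \<Rightarrow> real) \<Rightarrow> real"
  assumes "{\<omega>. chi_sum n \<omega> + d \<omega> \<le> z} \<in> sets gauss_seq"
    and "\<And>\<omega>. \<bar>d \<omega>\<bar> \<le> W \<omega> + \<bar>R \<omega>\<bar>" "\<And>\<omega>. 0 \<le> W \<omega>"
    and "integrable gauss_seq W" "(\<integral>\<omega>. W \<omega> \<partial>gauss_seq) \<le> w"
    and "integrable gauss_seq (\<lambda>\<omega>. (R \<omega>)\<^sup>2)" "(\<integral>\<omega>. (R \<omega>)\<^sup>2 \<partial>gauss_seq) \<le> v"
    and "0 < h"
  defines "p \<equiv> w / h + v / h\<^sup>2"
  shows "measure gauss_seq {\<omega>. chi_sum n \<omega> + d \<omega> \<le> z}
      \<le> measure gauss_seq {\<omega>. chi_sum n \<omega> \<le> z + 2 * h} + p"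
    and "measure gauss_seq {\<omega>. chi_sum n \<omega> \<le> z - 2 * h}
      \<le> measure gauss_seq {\<omega>. chi_sum n \<omega> + d \<omega> \<le> z} + p"
proof -
  let ?B1 = "{\<omega>. h \<le> W \<omega>}" and ?B2 = "{\<omega>. h\<^sup>2 \<le> (R \<omega>)\<^sup>2}"
  have meas: "?B1 \<in> sets gauss_seq" "?B2 \<in> sets gauss_seq"
    "{\<omega>. chi_sum n \<omega> \<le> a} \<in> sets gauss_seq" for a
  proof -
    have [measurable]: "W \<in> borel_measurable gauss_seq" "(\<lambda>\<omega>. (R \<omega>)\<^sup>2) \<in> borel_measurable gauss_seq"
      using assms(4,6) by auto
    have "{\<omega>\<in>space gauss_seq. h \<le> W \<omega>} \<in> sets gauss_seq"
      "{\<omega>\<in>space gauss_seq. h\<^sup>2 \<le> (R \<omega>)\<^sup>2} \<in> sets gauss_seq"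
      "{\<omega>\<in>space gauss_seq. chi_sum n \<omega> \<le> a} \<in> sets gauss_seq" by measurable
    then show "?B1 \<in> sets gauss_seq" "?B2 \<in> sets gauss_seq"
      "{\<omega>. chi_sum n \<omega> \<le> a} \<in> sets gauss_seq" by simp_all
  qed
  have "measure gauss_seq ?B1 \<le> (\<integral>\<omega>. W \<omega> \<partial>gauss_seq) / h"
    using integral_Markov_inequality_measure[OF assms(4), of "{}" h] assms by auto
  then have B1: "measure gauss_seq ?B1 \<le> w / h"
    using assms by (meson divide_right_mono less_imp_le order_trans)
  have "measure gauss_seq ?B2 \<le> (\<integral>\<omega>. (R \<omega>)\<^sup>2 \<partial>gauss_seq) / h\<^sup>2"
    using integral_Markov_inequality_measure[OF assms(6), of "{}" "h\<^sup>2"] assms by auto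
  then have B2: "measure gauss_seq ?B2 \<le> v / h\<^sup>2"
    using assms by (meson divide_right_mono zero_le_power2 order_trans)
  have d: "\<bar>d \<omega>\<bar> \<le> 2 * h" if "\<omega> \<notin> ?B1" "\<omega> \<notin> ?B2" for \<omega>
  proof -
    have "(R \<omega>)\<^sup>2 < h\<^sup>2" using that by simp
    then have "\<bar>R \<omega>\<bar> < h" using assms(8) abs_le_square_iff[of h "R \<omega>"] by auto
    then show ?thesis using assms(2)[of \<omega>] that by auto
  qed
  have union: "measure gauss_seq (X \<union> (?B1 \<union> ?B2)) \<le> measure gauss_seq X + p"
    if "X \<in> sets gauss_seq" for X
  proof -
    have "measure gauss_seq (X \<union> (?B1 \<union> ?B2)) \<le> measure gauss_seq X + measure gauss_seq (?B1 \<union> ?B2)"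
      using that meas by (intro measure_Un_le) auto
    also have "measure gauss_seq (?B1 \<union> ?B2) \<le> measure gauss_seq ?B1 + measure gauss_seq ?B2"
      using meas by (intro measure_Un_le) auto
    finally show ?thesis using B1 B2 by (simp add: p_def)
  qed
  have "measure gauss_seq {\<omega>. chi_sum n \<omega> + d \<omega> \<le> z}
      \<le> measure gauss_seq ({\<omega>. chi_sum n \<omega> \<le> z + 2 * h} \<union> (?B1 \<union> ?B2))"
    using meas d by (intro gauss.finite_measure_mono) (auto, force)
  also have "\<dots> \<le> measure gauss_seq {\<omega>. chi_sum n \<omega> \<le> z + 2 * h} + p"
    by (rule union[OF meas(3)])
  finally show "measure gauss_seq {\<omega>. chi_sum n \<omega> + d \<omega> \<le> z}
      \<le> measure gauss_seq {\<omega>. chi_sum n \<omega> \<le> z + 2 * h} + p" .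
  have "measure gauss_seq {\<omega>. chi_sum n \<omega> \<le> z - 2 * h}
      \<le> measure gauss_seq ({\<omega>. chi_sum n \<omega> + d \<omega> \<le> z} \<union> (?B1 \<union> ?B2))"
    using meas d assms(1) by (intro gauss.finite_measure_mono) (auto, force)
  also have "\<dots> \<le> measure gauss_seq {\<omega>. chi_sum n \<omega> + d \<omega> \<le> z} + p"
    by (rule union[OF assms(1)])
  finally show "measure gauss_seq {\<omega>. chi_sum n \<omega> \<le> z - 2 * h}
      \<le> measure gauss_seq {\<omega>. chi_sum n \<omega> + d \<omega> \<le> z} + p" .
qed

lemma loss_event_measurable:
  assumes "\<And>j. j \<in> {J0..J1} \<Longrightarrow> (\<lambda>y. t y j) \<in> borel_measurable (data_space (sample_size J1))"
  shows "{y \<in> space (data_space (sample_size J1)).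
      (\<Sum>l=1..sample_size J1. (\<mu> l - soft_estimate J0 (t y) y l)\<^sup>2) \<le> sq_radius \<sigma> \<alpha> J0 J1 (t y) y}
    \<in> sets (data_space (sample_size J1))"
  by (intro borel_measurable_le borel_measurable_sum borel_measurable_power borel_measurable_diff
      borel_measurable_const soft_estimate_measurable sq_radius_measurable assms)

text \<open>Small wavelet coefficients are separated from the rest, which includes the father
  coefficients. No individual threshold occurs on the right, so expectations may be taken there
  although \<open>r\<close> may depend on \<open>w\<close>.\<close>

lemma remainder_sum_bound:
  fixes \<tau> w r :: "nat \<Rightarrow> real"
  assumes r: "\<And>j. j \<in> {J0..J1} \<Longrightarrow> r0 \<le> r j \<and> r j \<le> r1" and "0 \<le> r0"
    and "a \<le> r0 - A" "1 \<le> a" "0 < \<theta>" "0 < t" and r01: "r0 \<le> r1"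
  defines "n \<equiv> sample_size J1"
  defines "Small \<equiv> {l \<in> {2 ^ J0 + 1..n}. \<bar>\<tau> l\<bar> \<le> A}"
  shows "\<bar>\<Sum>l=1..n. remainder J0 r \<tau> w l\<bar> \<le>
     (\<Sum>l\<in>{1..n} - Small. (1 + r1) * (1 + (w l)\<^sup>2)) +
     (\<Sum>l\<in>Small. 4 / t * exp (- \<theta> * a\<^sup>2 / 2) * exp ((\<theta> + t) * (w l)\<^sup>2 / 2)) +
     \<bar>\<Sum>l\<in>Small. \<tau> l * w l\<bar>"
proof -
  have sub: "Small \<subseteq> {1..n}" by (auto simp: Small_def)
  have lev: "level l \<in> {J0..J1}" if "2 ^ J0 < l" "l \<in> {1..n}" for l
    using that unfolding n_def by (meson wavelet_index_cases atLeastAtMost_iff)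
  have big: "\<bar>remainder J0 r \<tau> w l\<bar> \<le> (1 + r1) * (1 + (w l)\<^sup>2)" if "l \<in> {1..n}" for l
  proof (cases "l \<le> 2 ^ J0")
    case True
    have "\<bar>(w l)\<^sup>2 - 1\<bar> \<le> 1 * (1 + (w l)\<^sup>2)" by (simp add: abs_le_iff)
    also have "\<dots> \<le> (1 + r1) * (1 + (w l)\<^sup>2)"
      using assms(2) r01 by (intro mult_right_mono) auto
    finally show ?thesis using True by (simp add: remainder_def)
  next
    case False
    then have "r0 \<le> r (level l)" "r (level l) \<le> r1" using r[OF lev] that by auto
    then show ?thesis
      using remainder_large_bound[of "r (level l)" r1 "w l" "\<tau> l"] assms(2) False
      by (simp add: remainder_def)
  qed
  have small: "\<bar>remainder J0 r \<tau> w l + \<tau> l * w l\<bar> \<le>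
      4 / t * exp (- \<theta> * a\<^sup>2 / 2) * exp ((\<theta> + t) * (w l)\<^sup>2 / 2)" if "l \<in> Small" for l
  proof -
    have l: "2 ^ J0 < l" "l \<in> {1..n}" "\<bar>\<tau> l\<bar> \<le> A" using that by (auto simp: Small_def)
    then have "r0 \<le> r (level l)" using r[OF lev] by auto
    from remainder_small_bound[OF this l(3) assms(3-6), of "w l"]
    show ?thesis using l by (simp add: remainder_def)
  qed
  have "(\<Sum>l=1..n. remainder J0 r \<tau> w l) =
      (\<Sum>l\<in>{1..n} - Small. remainder J0 r \<tau> w l) + (\<Sum>l\<in>Small. remainder J0 r \<tau> w l)"
    by (rule sum.subset_diff[OF sub]) simp
  \<comment> \<open>The linear parts are collected before absolute values are taken: they are small
    only through the cancellation measured by their variance.\<close>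
  also have "(\<Sum>l\<in>Small. remainder J0 r \<tau> w l) =
      (\<Sum>l\<in>Small. remainder J0 r \<tau> w l + \<tau> l * w l) - (\<Sum>l\<in>Small. \<tau> l * w l)"
    by (simp add: sum.distrib)
  finally have "\<bar>\<Sum>l=1..n. remainder J0 r \<tau> w l\<bar> \<le>
      \<bar>\<Sum>l\<in>{1..n} - Small. remainder J0 r \<tau> w l\<bar> +
      \<bar>\<Sum>l\<in>Small. remainder J0 r \<tau> w l + \<tau> l * w l\<bar> + \<bar>\<Sum>l\<in>Small. \<tau> l * w l\<bar>"
    by linarith
  moreover have "\<bar>\<Sum>l\<in>{1..n} - Small. remainder J0 r \<tau> w l\<bar> \<le>
      (\<Sum>l\<in>{1..n} - Small. (1 + r1) * (1 + (w l)\<^sup>2))"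
    by (intro order_trans[OF sum_abs] sum_mono big) auto
  moreover have "\<bar>\<Sum>l\<in>Small. remainder J0 r \<tau> w l + \<tau> l * w l\<bar> \<le>
      (\<Sum>l\<in>Small. 4 / t * exp (- \<theta> * a\<^sup>2 / 2) * exp ((\<theta> + t) * (w l)\<^sup>2 / 2))"
    by (intro order_trans[OF sum_abs] sum_mono small) auto
  ultimately show ?thesis by linarith
qed

text \<open>Uniformity holds because the asymptotic conditions \<open>ev1\<close> to
  \<open>ev4\<close> involve the sample size alone; the coefficients enter only through the energy
  bounds of their levels.\<close>

lemma coverage_uniform:
  assumes \<sigma>: "0 < \<sigma>" and \<alpha>: "0 < \<alpha>" "\<alpha> < 1" and \<rho>: "1 / sqrt 2 < \<rho>" "\<rho> < 1"
    and thr: "global_thresholds \<sigma> \<rho> J0 lam \<or> levelwise_thresholds \<sigma> \<rho> J0 lam"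
    and \<gamma>: "1 / 2 < \<gamma>" and c: "0 \<le> c" and \<epsilon>: "0 < \<epsilon>"
  shows "eventually (\<lambda>J1. \<forall>\<mu>.
     (\<forall>j\<in>{J0..J1}. (\<Sum>k<2 ^ j. (\<mu> (2 ^ j + k + 1))\<^sup>2) \<le> c * 2 powr (- 2 * \<gamma> * real j)) \<longrightarrow>
     \<bar>measure (coef_law \<sigma> (sample_size J1) \<mu>) {y \<in> space (data_space (sample_size J1)).
        (\<Sum>l=1..sample_size J1. (\<mu> l - soft_estimate J0 (lam J1 y) y l)\<^sup>2)
          \<le> sq_radius \<sigma> \<alpha> J0 J1 (lam J1 y) y} - (1 - \<alpha>)\<bar> < \<epsilon>) sequentially"
proof -
  obtain \<kappa> where \<kappa>: "0 < \<kappa>" "\<kappa> \<le> 1 / 2" "1 / 2 < (1 - \<kappa>) ^ 3 * \<rho>\<^sup>2"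
    using chernoff_parameters[OF \<rho>(1)] .
  have \<rho>0: "0 < \<rho>" using \<rho>(1) by (smt (verit) divide_pos_pos real_sqrt_gt_zero)
  \<comment> \<open>\<open>\<theta> + t = 1 - \<kappa> / 2\<close> stays below 1, so the exponential
    moment \<open>M\<close> below is finite.\<close>
  define \<theta> t where "\<theta> = 1 - \<kappa>" and "t = \<kappa> / 2"
  have \<theta>: "0 < \<theta>" "0 < t" "\<theta> + t < 1" using \<kappa> by (auto simp: \<theta>_def t_def)
  define M where "M = (\<integral>x. std_normal_density x * exp ((\<theta> + t) * x\<^sup>2 / 2) \<partial>lborel)"
  have M: "(\<integral>\<omega>. exp ((\<theta> + t) * (\<omega> i)\<^sup>2 / 2) \<partial>gauss_seq) = M" for i
    unfolding M_def by (rule gauss_integral_coordinate) measurable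
  have Mint: "integrable gauss_seq (\<lambda>\<omega>. exp ((\<theta> + t) * (\<omega> i)\<^sup>2 / 2))" for i
    by (rule gauss_integrable_exp_square[OF \<theta>(3)])
  have M0: "0 \<le> M" unfolding M[of 0, symmetric] by (intro integral_nonneg_AE) auto
  \<comment> \<open>\<open>D\<close> gathers the constants of \<open>truncated_energy_bound\<close>:
    the squared cut-off is \<open>2 * \<kappa>\<^sup>2 * \<rho>\<^sup>2 * ln N\<close>, the factor
    \<open>J1 + 1\<close> is \<open>ln N / ln 2\<close>, and division by the noise level turns the
    energy constant \<open>c\<close> into \<open>c / \<sigma>\<^sup>2 * N\<close>.\<close>
  define w D where "w = 1 / (1 + 2 * \<gamma>)" and "D = 2 * \<kappa>\<^sup>2 * \<rho>\<^sup>2 / ln 2 * (c / \<sigma>\<^sup>2) powr w"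
  have w: "w < 1 / 2" using \<gamma> by (simp add: w_def field_simps)
  define L where "L N = sqrt (2 * ln N)" for N :: real
  define T where "T N = D * ((ln N)\<^sup>2 * N powr w)" for N
  \<comment> \<open>Will bound the expectation of \<open>W\<close>: at most
    \<open>2 ^ J0 + T N\<close> coefficients are not small, and 2 is the mean of one plus a squared
    standard normal variable.\<close>
  define EW where "EW N = 2 / sqrt (2 * N) * (2 * (1 + L N) * (2 ^ J0 + T N) +
     N * (4 / t * exp (- \<theta> * ((1 - \<kappa>) * \<rho> * L N)\<^sup>2 / 2) * M))" for N
  define n where "n J1 = sample_size J1" for J1
  let ?F = "cdf std_normal_distribution"
  define z where "z = upper_normal_quantile \<alpha>"
  have Fz: "?F z = 1 - \<alpha>" unfolding z_def by (rule std_normal_cdf_quantile[OF \<alpha>])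
  \<comment> \<open>The perturbation may move the quantile by \<open>2 * h\<close>; continuity of
    the limit law makes this cost less than \<open>\<epsilon> / 4\<close>.\<close>
  obtain h where h: "0 < h" "\<bar>?F (z + 2 * h) - ?F z\<bar> < \<epsilon> / 4" "\<bar>?F (z - 2 * h) - ?F z\<bar> < \<epsilon> / 4"
  proof -
    have "\<exists>d>0. \<forall>x. \<bar>x - z\<bar> < d \<longrightarrow> \<bar>?F x - ?F z\<bar> < \<epsilon> / 4"
      using isCont_std_normal_cdf[of z] \<epsilon> unfolding continuous_at_eps_delta dist_real_def
      by (metis zero_less_divide_iff zero_less_numeral)
    then obtain d where "d > 0" "\<And>x. \<bar>x - z\<bar> < d \<Longrightarrow> \<bar>?F x - ?F z\<bar> < \<epsilon> / 4" by blast
    then show ?thesis by (intro that[of "d / 4"]) auto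
  qed
  have nlim: "filterlim n sequentially sequentially"
    using filterlim_sample_size unfolding n_def filterlim_sequentially_iff_filterlim_real .
  have "(EW \<longlongrightarrow> 0) at_top"
  proof -
    \<comment> \<open>Equals \<open>(1 - \<kappa>) ^ 3 * \<rho>\<^sup>2\<close>, which the choice of
      \<kappa> puts above 1/2.\<close>
    define u where "u = \<theta> * (1 - \<kappa>)\<^sup>2 * \<rho>\<^sup>2"
    have u: "1 / 2 < u" using \<kappa>(3) by (simp add: u_def \<theta>_def power2_eq_square power3_eq_cube mult_ac)
    have "((\<lambda>N. 2 * sqrt 2 * ((1 + sqrt (2 * ln N)) * (2 ^ J0 + D * ((ln N)\<^sup>2 * N powr w)) / sqrt N) +
       4 / t * M * sqrt 2 * (sqrt N * N powr (- u))) \<longlongrightarrow> 2 * sqrt 2 * 0 + 4 / t * M * sqrt 2 * 0) at_top"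
      by (intro tendsto_intros rate_limits(1)[OF w u] rate_limits(3)[OF w u])
    moreover have "eventually (\<lambda>N. 2 * sqrt 2 * ((1 + sqrt (2 * ln N)) * (2 ^ J0 + D * ((ln N)\<^sup>2 * N powr w)) / sqrt N) +
       4 / t * M * sqrt 2 * (sqrt N * N powr (- u)) = EW N) at_top"
      using eventually_gt_at_top[of 1]
    proof eventually_elim
      fix N :: real assume N: "1 < N"
      have e: "exp (- \<theta> * ((1 - \<kappa>) * \<rho> * L N)\<^sup>2 / 2) = N powr (- u)"
        using N by (simp add: L_def u_def powr_def power_mult_distrib)
      have r: "2 / sqrt (2 * N) = sqrt 2 / sqrt N" "2 / sqrt (2 * N) * N = sqrt 2 * sqrt N"
        using N by (auto simp: real_sqrt_mult field_simps)
      have "EW N = (2 / sqrt (2 * N)) * (2 * (1 + L N) * (2 ^ J0 + T N)) +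
         (2 / sqrt (2 * N) * N) * (4 / t * N powr (- u) * M)"
        unfolding EW_def e by (simp only: distrib_left mult.assoc)
      also have "\<dots> = sqrt 2 / sqrt N * (2 * (1 + L N) * (2 ^ J0 + T N)) +
         (sqrt 2 * sqrt N) * (4 / t * N powr (- u) * M)"
        unfolding r(2) unfolding r(1) ..
      finally show "2 * sqrt 2 * ((1 + sqrt (2 * ln N)) * (2 ^ J0 + D * ((ln N)\<^sup>2 * N powr w)) / sqrt N) +
       4 / t * M * sqrt 2 * (sqrt N * N powr (- u)) = EW N"
        by (simp add: T_def L_def mult_ac)
    qed
    ultimately have "(EW \<longlongrightarrow> 2 * sqrt 2 * 0 + 4 / t * M * sqrt 2 * 0) at_top"
      by (rule Lim_transform_eventually)
    then show ?thesis by simp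
  qed
  then have "((\<lambda>J1. EW (real (n J1))) \<longlongrightarrow> 0) sequentially"
    unfolding n_def by (rule filterlim_compose[OF _ filterlim_sample_size])
  from tendsto_divide[OF this tendsto_const[of h]] h
  have "((\<lambda>J1. EW (real (n J1)) / h) \<longlongrightarrow> 0) sequentially" by simp
  then have ev1: "eventually (\<lambda>J1. EW (real (n J1)) / h < \<epsilon> / 4) sequentially"
    by (rule order_tendstoD) (use \<epsilon> in simp)
  have "((\<lambda>N. T N / N) \<longlongrightarrow> 0) at_top"
    unfolding T_def by (rule rate_limits(2)[OF w, of 1]) simp
  then have "((\<lambda>J1. T (real (n J1)) / real (n J1)) \<longlongrightarrow> 0) sequentially"
    unfolding n_def by (rule filterlim_compose[OF _ filterlim_sample_size])
  from tendsto_mult[OF tendsto_const[of "2 / h\<^sup>2"] this]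
  have "((\<lambda>J1. 2 / h\<^sup>2 * (T (real (n J1)) / real (n J1))) \<longlongrightarrow> 0) sequentially" by simp
  then have ev2: "eventually (\<lambda>J1. 2 / h\<^sup>2 * (T (real (n J1)) / real (n J1)) < \<epsilon> / 4) sequentially"
    by (rule order_tendstoD) (use \<epsilon> in simp)
  \<comment> \<open>Ensures \<open>1 \<le> A\<close>, so that every coefficient beyond
    \<open>A\<close> contributes at least 1 to the truncated energy.\<close>
  have ev3: "eventually (\<lambda>J1. 1 / (\<kappa> * \<rho>) \<le> L (real (n J1))) sequentially"
  proof -
    have "filterlim L at_top at_top" unfolding L_def by real_asymp
    then have "filterlim (\<lambda>J1. L (real (n J1))) at_top sequentially"
      unfolding n_def by (rule filterlim_compose[OF _ filterlim_sample_size])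
    then show ?thesis by (simp add: filterlim_at_top)
  qed
  have ev4: "eventually (\<lambda>J1. \<bar>measure gauss_seq {\<omega>. chi_sum (n J1) \<omega> \<le> x} - ?F x\<bar> < \<epsilon> / 4) sequentially" for x
  proof -
    have "((\<lambda>J1. measure gauss_seq {\<omega>. chi_sum (n J1) \<omega> \<le> x}) \<longlongrightarrow> ?F x) sequentially"
      by (rule filterlim_compose[OF chi_sum_clt nlim])
    from tendstoD[OF this, of "\<epsilon> / 4"] show ?thesis using \<epsilon> by (simp add: dist_real_def)
  qed
  show ?thesis
    using ev1 ev2 ev3 ev4[of "z + 2 * h"] ev4[of "z - 2 * h"] eventually_ge_at_top[of J0]
  proof eventually_elim
    case (elim J1)
    define N where "N = real (n J1)"
    have N1: "1 < N" unfolding N_def n_def sample_size_def using one_less_power[of "2::real" "J1 + 1"] by simp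
    \<comment> \<open>In noise units, \<open>A\<close> is the fraction \<kappa> of the smallest
      threshold \<open>\<rho> * r1\<close>, and \<open>a\<close> is what is left of it for the
      noise.\<close>
    define r1 A a where "r1 = L N" and "A = \<kappa> * \<rho> * r1" and "a = (1 - \<kappa>) * \<rho> * r1"
    have r1: "0 < r1" using N1 by (simp add: r1_def L_def)
    have r1b: "1 / (\<kappa> * \<rho>) \<le> r1" using elim(3) by (simp add: r1_def N_def)
    have A1: "1 \<le> A" using r1b \<kappa> \<rho>0 by (simp add: A_def field_simps)
    have "\<kappa> * (\<rho> * r1) \<le> (1 - \<kappa>) * (\<rho> * r1)" using \<kappa> \<rho>0 r1 by (intro mult_right_mono) auto
    then have a1: "1 \<le> a" using A1 by (simp add: a_def A_def mult.assoc)
    define s where "s = \<sigma> / sqrt N"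
    have s: "0 < s" using \<sigma> N1 by (simp add: s_def)
    show ?case
    proof (intro allI impI)
      fix \<mu> :: "nat \<Rightarrow> real"
      assume \<mu>: "\<forall>j\<in>{J0..J1}. (\<Sum>k<2 ^ j. (\<mu> (2 ^ j + k + 1))\<^sup>2) \<le> c * 2 powr (- 2 * \<gamma> * real j)"
      define \<tau> where "\<tau> l = \<mu> l / s" for l
      define y where "y \<omega> = (\<lambda>l\<in>{1..n J1}. \<mu> l + s * \<omega> l)" for \<omega> :: "nat \<Rightarrow> real"
      define Small where "Small = {l \<in> {2 ^ J0 + 1..n J1}. \<bar>\<tau> l\<bar> \<le> A}"
      define d where "d \<omega> = 2 * (\<Sum>l=1..n J1. remainder J0 (\<lambda>j. lam J1 (y \<omega>) j / s) \<tau> \<omega> l) / sqrt (2 * N)" for \<omega>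
      define q where "q = 4 / t * exp (- \<theta> * a\<^sup>2 / 2)"
      define W where "W \<omega> = 2 / sqrt (2 * N) * ((\<Sum>l\<in>{1..n J1} - Small. (1 + r1) * (1 + (\<omega> l)\<^sup>2)) +
         (\<Sum>l\<in>Small. q * exp ((\<theta> + t) * (\<omega> l)\<^sup>2 / 2)))" for \<omega> :: "nat \<Rightarrow> real"
      define R where "R \<omega> = 2 / sqrt (2 * N) * (\<Sum>l\<in>Small. \<tau> l * \<omega> l)" for \<omega> :: "nat \<Rightarrow> real"
      \<comment> \<open>This one quantity controls both the number of large coefficients and the sum
        of squares of the small ones.\<close>
      define Ts where "Ts = (\<Sum>l=2 ^ J0 + 1..n J1. min ((\<tau> l)\<^sup>2) (A\<^sup>2))"
      have Ts: "Ts \<le> T N"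
      proof -
        have "(\<Sum>k<2 ^ j. (\<tau> (2 ^ j + k + 1))\<^sup>2) \<le> c / \<sigma>\<^sup>2 * N * 2 powr (- 2 * \<gamma> * real j)"
          if "j \<in> {J0..J1}" for j
        proof -
          have "(\<tau> l)\<^sup>2 = (\<mu> l)\<^sup>2 * (N / \<sigma>\<^sup>2)" for l
            using N1 by (simp add: \<tau>_def s_def power_divide power_mult_distrib)
          then have "(\<Sum>k<2 ^ j. (\<tau> (2 ^ j + k + 1))\<^sup>2) = (\<Sum>k<2 ^ j. (\<mu> (2 ^ j + k + 1))\<^sup>2) * (N / \<sigma>\<^sup>2)"
            by (simp only: sum_distrib_right)
          also have "\<dots> \<le> (c * 2 powr (- 2 * \<gamma> * real j)) * (N / \<sigma>\<^sup>2)"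
            using \<mu> that N1 by (intro mult_right_mono) auto
          finally show ?thesis by (simp add: mult_ac)
        qed
        from truncated_energy_bound[where \<tau> = \<tau>, OF A1 _ _ elim(6) this]
        have "Ts \<le> real (J1 + 1) * (A\<^sup>2 * (c / \<sigma>\<^sup>2 * N) powr w)"
          unfolding Ts_def n_def w_def using c \<gamma> N1 by simp
        also have "\<dots> = T N"
        proof -
          have lnN: "ln N = real (J1 + 1) * ln 2"
            unfolding N_def n_def sample_size_def using ln_realpow[of 2 "J1 + 1"] by simp
          have "A\<^sup>2 = \<kappa>\<^sup>2 * \<rho>\<^sup>2 * (2 * ln N)"
            using N1 by (simp add: A_def r1_def L_def power_mult_distrib)
          moreover have "real (J1 + 1) = ln N / ln 2" using lnN by simp
          moreover have "(c / \<sigma>\<^sup>2 * N) powr w = (c / \<sigma>\<^sup>2) powr w * N powr w"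
            by (rule powr_mult)
          moreover have "x / k * (a' * b * (2 * x) * (u * v)) = 2 * a' * b / k * u * (x\<^sup>2 * v)"
            for x k a' b u v :: real by (simp add: power2_eq_square)
          ultimately show ?thesis
            unfolding T_def D_def by (simp only:)
        qed
        finally show ?thesis .
      qed
      have fin: "finite Small" "Small \<subseteq> {1..n J1}" by (auto simp: Small_def)
      have small_sq: "(\<Sum>l\<in>Small. (\<tau> l)\<^sup>2) \<le> T N"
      proof -
        have "(\<tau> l)\<^sup>2 \<le> A\<^sup>2" if "l \<in> Small" for l
          using that A1 power_mono[of "\<bar>\<tau> l\<bar>" A 2] by (simp add: Small_def)
        then have "(\<Sum>l\<in>Small. (\<tau> l)\<^sup>2) = (\<Sum>l\<in>Small. min ((\<tau> l)\<^sup>2) (A\<^sup>2))"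
          by (intro sum.cong) auto
        also have "\<dots> \<le> Ts" unfolding Ts_def by (intro sum_mono2) (auto simp: Small_def)
        finally show ?thesis using Ts by linarith
      qed
      have card_big: "real (card ({1..n J1} - Small)) \<le> 2 ^ J0 + T N"
      proof -
        let ?B = "{l \<in> {2 ^ J0 + 1..n J1}. A < \<bar>\<tau> l\<bar>}"
        have "{1..n J1} - Small \<subseteq> {1..2 ^ J0} \<union> ?B" by (auto simp: Small_def)
        then have "card ({1..n J1} - Small) \<le> card ({1..2 ^ J0} \<union> ?B)" by (intro card_mono) auto
        also have "\<dots> \<le> 2 ^ J0 + card ?B" using card_Un_le[of "{1..2 ^ J0}" ?B] by simp
        finally have "real (card ({1..n J1} - Small)) \<le> 2 ^ J0 + real (card ?B)"
          using of_nat_mono[where 'a = real] by fastforce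
        also have "real (card ?B) = (\<Sum>l\<in>?B. 1)" by simp
        also have "\<dots> \<le> (\<Sum>l\<in>?B. min ((\<tau> l)\<^sup>2) (A\<^sup>2))"
        proof (intro sum_mono)
          fix l assume l: "l \<in> ?B"
          then have "A\<^sup>2 \<le> (\<tau> l)\<^sup>2" using A1 power_mono[of A "\<bar>\<tau> l\<bar>" 2] by simp
          moreover have "1 \<le> A\<^sup>2" using A1 by simp
          ultimately show "1 \<le> min ((\<tau> l)\<^sup>2) (A\<^sup>2)" by simp
        qed
        also have "\<dots> \<le> Ts" unfolding Ts_def by (intro sum_mono2) auto
        finally show ?thesis using Ts by linarith
      qed
      have q: "0 \<le> q" using \<theta> by (simp add: q_def)
      have Wint: "integrable gauss_seq W"
        unfolding W_def by (intro integrable_mult_right Bochner_Integration.integrable_add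
            Bochner_Integration.integrable_sum Mint gauss_integrable_square) auto
      have EWle: "(\<integral>\<omega>. W \<omega> \<partial>gauss_seq) \<le> EW N"
      proof -
        have "(\<integral>\<omega>. W \<omega> \<partial>gauss_seq) = 2 / sqrt (2 * N) *
            ((\<Sum>l\<in>{1..n J1} - Small. (1 + r1) * 2) + (\<Sum>l\<in>Small. q * M))"
        proof -
          let ?f = "\<lambda>l \<omega>. (1 + r1) * (1 + (\<omega> l)\<^sup>2)" and ?g = "\<lambda>l \<omega>. q * exp ((\<theta> + t) * (\<omega> l)\<^sup>2 / 2)"
          have i1: "(\<integral>\<omega>. ?f l \<omega> \<partial>gauss_seq) = (1 + r1) * 2" for l
            using gauss.prob_space by (simp add: gauss_moments)
          have i2: "(\<integral>\<omega>. ?g l \<omega> \<partial>gauss_seq) = q * M" for l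
            using M[of l] by simp
          have j1: "integrable gauss_seq (?f l)" for l
            by (intro integrable_mult_right Bochner_Integration.integrable_add gauss_integrable_square) auto
          have j2: "integrable gauss_seq (?g l)" for l
            by (intro integrable_mult_right Mint)
          have "(\<integral>\<omega>. (\<Sum>l\<in>{1..n J1} - Small. ?f l \<omega>) + (\<Sum>l\<in>Small. ?g l \<omega>) \<partial>gauss_seq) =
            (\<integral>\<omega>. (\<Sum>l\<in>{1..n J1} - Small. ?f l \<omega>) \<partial>gauss_seq) + (\<integral>\<omega>. (\<Sum>l\<in>Small. ?g l \<omega>) \<partial>gauss_seq)"
            by (intro Bochner_Integration.integral_add Bochner_Integration.integrable_sum j1 j2)
          also have "(\<integral>\<omega>. (\<Sum>l\<in>{1..n J1} - Small. ?f l \<omega>) \<partial>gauss_seq) = (\<Sum>l\<in>{1..n J1} - Small. (1 + r1) * 2)"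
            by (subst Bochner_Integration.integral_sum[OF j1]) (simp only: i1)
          also have "(\<integral>\<omega>. (\<Sum>l\<in>Small. ?g l \<omega>) \<partial>gauss_seq) = (\<Sum>l\<in>Small. q * M)"
            by (subst Bochner_Integration.integral_sum[OF j2]) (simp only: i2)
          finally show ?thesis unfolding W_def integral_mult_right_zero by simp
        qed
        also have "\<dots> = 2 / sqrt (2 * N) *
            (2 * (1 + r1) * real (card ({1..n J1} - Small)) + real (card Small) * (q * M))"
          by (simp add: mult_ac)
        also have "\<dots> \<le> 2 / sqrt (2 * N) * (2 * (1 + r1) * (2 ^ J0 + T N) + N * (q * M))"
        proof (intro mult_left_mono add_mono mult_right_mono card_big)
          show "real (card Small) \<le> N"
            unfolding N_def using card_mono[OF _ fin(2)] by simp
        qed (use r1 q M0 N1 in auto)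
        finally show ?thesis unfolding EW_def q_def a_def r1_def by simp
      qed
      have Rint: "integrable gauss_seq (\<lambda>\<omega>. (R \<omega>)\<^sup>2)"
        unfolding R_def power_mult_distrib
        by (intro integrable_mult_right gauss_linear_combination_square fin)
      have ER: "(\<integral>\<omega>. (R \<omega>)\<^sup>2 \<partial>gauss_seq) \<le> 2 * (T N / N)"
      proof -
        have "(\<integral>\<omega>. (R \<omega>)\<^sup>2 \<partial>gauss_seq) = (2 / sqrt (2 * N))\<^sup>2 * (\<Sum>l\<in>Small. (\<tau> l)\<^sup>2)"
          unfolding R_def power_mult_distrib integral_mult_right_zero gauss_linear_combination_square(2)[OF fin(1)] ..
        also have "\<dots> \<le> (2 / sqrt (2 * N))\<^sup>2 * T N" by (intro mult_left_mono small_sq) simp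
        also have "\<dots> = 2 * (T N / N)" using N1 by (simp add: power_divide)
        finally show ?thesis .
      qed
      have range: "\<rho> * r1 \<le> lam J1 (y \<omega>) j / s \<and> lam J1 (y \<omega>) j / s \<le> r1" if "j \<in> {J0..J1}" for j \<omega>
      proof -
        have "y \<omega> \<in> space (data_space (sample_size J1))" by (simp add: y_def n_def space_PiM)
        from threshold_selection(2)[OF thr elim(6) that this]
        have "\<rho> * (r1 * s) \<le> lam J1 (y \<omega>) j" "lam J1 (y \<omega>) j \<le> r1 * s"
          unfolding threshold_range_def Let_def by (auto simp: r1_def L_def N_def n_def s_def)
        then show ?thesis using s by (simp add: field_simps)
      qed
      have rr: "\<rho> * r1 \<le> r1" using \<rho> r1 by simp
      have dle: "\<bar>d \<omega>\<bar> \<le> W \<omega> + \<bar>R \<omega>\<bar>" for \<omega>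
      proof -
        have "\<bar>d \<omega>\<bar> = 2 / sqrt (2 * N) * \<bar>\<Sum>l=1..n J1. remainder J0 (\<lambda>j. lam J1 (y \<omega>) j / s) \<tau> \<omega> l\<bar>"
          using N1 by (simp add: d_def abs_mult)
        also have "\<dots> \<le> 2 / sqrt (2 * N) * ((\<Sum>l\<in>{1..n J1} - Small. (1 + r1) * (1 + (\<omega> l)\<^sup>2)) +
           (\<Sum>l\<in>Small. q * exp ((\<theta> + t) * (\<omega> l)\<^sup>2 / 2)) + \<bar>\<Sum>l\<in>Small. \<tau> l * \<omega> l\<bar>)"
          unfolding q_def Small_def n_def
          by (intro mult_left_mono remainder_sum_bound[where ?r0.0 = "\<rho> * r1"] range rr)
             (use \<theta> a1 \<rho>0 r1 N1 in \<open>auto simp: a_def A_def algebra_simps\<close>)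
        also have "\<dots> = W \<omega> + \<bar>R \<omega>\<bar>"
          using N1 by (simp add: W_def R_def abs_mult algebra_simps)
        finally show ?thesis .
      qed
      have W0: "0 \<le> W \<omega>" for \<omega>
        unfolding W_def using N1 r1 q by (intro mult_nonneg_nonneg add_nonneg_nonneg sum_nonneg) auto
      define Ev where "Ev = {y \<in> space (data_space (n J1)).
        (\<Sum>l=1..n J1. (\<mu> l - soft_estimate J0 (lam J1 y) y l)\<^sup>2) \<le> sq_radius \<sigma> \<alpha> J0 J1 (lam J1 y) y}"
      have Ev: "Ev \<in> sets (data_space (n J1))"
        unfolding Ev_def n_def by (rule loss_event_measurable) (rule threshold_selection[OF thr elim(6)])
      have npos: "0 < n J1" by (simp add: n_def)
      have eq: "{\<omega>. y \<omega> \<in> Ev} = {\<omega>. chi_sum (n J1) \<omega> + d \<omega> \<le> z}"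
      proof -
        have "y \<omega> \<in> Ev \<longleftrightarrow> chi_sum (n J1) \<omega> + d \<omega> \<le> z" for \<omega>
        proof -
          have t0: "0 \<le> lam J1 (y \<omega>) j" if "j \<in> {J0..J1}" for j
          proof -
            have "0 \<le> \<rho> * r1" using \<rho>0 r1 by simp
            then have "0 \<le> lam J1 (y \<omega>) j / s" using range[OF that, of \<omega>] by linarith
            then show ?thesis using s by (simp add: zero_le_divide_iff)
          qed
          have "y \<omega> \<in> space (data_space (n J1))" by (simp add: y_def n_def space_PiM)
          then have "y \<omega> \<in> Ev \<longleftrightarrow>
             (\<Sum>l=1..n J1. (\<mu> l - soft_estimate J0 (lam J1 (y \<omega>)) (y \<omega>) l)\<^sup>2) \<le> sq_radius \<sigma> \<alpha> J0 J1 (lam J1 (y \<omega>)) (y \<omega>)"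
            by (simp add: Ev_def)
          also have "\<dots> \<longleftrightarrow> chi_sum (n J1) \<omega> + d \<omega> \<le> z"
            using loss_le_radius_iff[OF \<sigma> elim(6) t0, where \<mu> = \<mu> and w = \<omega>]
            unfolding d_def z_def y_def n_def N_def s_def \<tau>_def by simp
          finally show ?thesis .
        qed
        then show ?thesis by simp
      qed
      have yeq: "y \<omega> = (\<lambda>l\<in>{1..n J1}. \<mu> l + \<sigma> / sqrt (real (n J1)) * \<omega> l)" for \<omega>
        by (simp add: y_def s_def N_def)
      note law = measure_coef_law[OF \<sigma> Ev npos, of \<mu>, folded yeq, unfolded eq]
      note pert = perturbed_probability[OF law(2) dle W0 Wint EWle Rint ER h(1)]
      \<comment> \<open>Half of \<epsilon> is spent on the exceptional events; the other half is
        shared by the limit theorem and the shift of the quantile.\<close>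
      have p: "EW N / h + 2 * (T N / N) / h\<^sup>2 < \<epsilon> / 2"
      proof -
        have "2 * (T N / N) / h\<^sup>2 = 2 / h\<^sup>2 * (T N / N)" by simp
        then show ?thesis using elim(1,2) unfolding N_def by linarith
      qed
      have "\<bar>measure gauss_seq {\<omega>. chi_sum (n J1) \<omega> + d \<omega> \<le> z} - (1 - \<alpha>)\<bar> < \<epsilon>"
        using pert p elim(4,5) h(2,3) Fz by linarith
      then show "\<bar>measure (coef_law \<sigma> (sample_size J1) \<mu>) {y \<in> space (data_space (sample_size J1)).
        (\<Sum>l=1..sample_size J1. (\<mu> l - soft_estimate J0 (lam J1 y) y l)\<^sup>2)
          \<le> sq_radius \<sigma> \<alpha> J0 J1 (lam J1 y) y} - (1 - \<alpha>)\<bar> < \<epsilon>"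
        using law(1) unfolding Ev_def n_def by simp
    qed
  qed
qed

section \<open>Besov bodies\<close>

text \<open>Every entry is at most the p-norm \<open>m\<close>, so the second factor of
  \<open>\<bar>x k\<bar> powr p * \<bar>x k\<bar> powr (2 - p)\<close> may be replaced by a power of
  \<open>m\<close>.\<close>

lemma sum_squares_le_powr_le_2:
  fixes x :: "nat \<Rightarrow> real"
  assumes "1 \<le> p" "p \<le> 2" "finite I"
  shows "(\<Sum>k\<in>I. (x k)\<^sup>2) \<le> ((\<Sum>k\<in>I. \<bar>x k\<bar> powr p) powr (1 / p))\<^sup>2"
proof -
  define S where "S = (\<Sum>k\<in>I. \<bar>x k\<bar> powr p)"
  have S0: "0 \<le> S" by (simp add: S_def sum_nonneg)
  define m where "m = S powr (1 / p)"
  have m: "0 \<le> m" "m powr p = S" using assms S0 by (auto simp: m_def powr_powr)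
  have le: "\<bar>x k\<bar> \<le> m" if "k \<in> I" for k
  proof -
    have "\<bar>x k\<bar> powr p \<le> S" unfolding S_def using assms that by (intro member_le_sum) auto
    then have "(\<bar>x k\<bar> powr p) powr (1 / p) \<le> m"
      unfolding m_def using assms by (intro powr_mono2) auto
    then show ?thesis using assms by (simp add: powr_powr)
  qed
  have "(x k)\<^sup>2 \<le> \<bar>x k\<bar> powr p * m powr (2 - p)" if "k \<in> I" for k
  proof (cases "x k = 0")
    case False
    then have "(x k)\<^sup>2 = \<bar>x k\<bar> powr p * \<bar>x k\<bar> powr (2 - p)"
      by (simp add: powr_add[symmetric])
    also have "\<dots> \<le> \<bar>x k\<bar> powr p * m powr (2 - p)"
      using le[OF that] assms by (intro mult_left_mono powr_mono2) auto
    finally show ?thesis .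
  qed simp
  then have "(\<Sum>k\<in>I. (x k)\<^sup>2) \<le> (\<Sum>k\<in>I. \<bar>x k\<bar> powr p * m powr (2 - p))" by (rule sum_mono)
  also have "\<dots> = m powr p * m powr (2 - p)" by (simp add: sum_distrib_right[symmetric] m(2) S_def)
  also have "\<dots> = m\<^sup>2"
    using m(1) by (cases "m = 0") (auto simp: powr_add[symmetric])
  finally show ?thesis by (simp add: m_def S_def)
qed

text \<open>Comparison of power means, where the cardinality is the price of lowering the exponent.
  Young's inequality is applied to each entry after normalisation.\<close>

lemma sum_squares_le_powr_ge_2:
  fixes x :: "nat \<Rightarrow> real"
  assumes "2 \<le> p" "finite I"
  shows "(\<Sum>k\<in>I. (x k)\<^sup>2) \<le> (real (card I) powr (1 / 2 - 1 / p) * (\<Sum>k\<in>I. \<bar>x k\<bar> powr p) powr (1 / p))\<^sup>2"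
proof (cases "I = {}")
  case False
  define N S where "N = real (card I)" and "S = (\<Sum>k\<in>I. \<bar>x k\<bar> powr p)"
  have N: "0 < N" using False assms by (simp add: N_def card_gt_0_iff)
  have S0: "0 \<le> S" by (simp add: S_def sum_nonneg)
  show ?thesis
  proof (cases "S = 0")
    case True
    then have "x k = 0" if "k \<in> I" for k
      using that assms by (simp add: S_def sum_nonneg_eq_0_iff)
    then show ?thesis by simp
  next
    case False
    then have S: "0 < S" using S0 by simp
    \<comment> \<open>The square of the power mean of order \<open>p\<close>; with this
      normalisation the bounds from Young's inequality add up to exactly \<open>N\<close>.\<close>
    define m where "m = (S / N) powr (2 / p)"
    have m: "0 < m" "m powr (p / 2) = S / N" using S N assms by (auto simp: m_def powr_powr)
    have young: "(x k)\<^sup>2 / m \<le> 2 / p * (\<bar>x k\<bar> powr p / (S / N)) + (1 - 2 / p)" for k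
    proof (cases "x k = 0")
      case True
      then show ?thesis using assms S N by (simp add: field_simps)
    next
      case False
      define u where "u = \<bar>x k\<bar> powr p / (S / N)"
      have u: "0 < u" using False S N by (simp add: u_def)
      have "(x k)\<^sup>2 = (\<bar>x k\<bar> powr p) powr (2 / p)"
        using False assms by (simp add: powr_powr)
      then have "(x k)\<^sup>2 / m = u powr (2 / p) * 1 powr (1 - 2 / p)"
        using S N by (simp add: u_def m_def powr_divide powr_mult)
      also have "\<dots> \<le> 2 / p * u + (1 - 2 / p) * 1"
        using assms u by (intro Youngs_inequality_0) auto
      finally show ?thesis by (simp add: u_def)
    qed
    have "(\<Sum>k\<in>I. (x k)\<^sup>2) / m = (\<Sum>k\<in>I. (x k)\<^sup>2 / m)" by (simp add: sum_divide_distrib)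
    also have "\<dots> \<le> (\<Sum>k\<in>I. 2 / p * (\<bar>x k\<bar> powr p / (S / N)) + (1 - 2 / p))"
      by (intro sum_mono young)
    also have "\<dots> = 2 / p * (S / (S / N)) + N * (1 - 2 / p)"
    proof -
      have "(\<Sum>k\<in>I. b * (\<bar>x k\<bar> powr p / a) + h) = b * (S / a) + N * h" for a b h :: real
        by (simp add: sum.distrib sum_distrib_left sum_divide_distrib S_def N_def)
      then show ?thesis .
    qed
    also have "\<dots> = N" using S by (simp add: algebra_simps)
    finally have "(\<Sum>k\<in>I. (x k)\<^sup>2) \<le> N * m" using m by (simp add: field_simps)
    also have "N * m = (N powr (1 / 2 - 1 / p) * S powr (1 / p))\<^sup>2"
    proof -
      have sq: "(y powr b)\<^sup>2 = y powr (2 * b)" for y b :: real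
        by (simp add: power2_eq_square powr_add[symmetric])
      have "N * m = N powr 1 * (N powr (- (2 / p)) * S powr (2 / p))"
        using N S by (simp add: m_def powr_divide powr_minus_divide)
      also have "\<dots> = N powr (1 - 2 / p) * S powr (2 / p)"
        by (simp only: mult.assoc[symmetric] powr_add[symmetric]) simp
      finally show ?thesis by (simp add: power_mult_distrib sq algebra_simps)
    qed
    finally show ?thesis by (simp add: S_def N_def)
  qed
qed simp

text \<open>A single term of the sum over levels is at most the whole sum for every
  \<open>q\<close>, which removes \<open>q\<close> from all later constants.\<close>

lemma besov_level_bound:
  assumes "\<mu> \<in> besov_body J0 p q s c" "1 \<le> p" "1 \<le> q" "0 \<le> c" "J0 \<le> j"
  shows "(\<Sum>k<2 ^ j. \<bar>\<mu> (2 ^ j + k + 1)\<bar> powr p) powr (1 / p) \<le> c * 2 powr (- (real j * (s + 1 / 2 - 1 / p)))"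
proof -
  define b where "b j = 2 powr (real j * (s + 1/2 - 1/p)) *
      (\<Sum>k<2 ^ j. \<bar>\<mu> (2 ^ j + k + 1)\<bar> powr p) powr (1/p)" for j
  define a where "a = (\<Sum>k<2 ^ J0. \<bar>\<mu> (k + 1)\<bar> powr p) powr (1/p)"
  have b0: "0 \<le> b j" for j by (simp add: b_def)
  have norm: "ereal a + (if summable (\<lambda>i. b (J0 + i) powr q)
          then ereal ((\<Sum>i. b (J0 + i) powr q) powr (1/q)) else \<infinity>) \<le> ereal c"
    using assms(1) by (simp only: besov_body_def besov_norm_def Let_def mem_Collect_eq a_def b_def)
  \<comment> \<open>An infinite norm is not at most \<open>c\<close>.\<close>
  then have sm: "summable (\<lambda>i. b (J0 + i) powr q)" by (auto split: if_splits)
  then have "a + (\<Sum>i. b (J0 + i) powr q) powr (1/q) \<le> c" using norm by simp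
  moreover have "0 \<le> a" by (simp add: a_def)
  ultimately have "(\<Sum>i. b (J0 + i) powr q) powr (1/q) \<le> c" by linarith
  moreover have "b j powr q \<le> (\<Sum>i. b (J0 + i) powr q)"
    using sum_le_suminf[OF sm, of "{j - J0}"] assms(5) by simp
  then have "(b j powr q) powr (1/q) \<le> (\<Sum>i. b (J0 + i) powr q) powr (1/q)"
    using assms(3) by (intro powr_mono2) auto
  then have "b j \<le> (\<Sum>i. b (J0 + i) powr q) powr (1/q)"
    using assms(3) b0[of j] by (simp add: powr_powr)
  ultimately have "b j \<le> c" by linarith
  then have "2 powr (- (real j * (s + 1/2 - 1/p))) * b j \<le> 2 powr (- (real j * (s + 1/2 - 1/p))) * c"
    by (intro mult_left_mono) auto
  then show ?thesis
    unfolding b_def mult.assoc[symmetric] powr_add[symmetric] by (simp add: mult.commute)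
qed

lemma besov_father_bound:
  assumes "\<mu> \<in> besov_body J0 p q s c" "1 \<le> p" "l \<in> {1..2 ^ J0}"
  shows "\<bar>\<mu> l\<bar> \<le> c"
proof -
  let ?S = "\<Sum>k<2 ^ J0. \<bar>\<mu> (k + 1)\<bar> powr p"
  have "\<bar>\<mu> (l - 1 + 1)\<bar> powr p \<le> ?S"
    using assms(3) by (intro member_le_sum) auto
  then have "(\<bar>\<mu> l\<bar> powr p) powr (1/p) \<le> ?S powr (1/p)"
    using assms by (intro powr_mono2) auto
  then have 1: "\<bar>\<mu> l\<bar> \<le> ?S powr (1/p)" using assms by (simp add: powr_powr)
  let ?b = "\<lambda>j. 2 powr (real j * (s + 1/2 - 1/p)) *
      (\<Sum>k<2 ^ j. \<bar>\<mu> (2 ^ j + k + 1)\<bar> powr p) powr (1/p)"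
  let ?t = "if summable (\<lambda>i. ?b (J0 + i) powr q)
          then ereal ((\<Sum>i. ?b (J0 + i) powr q) powr (1/q)) else \<infinity>"
  have norm: "ereal (?S powr (1/p)) + ?t \<le> ereal c"
    using assms(1) by (simp only: besov_body_def besov_norm_def Let_def mem_Collect_eq)
  have t0: "0 \<le> ?t" by simp
  have "ereal (?S powr (1/p)) \<le> ereal (?S powr (1/p)) + ?t" using add_left_mono[OF t0] by simp
  from order_trans[OF this norm] have "?S powr (1/p) \<le> c" by (simp only: ereal_less_eq(3))
  then show ?thesis using 1 by linarith
qed

text \<open>For \<open>p < 2\<close> the passage to the 2-norm is free and the weight exponent
  \<open>s + 1/2 - 1/p\<close> remains. For \<open>p \<ge> 2\<close> it costs
  \<open>2 powr (j * (1/2 - 1/p))\<close>, which cancels the correction and leaves \<open>s\<close>.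
  Both are \<open>besov_gamma\<close>.\<close>

lemma besov_body_energy:
  assumes "\<mu> \<in> besov_body J0 p q s c" "1 \<le> p" "1 \<le> q" "0 \<le> c" "J0 \<le> j"
  shows "(\<Sum>k<2 ^ j. (\<mu> (2 ^ j + k + 1))\<^sup>2) \<le> c\<^sup>2 * 2 powr (- 2 * besov_gamma p s * real j)"
proof -
  let ?S = "(\<Sum>k<2 ^ j. \<bar>\<mu> (2 ^ j + k + 1)\<bar> powr p) powr (1 / p)"
  note le = besov_level_bound[OF assms]
  have sq: "(2 powr x)\<^sup>2 = 2 powr (2 * x)" for x :: real
    by (simp add: power2_eq_square powr_add[symmetric])
  have "(\<Sum>k<2 ^ j. (\<mu> (2 ^ j + k + 1))\<^sup>2) \<le> (c * 2 powr (- (besov_gamma p s * real j)))\<^sup>2"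
  proof (cases "2 \<le> p")
    case False
    have "(\<Sum>k<2 ^ j. (\<mu> (2 ^ j + k + 1))\<^sup>2) \<le> ?S\<^sup>2"
      using False assms by (intro sum_squares_le_powr_le_2) auto
    also have "\<dots> \<le> (c * 2 powr (- (besov_gamma p s * real j)))\<^sup>2"
      using le False by (intro power_mono) (auto simp: besov_gamma_def mult.commute)
    finally show ?thesis .
  next
    case True
    have "(\<Sum>k<2 ^ j. (\<mu> (2 ^ j + k + 1))\<^sup>2) \<le> (real (card {..<(2::nat) ^ j}) powr (1 / 2 - 1 / p) * ?S)\<^sup>2"
      using True by (intro sum_squares_le_powr_ge_2) auto
    also have "\<dots> = (2 powr (real j * (1 / 2 - 1 / p)) * ?S)\<^sup>2"
      by (simp add: powr_powr powr_realpow[symmetric])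
    also have "\<dots> \<le> (2 powr (real j * (1 / 2 - 1 / p)) * (c * 2 powr (- (real j * (s + 1 / 2 - 1 / p)))))\<^sup>2"
      by (intro power_mono mult_left_mono le) auto
    also have "2 powr (real j * (1 / 2 - 1 / p)) * (c * 2 powr (- (real j * (s + 1 / 2 - 1 / p)))) =
        c * 2 powr (- (besov_gamma p s * real j))"
      using True by (simp add: besov_gamma_def mult.left_commute powr_add[symmetric] algebra_simps)
    finally show ?thesis .
  qed
  then show ?thesis by (simp add: power_mult_distrib sq mult_ac)
qed

text \<open>Keeps the suprema over truncated bodies from ranging over the empty set.\<close>

lemma zero_in_besov_body:
  assumes "0 \<le> c" "1 \<le> p" "1 \<le> q"
  shows "(\<lambda>_. 0) \<in> besov_body J0 p q s c"
  using assms by (simp add: besov_body_def besov_norm_def)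

lemma coef_law_cong:
  assumes "\<And>l. l \<in> {1..n} \<Longrightarrow> \<mu> l = \<nu> l"
  shows "coef_law \<sigma> n \<mu> = coef_law \<sigma> n \<nu>"
  unfolding coef_law_def using assms by (intro PiM_cong) auto

lemma space_coef_law [simp]: "space (coef_law \<sigma> n \<mu>) = space (data_space n)"
  by (simp add: coef_law_def space_PiM)

text \<open>A real supremum is meaningful only for nonempty bounded families; boundedness is read
  off the eventual bound itself.\<close>

lemma SUP_tendsto_zero:
  fixes f :: "nat \<Rightarrow> 'a \<Rightarrow> real"
  assumes ne: "\<And>i. A i \<noteq> {}" and nn: "\<And>i x. 0 \<le> f i x"
    and ev: "\<And>\<epsilon>. 0 < \<epsilon> \<Longrightarrow> eventually (\<lambda>i. \<forall>x\<in>A i. f i x < \<epsilon>) sequentially"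
  shows "(\<lambda>i. SUP x\<in>A i. f i x) \<longlonglongrightarrow> 0"
proof (rule tendstoI)
  fix \<epsilon> :: real assume "0 < \<epsilon>"
  \<comment> \<open>Half of \<epsilon>, because a strict bound becomes weak under the
    supremum.\<close>
  then have "eventually (\<lambda>i. \<forall>x\<in>A i. f i x < \<epsilon> / 2) sequentially" by (intro ev) simp
  then show "eventually (\<lambda>i. dist (SUP x\<in>A i. f i x) 0 < \<epsilon>) sequentially"
  proof eventually_elim
    case (elim i)
    have "(SUP x\<in>A i. f i x) \<le> \<epsilon> / 2" using elim by (intro cSUP_least[OF ne]) force
    moreover have "0 \<le> (SUP x\<in>A i. f i x)"
    proof -
      obtain x where x: "x \<in> A i" using ne by blast
      have "f i x \<le> (SUP x\<in>A i. f i x)"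
        using elim x by (intro cSUP_upper bdd_aboveI2[where M = "\<epsilon> / 2"]) force+
      then show ?thesis using nn[of i x] by linarith
    qed
    ultimately show ?case using \<open>0 < \<epsilon>\<close> by (simp add: dist_real_def)
  qed
qed

section \<open>Square integrable functions, orthonormal sums, and coverage for Besov bodies\<close>

lemma sq_integrable_product:
  assumes "sq_integrable M f" "sq_integrable M g"
  shows "integrable M (\<lambda>x. f x * g x)"
proof (rule Bochner_Integration.integrable_bound)
  show "integrable M (\<lambda>x. (f x)\<^sup>2 + (g x)\<^sup>2)" using assms by (simp add: sq_integrable_def)
  show "(\<lambda>x. f x * g x) \<in> borel_measurable M"
    using assms unfolding sq_integrable_def by (intro borel_measurable_times) auto
  have "\<bar>a * b\<bar> \<le> a\<^sup>2 + b\<^sup>2" for a b :: real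
  proof -
    have "2 * \<bar>a\<bar> * \<bar>b\<bar> \<le> a\<^sup>2 + b\<^sup>2" using sum_squares_bound[of "\<bar>a\<bar>" "\<bar>b\<bar>"] by simp
    moreover have "0 \<le> \<bar>a\<bar> * \<bar>b\<bar>" by simp
    ultimately show ?thesis unfolding abs_mult by linarith
  qed
  then show "AE x in M. norm (f x * g x) \<le> norm ((f x)\<^sup>2 + (g x)\<^sup>2)" by simp
qed

lemma sq_integrable_scale: "sq_integrable M f \<Longrightarrow> sq_integrable M (\<lambda>x. c * f x)"
  unfolding sq_integrable_def power_mult_distrib
  by (intro conjI borel_measurable_times integrable_mult_right) auto

lemma sq_integrable_add:
  assumes "sq_integrable M f" "sq_integrable M g"
  shows "sq_integrable M (\<lambda>x. f x + g x)"
  using assms sq_integrable_product[OF assms] unfolding sq_integrable_def power2_sum mult.assoc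
  by (intro conjI borel_measurable_add Bochner_Integration.integrable_add integrable_mult_right) auto

lemma sq_integrable_diff:
  assumes "sq_integrable M f" "sq_integrable M g"
  shows "sq_integrable M (\<lambda>x. f x - g x)"
  using sq_integrable_add[OF assms(1) sq_integrable_scale[OF assms(2), of "-1"]] by simp

lemma sq_integrable_zero [simp]: "sq_integrable M (\<lambda>_. 0)"
  by (simp add: sq_integrable_def)

lemma sq_integrable_sum:
  assumes "\<And>i. i \<in> I \<Longrightarrow> sq_integrable M (f i)"
  shows "sq_integrable M (\<lambda>x. \<Sum>i\<in>I. f i x)"
  using assms by (induction I rule: infinite_finite_induct) (auto intro: sq_integrable_add)

lemma L2_norm_nonneg [simp]: "0 \<le> L2_norm M f"
  by (simp add: L2_norm_def integral_nonneg_AE)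

lemma L2_norm_square: "(L2_norm M f)\<^sup>2 = (LINT x|M. (f x)\<^sup>2)"
  by (simp add: L2_norm_def integral_nonneg_AE)

lemma L2_norm_scale: "L2_norm M (\<lambda>x. c * f x) = \<bar>c\<bar> * L2_norm M f"
  by (simp add: L2_norm_def power_mult_distrib real_sqrt_mult)

text \<open>The integral of \<open>(t * f x + g x)\<^sup>2\<close> is a nonnegative polynomial of
  degree at most two in \<open>t\<close>, which bounds its discriminant.\<close>

lemma L2_inner_le_norm:
  assumes "sq_integrable M f" "sq_integrable M g"
  shows "\<bar>L2_inner M f g\<bar> \<le> L2_norm M f * L2_norm M g"
proof -
  note int = sq_integrable_product[OF assms]
  have q: "0 \<le> (LINT x|M. (f x)\<^sup>2) * t\<^sup>2 + 2 * L2_inner M f g * t + (LINT x|M. (g x)\<^sup>2)" for t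
  proof -
    have "(LINT x|M. (t * f x + g x)\<^sup>2) = (LINT x|M. t\<^sup>2 * (f x)\<^sup>2 + (2 * t * (f x * g x) + (g x)\<^sup>2))"
      by (intro Bochner_Integration.integral_cong) (auto simp: power2_sum power_mult_distrib mult_ac)
    also have "\<dots> = t\<^sup>2 * (LINT x|M. (f x)\<^sup>2) + (2 * t * L2_inner M f g + (LINT x|M. (g x)\<^sup>2))"
      using assms int by (simp add: sq_integrable_def L2_inner_def)
    finally show ?thesis
      using integral_nonneg_AE[of "\<lambda>x. (t * f x + g x)\<^sup>2" M] by (simp add: algebra_simps)
  qed
  let ?a = "LINT x|M. (f x)\<^sup>2" and ?b = "L2_inner M f g" and ?c = "LINT x|M. (g x)\<^sup>2"
  have a0: "0 \<le> ?a" and c0: "0 \<le> ?c" by (simp_all add: integral_nonneg_AE)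
  have "?b\<^sup>2 \<le> ?a * ?c"
  proof (cases "?a = 0")
    case True
    have "?b = 0"
    proof (rule ccontr)
      assume b: "?b \<noteq> 0"
      have "0 \<le> 2 * ?b * t + ?c" for t using q[of t] True by simp
      \<comment> \<open>At this \<open>t\<close> the linear polynomial would equal -1.\<close>
      from this[of "- (?c + 1) / (2 * ?b)"] b show False by simp
    qed
    then show ?thesis using True by simp
  next
    case False
    then have a: "0 < ?a" using a0 by linarith
    have "?a * (- ?b / ?a)\<^sup>2 + 2 * ?b * (- ?b / ?a) + ?c = ?c - ?b\<^sup>2 / ?a"
      using a by (simp add: power2_eq_square field_simps)
    then have "?b\<^sup>2 / ?a \<le> ?c" using q[of "- ?b / ?a"] by linarith
    then show ?thesis using a by (simp add: field_simps)
  qed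
  then have "sqrt (?b\<^sup>2) \<le> sqrt (?a * ?c)" by (rule real_sqrt_le_mono)
  then show ?thesis by (simp add: L2_norm_def real_sqrt_mult)
qed

lemma L2_norm_triangle:
  assumes "sq_integrable M f" "sq_integrable M g"
  shows "L2_norm M (\<lambda>x. f x + g x) \<le> L2_norm M f + L2_norm M g"
proof (rule power2_le_imp_le)
  have "(L2_norm M (\<lambda>x. f x + g x))\<^sup>2 = (LINT x|M. (f x)\<^sup>2 + ((g x)\<^sup>2 + 2 * (f x * g x)))"
    unfolding L2_norm_square by (intro Bochner_Integration.integral_cong) (auto simp: power2_sum)
  also have "\<dots> = (L2_norm M f)\<^sup>2 + ((L2_norm M g)\<^sup>2 + 2 * L2_inner M f g)"
    using assms sq_integrable_product[OF assms]
    by (simp add: sq_integrable_def L2_norm_square L2_inner_def)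
  also have "\<dots> \<le> (L2_norm M f + L2_norm M g)\<^sup>2"
    using L2_inner_le_norm[OF assms] by (simp add: power2_sum)
  finally show "(L2_norm M (\<lambda>x. f x + g x))\<^sup>2 \<le> (L2_norm M f + L2_norm M g)\<^sup>2" .
qed simp

lemma L2_norm_triangle_diff:
  assumes "sq_integrable M f" "sq_integrable M g"
  shows "L2_norm M (\<lambda>x. f x - g x) \<le> L2_norm M f + L2_norm M g"
  using L2_norm_triangle[OF assms(1) sq_integrable_scale[OF assms(2), of "-1"]]
    L2_norm_scale[of M "-1" g] by simp

lemma L2_norm_zero [simp]: "L2_norm M (\<lambda>_. 0) = 0"
  by (simp add: L2_norm_def)

lemma L2_norm_sum_le:
  assumes "\<And>i. i \<in> I \<Longrightarrow> sq_integrable M (f i)"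
  shows "L2_norm M (\<lambda>x. \<Sum>i\<in>I. f i x) \<le> (\<Sum>i\<in>I. L2_norm M (f i))"
  using assms
proof (induction I rule: infinite_finite_induct)
  case (insert i I)
  have "L2_norm M (\<lambda>x. f i x + (\<Sum>i\<in>I. f i x)) \<le> L2_norm M (f i) + L2_norm M (\<lambda>x. \<Sum>i\<in>I. f i x)"
    using insert.prems by (intro L2_norm_triangle sq_integrable_sum) auto
  also have "\<dots> \<le> L2_norm M (f i) + (\<Sum>i\<in>I. L2_norm M (f i))"
    using insert by (intro add_left_mono) auto
  finally show ?case using insert.hyps by simp
qed auto

lemma L2_inner_sum_left:
  assumes "\<And>i. i \<in> I \<Longrightarrow> sq_integrable M (f i)" "sq_integrable M g"
  shows "L2_inner M (\<lambda>x. \<Sum>i\<in>I. a i * f i x) g = (\<Sum>i\<in>I. a i * L2_inner M (f i) g)"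
proof -
  have "L2_inner M (\<lambda>x. \<Sum>i\<in>I. a i * f i x) g = (LINT x|M. (\<Sum>i\<in>I. a i * (f i x * g x)))"
    unfolding L2_inner_def by (simp add: sum_distrib_right mult.assoc)
  also have "\<dots> = (\<Sum>i\<in>I. (LINT x|M. a i * (f i x * g x)))"
    using assms by (intro Bochner_Integration.integral_sum integrable_mult_right sq_integrable_product) auto
  finally show ?thesis by (simp add: L2_inner_def)
qed

lemma L2_inner_commute: "L2_inner M f g = L2_inner M g f"
  by (simp add: L2_inner_def mult.commute)

lemma L2_inner_diff_left:
  assumes "sq_integrable M f" "sq_integrable M g" "sq_integrable M h"
  shows "L2_inner M (\<lambda>x. f x - g x) h = L2_inner M f h - L2_inner M g h"
  using sq_integrable_product[OF assms(1,3)] sq_integrable_product[OF assms(2,3)]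
  by (simp add: L2_inner_def left_diff_distrib)

lemma L2_norm_orthonormal_sum:
  assumes "finite I" "\<And>i. i \<in> I \<Longrightarrow> sq_integrable M (e i)"
    and "\<And>i j. i \<in> I \<Longrightarrow> j \<in> I \<Longrightarrow> L2_inner M (e i) (e j) = of_bool (i = j)"
  shows "(L2_norm M (\<lambda>x. \<Sum>i\<in>I. a i * e i x))\<^sup>2 = (\<Sum>i\<in>I. (a i)\<^sup>2)"
proof -
  let ?g = "\<lambda>x. \<Sum>i\<in>I. a i * e i x"
  have sq: "sq_integrable M ?g" using assms by (intro sq_integrable_sum sq_integrable_scale)
  have "(L2_norm M ?g)\<^sup>2 = L2_inner M ?g ?g"
    unfolding L2_norm_square L2_inner_def by (simp add: power2_eq_square)
  also have "\<dots> = (\<Sum>i\<in>I. a i * L2_inner M ?g (e i))"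
    using L2_inner_sum_left[OF assms(2) sq, where a = a] by (simp add: L2_inner_commute)
  also have "\<dots> = (\<Sum>i\<in>I. a i * (\<Sum>j\<in>I. a j * of_bool (j = i)))"
    using assms by (intro sum.cong refl arg_cong2[where f = "(*)"]) (subst L2_inner_sum_left, auto)
  also have "\<dots> = (\<Sum>i\<in>I. (a i)\<^sup>2)"
    using assms(1) by (auto simp: power2_eq_square intro!: sum.cong)
  finally show ?thesis .
qed

lemma wavelet_sum_coefficient:
  assumes "complete_orthonormal e" "1 \<le> m"
  shows "L2_inner unit_leb (wavelet_sum e n \<mu>) (e m) = (if m \<le> n then \<mu> m else 0)"
proof -
  have "L2_inner unit_leb (wavelet_sum e n \<mu>) (e m) = (\<Sum>l=1..n. \<mu> l * of_bool (l = m))"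
    unfolding wavelet_sum_def[abs_def]
    using assms unfolding complete_orthonormal_def by (subst L2_inner_sum_left) (auto intro!: sum.cong)
  also have "\<dots> = (if m \<le> n then \<mu> m else 0)" using assms(2) by auto
  finally show ?thesis .
qed

text \<open>Orthonormality recovers each entry as a coefficient, and extensional vectors are
  determined by their entries. Covering the function is therefore the same event as covering the
  vector.\<close>

lemma wavelet_sum_eq_iff:
  assumes "complete_orthonormal e" "\<mu> \<in> {1..n} \<rightarrow>\<^sub>E UNIV" "\<nu> \<in> {1..n} \<rightarrow>\<^sub>E UNIV"
  shows "wavelet_sum e n \<mu> = wavelet_sum e n \<nu> \<longleftrightarrow> \<mu> = \<nu>"
proof
  assume eq: "wavelet_sum e n \<mu> = wavelet_sum e n \<nu>"
  show "\<mu> = \<nu>"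
  proof (rule PiE_ext[OF assms(2,3)])
    fix l assume "l \<in> {1..n}"
    then show "\<mu> l = \<nu> l"
      using wavelet_sum_coefficient[OF assms(1), of l n \<mu>]
        wavelet_sum_coefficient[OF assms(1), of l n \<nu>] eq by auto
  qed
qed simp

lemma mem_conf_A_iff:
  assumes "complete_orthonormal e" "\<mu> \<in> {1..sample_size J1} \<rightarrow>\<^sub>E UNIV"
  shows "wavelet_sum e (sample_size J1) \<mu> \<in> conf_A e \<sigma> \<alpha> J0 lam J1 y \<longleftrightarrow> \<mu> \<in> conf_D \<sigma> \<alpha> J0 lam J1 y"
proof
  assume "wavelet_sum e (sample_size J1) \<mu> \<in> conf_A e \<sigma> \<alpha> J0 lam J1 y"
  then obtain \<nu> where \<nu>: "\<nu> \<in> conf_D \<sigma> \<alpha> J0 lam J1 y"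
    "wavelet_sum e (sample_size J1) \<mu> = wavelet_sum e (sample_size J1) \<nu>"
    unfolding conf_A_def by blast
  then have "\<nu> \<in> {1..sample_size J1} \<rightarrow>\<^sub>E UNIV" by (simp add: conf_D_def)
  then show "\<mu> \<in> conf_D \<sigma> \<alpha> J0 lam J1 y"
    using \<nu> wavelet_sum_eq_iff[OF assms] by blast
qed (simp add: conf_A_def)

lemma cover_prob_conf_D:
  "cover_prob \<sigma> (sample_size J1) (restrict \<mu> {1..sample_size J1}) (restrict \<mu> {1..sample_size J1})
      (conf_D \<sigma> \<alpha> J0 lam J1) =
    measure (coef_law \<sigma> (sample_size J1) \<mu>) {y \<in> space (data_space (sample_size J1)).
        (\<Sum>l=1..sample_size J1. (\<mu> l - soft_estimate J0 (lam J1 y) y l)\<^sup>2)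
          \<le> sq_radius \<sigma> \<alpha> J0 J1 (lam J1 y) y}"
proof -
  have "coef_law \<sigma> (sample_size J1) (restrict \<mu> {1..sample_size J1}) = coef_law \<sigma> (sample_size J1) \<mu>"
    by (intro coef_law_cong) auto
  moreover have "(\<Sum>l=1..sample_size J1. (restrict \<mu> {1..sample_size J1} l - soft_estimate J0 (lam J1 y) y l)\<^sup>2) =
     (\<Sum>l=1..sample_size J1. (\<mu> l - soft_estimate J0 (lam J1 y) y l)\<^sup>2)" for y
    by (intro sum.cong) auto
  ultimately show ?thesis by (simp add: cover_prob_def conf_D_def)
qed

lemma coverage_besov_body:
  assumes "0 < \<sigma>" "0 < \<alpha>" "\<alpha> < 1" "1 / sqrt 2 < \<rho>" "\<rho> < 1"
    and "global_thresholds \<sigma> \<rho> J0 lam \<or> levelwise_thresholds \<sigma> \<rho> J0 lam"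
    and pq: "1 \<le> p" "1 \<le> q" and "1 / 2 < besov_gamma p s" and c: "0 < c"
  shows "(\<lambda>J1. SUP \<mu>\<in>truncated_body (sample_size J1) (besov_body J0 p q s c).
          \<bar>cover_prob \<sigma> (sample_size J1) \<mu> \<mu> (conf_D \<sigma> \<alpha> J0 lam J1) - (1 - \<alpha>)\<bar>)
        \<longlonglongrightarrow> 0"
proof (rule SUP_tendsto_zero)
  show "truncated_body (sample_size J1) (besov_body J0 p q s c) \<noteq> {}" for J1
    using zero_in_besov_body[of c p q] c pq unfolding truncated_body_def by fastforce
  fix \<epsilon> :: real assume "0 < \<epsilon>"
  from coverage_uniform[OF assms(1-6) assms(9) zero_le_power2[of c] this]
  show "eventually (\<lambda>J1. \<forall>\<mu>\<in>truncated_body (sample_size J1) (besov_body J0 p q s c).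
          \<bar>cover_prob \<sigma> (sample_size J1) \<mu> \<mu> (conf_D \<sigma> \<alpha> J0 lam J1) - (1 - \<alpha>)\<bar> < \<epsilon>) sequentially"
  proof eventually_elim
    case (elim J1)
    show ?case
    proof
      fix \<mu> assume "\<mu> \<in> truncated_body (sample_size J1) (besov_body J0 p q s c)"
      then obtain \<nu> where \<nu>: "\<nu> \<in> besov_body J0 p q s c" "\<mu> = restrict \<nu> {1..sample_size J1}"
        by (auto simp: truncated_body_def)
      have "\<forall>j\<in>{J0..J1}. (\<Sum>k<2 ^ j. (\<nu> (2 ^ j + k + 1))\<^sup>2) \<le> c\<^sup>2 * 2 powr (- 2 * besov_gamma p s * real j)"
        using c pq by (intro ballI besov_body_energy[OF \<nu>(1)]) auto
      then show "\<bar>cover_prob \<sigma> (sample_size J1) \<mu> \<mu> (conf_D \<sigma> \<alpha> J0 lam J1) - (1 - \<alpha>)\<bar> < \<epsilon>"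
        unfolding \<nu>(2) cover_prob_conf_D using elim by blast
    qed
  qed
qed simp

lemma cover_prob_conf_A:
  assumes "complete_orthonormal e" "\<mu> \<in> truncated_body (sample_size J1) B"
  shows "cover_prob \<sigma> (sample_size J1) \<mu> (wavelet_sum e (sample_size J1) \<mu>) (conf_A e \<sigma> \<alpha> J0 lam J1) =
    cover_prob \<sigma> (sample_size J1) \<mu> \<mu> (conf_D \<sigma> \<alpha> J0 lam J1)"
proof -
  have "\<mu> \<in> {1..sample_size J1} \<rightarrow>\<^sub>E UNIV" using assms(2) by (auto simp: truncated_body_def)
  then show ?thesis by (simp add: cover_prob_def mem_conf_A_iff[OF assms(1)])
qed

section \<open>Wavelet expansions and cell averages\<close>

text \<open>A finite nonnegative integral yields integrability along with the norm bound, as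
  required for limits that come out of Fatou's lemma.\<close>

lemma L2_norm_leI:
  assumes "h \<in> borel_measurable M" "0 \<le> b" "(\<integral>\<^sup>+x. ennreal ((h x)\<^sup>2) \<partial>M) \<le> ennreal (b\<^sup>2)"
  shows "sq_integrable M h" "L2_norm M h \<le> b"
proof -
  have m: "(\<lambda>x. (h x)\<^sup>2) \<in> borel_measurable M" using assms(1) by (intro borel_measurable_power)
  have int: "integrable M (\<lambda>x. (h x)\<^sup>2)"
    by (intro integrableI_nonneg m le_less_trans[OF assms(3)]) auto
  then show "sq_integrable M h" using assms(1) by (simp add: sq_integrable_def)
  have "ennreal (LINT x|M. (h x)\<^sup>2) \<le> ennreal (b\<^sup>2)"
    using assms(3) nn_integral_eq_integral[OF int] by simp
  then have "(LINT x|M. (h x)\<^sup>2) \<le> b\<^sup>2" by (simp add: ennreal_le_iff)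
  then show "L2_norm M h \<le> b"
    unfolding L2_norm_def using assms(2) real_le_lsqrt by (simp add: integral_nonneg_AE)
qed

lemma L2_norm_nn_integral:
  assumes "sq_integrable M h"
  shows "(\<integral>\<^sup>+x. ennreal ((h x)\<^sup>2) \<partial>M) = ennreal ((L2_norm M h)\<^sup>2)"
  using assms unfolding L2_norm_square sq_integrable_def by (intro nn_integral_eq_integral) auto

lemma L2_norm_cong_AE:
  assumes "f \<in> borel_measurable M" "g \<in> borel_measurable M" "AE x in M. f x = g x"
  shows "L2_norm M f = L2_norm M g"
proof -
  have "(LINT x|M. (f x)\<^sup>2) = (LINT x|M. (g x)\<^sup>2)"
    using assms by (intro integral_cong_AE borel_measurable_power) auto
  then show ?thesis by (simp add: L2_norm_def)
qed

context finite_measure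
begin

lemma sq_integrable_one: "sq_integrable M (\<lambda>_. 1)"
  by (simp add: sq_integrable_def)

lemma sq_integrable_imp_integrable: "sq_integrable M f \<Longrightarrow> integrable M f"
  using sq_integrable_product[of M f "\<lambda>_. 1"] sq_integrable_one by simp

text \<open>Since the norms are summable, the series converges absolutely almost everywhere, so no
  completeness of \<open>L\<^sup>2\<close> is needed.\<close>

lemma L2_series_limit:
  fixes u :: "nat \<Rightarrow> 'a \<Rightarrow> real"
  assumes u: "\<And>j. sq_integrable M (u j)" and a: "summable a" "\<And>j. L2_norm M (u j) \<le> a j"
  obtains g where "sq_integrable M g"
    and "\<And>J. L2_norm M (\<lambda>x. g x - (\<Sum>j<J. u j x)) \<le> (\<Sum>j. a (j + J))"
proof -
  define C where "C = L2_norm M (\<lambda>_. 1)"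
  define g where "g x = (\<Sum>j. u j x)" for x
  have meas [measurable]: "u j \<in> borel_measurable M" for j using u by (simp add: sq_integrable_def)
  have a0: "0 \<le> a j" for j using a(2)[of j] L2_norm_nonneg[of M "u j"] by linarith
  have "(\<integral>\<^sup>+x. ennreal \<bar>u j x\<bar> \<partial>M) \<le> ennreal (C * a j)" for j
  proof -
    have abs_sq: "sq_integrable M (\<lambda>x. \<bar>u j x\<bar>)" using u[of j] unfolding sq_integrable_def by auto
    have "(\<integral>\<^sup>+x. ennreal \<bar>u j x\<bar> \<partial>M) = ennreal (LINT x|M. \<bar>u j x\<bar>)"
      by (intro nn_integral_eq_integral integrable_abs sq_integrable_imp_integrable u) auto
    also have "(LINT x|M. \<bar>u j x\<bar>) \<le> C * a j"
    proof -
      have "(LINT x|M. \<bar>u j x\<bar>) = L2_inner M (\<lambda>_. 1) (\<lambda>x. \<bar>u j x\<bar>)" by (simp add: L2_inner_def)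
      also have "\<dots> \<le> C * L2_norm M (\<lambda>x. \<bar>u j x\<bar>)"
        unfolding C_def using L2_inner_le_norm[OF sq_integrable_one abs_sq] by linarith
      also have "L2_norm M (\<lambda>x. \<bar>u j x\<bar>) = L2_norm M (u j)" by (simp add: L2_norm_def)
      also have "C * L2_norm M (u j) \<le> C * a j" using a(2) by (intro mult_left_mono) (auto simp: C_def)
      finally show ?thesis .
    qed
    finally show ?thesis by (simp add: ennreal_leI)
  qed
  then have "(\<integral>\<^sup>+x. (\<Sum>j. ennreal \<bar>u j x\<bar>) \<partial>M) \<le> (\<Sum>j. ennreal (C * a j))"
    by (subst nn_integral_suminf) (auto intro!: suminf_le)
  also have "\<dots> = ennreal (\<Sum>j. C * a j)"
    using a a0 by (intro suminf_ennreal2 summable_mult) (auto simp: C_def)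
  also have "\<dots> < \<infinity>" by simp
  finally have "AE x in M. (\<Sum>j. ennreal \<bar>u j x\<bar>) \<noteq> \<infinity>"
    by (intro nn_integral_noteq_infinite) auto
  then have sm: "AE x in M. summable (\<lambda>j. u j x)"
  proof eventually_elim
    case (elim x)
    then have "summable (\<lambda>j. \<bar>u j x\<bar>)"
      by (intro summable_suminf_not_top) (auto simp: top_unique)
    then show ?case by (rule summable_rabs_cancel)
  qed
  have gm [measurable]: "g \<in> borel_measurable M" unfolding g_def by measurable
  have tail: "(\<integral>\<^sup>+x. ennreal ((g x - (\<Sum>j<J. u j x))\<^sup>2) \<partial>M) \<le> ennreal ((\<Sum>j. a (j + J))\<^sup>2)" for J
  proof -
    let ?d = "\<lambda>n x. (\<Sum>j<n + J. u j x) - (\<Sum>j<J. u j x)"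
    \<comment> \<open>Almost everywhere the tail is a limit of finite block sums, to which Fatou's
      lemma applies.\<close>
    have "(\<integral>\<^sup>+x. ennreal ((g x - (\<Sum>j<J. u j x))\<^sup>2) \<partial>M) = (\<integral>\<^sup>+x. liminf (\<lambda>n. ennreal ((?d n x)\<^sup>2)) \<partial>M)"
    proof (rule nn_integral_cong_AE, use sm in eventually_elim)
      fix x assume "summable (\<lambda>j. u j x)"
      then have "(\<lambda>n. \<Sum>j<n. u j x) \<longlonglongrightarrow> g x" by (simp add: g_def summable_LIMSEQ)
      then have "(\<lambda>n. \<Sum>j<n + J. u j x) \<longlonglongrightarrow> g x" by (rule LIMSEQ_ignore_initial_segment)
      then have "(\<lambda>n. ennreal ((?d n x)\<^sup>2)) \<longlonglongrightarrow> ennreal ((g x - (\<Sum>j<J. u j x))\<^sup>2)"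
        by (intro tendsto_intros tendsto_ennrealI)
      then show "ennreal ((g x - (\<Sum>j<J. u j x))\<^sup>2) = liminf (\<lambda>n. ennreal ((?d n x)\<^sup>2))"
        by (rule lim_imp_Liminf[symmetric, OF trivial_limit_sequentially])
    qed
    also have "\<dots> \<le> liminf (\<lambda>n. \<integral>\<^sup>+x. ennreal ((?d n x)\<^sup>2) \<partial>M)"
      by (intro nn_integral_liminf) auto
    also have "\<dots> \<le> ennreal ((\<Sum>j. a (j + J))\<^sup>2)"
    proof -
      have "(\<integral>\<^sup>+x. ennreal ((?d n x)\<^sup>2) \<partial>M) \<le> ennreal ((\<Sum>j. a (j + J))\<^sup>2)" for n
      proof -
        have d: "?d n x = (\<Sum>j<n. u (j + J) x)" for x
          by (induction n) auto
        have sq: "sq_integrable M (\<lambda>x. \<Sum>j<n. u (j + J) x)" by (intro sq_integrable_sum u)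
        have "L2_norm M (\<lambda>x. \<Sum>j<n. u (j + J) x) \<le> (\<Sum>j<n. a (j + J))"
          using L2_norm_sum_le[of "{..<n}" M "\<lambda>j. u (j + J)"] u a(2)
          by (meson order_trans sum_mono)
        also have "\<dots> \<le> (\<Sum>j. a (j + J))"
          using a a0 by (intro sum_le_suminf summable_ignore_initial_segment) auto
        finally have "(L2_norm M (\<lambda>x. \<Sum>j<n. u (j + J) x))\<^sup>2 \<le> (\<Sum>j. a (j + J))\<^sup>2"
          by (intro power_mono) auto
        then show ?thesis unfolding d L2_norm_nn_integral[OF sq] by (rule ennreal_leI)
      qed
      then show ?thesis by (intro Liminf_le) auto
    qed
    finally show ?thesis .
  qed
  have t0: "0 \<le> (\<Sum>j. a (j + J))" for J
    using a a0 by (intro suminf_nonneg summable_ignore_initial_segment) auto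
  show ?thesis
  proof (rule that)
    have "sq_integrable M (\<lambda>x. g x - (\<Sum>j<0. u j x))"
      using tail[of 0] t0[of 0] by (intro L2_norm_leI) auto
    then show "sq_integrable M g" by simp
    show "L2_norm M (\<lambda>x. g x - (\<Sum>j<J. u j x)) \<le> (\<Sum>j. a (j + J))" for J
      using tail[of J] t0[of J] by (intro L2_norm_leI) auto
  qed
qed

end

interpretation unit_leb: prob_space unit_leb
  by (rule prob_spaceI) (simp add: emeasure_restrict_space space_restrict_space)

lemma complete_orthonormal_sq_integrable:
  "complete_orthonormal e \<Longrightarrow> 1 \<le> l \<Longrightarrow> sq_integrable unit_leb (e l)"
  by (simp add: complete_orthonormal_def)

lemma sq_integrable_wavelet_sum:
  "complete_orthonormal e \<Longrightarrow> sq_integrable unit_leb (wavelet_sum e n \<mu>)"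
  unfolding wavelet_sum_def[abs_def]
  by (intro sq_integrable_sum sq_integrable_scale complete_orthonormal_sq_integrable) auto

text \<open>Summable block norms make the partial sums along \<open>N\<close> converge to some
  \<open>h\<close> with the coefficients of \<open>f\<close>. Completeness, stated as the absence of
  a nonzero function orthogonal to the basis, then forces \<open>f = h\<close> almost everywhere and
  so becomes convergence of the expansion.\<close>

lemma wavelet_partial_sum_error:
  assumes e: "complete_orthonormal e" and f: "sq_integrable unit_leb f"
    and N: "mono N" "\<And>l. \<exists>m. l \<le> N m"
    and a: "summable a"
      "\<And>m. L2_norm unit_leb (\<lambda>x. wavelet_sum e (N (Suc m)) (wcoef e f) x - wavelet_sum e (N m) (wcoef e f) x) \<le> a m"
  shows "L2_norm unit_leb (\<lambda>x. f x - wavelet_sum e (N m) (wcoef e f) x) \<le> (\<Sum>i. a (i + m))"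
proof -
  define s where "s n = wavelet_sum e n (wcoef e f)" for n
  have s: "sq_integrable unit_leb (s n)" for n unfolding s_def by (rule sq_integrable_wavelet_sum[OF e])
  obtain g where g: "sq_integrable unit_leb g"
    "\<And>J. L2_norm unit_leb (\<lambda>x. g x - (\<Sum>j<J. s (N (Suc j)) x - s (N j) x)) \<le> (\<Sum>j. a (j + J))"
    by (rule unit_leb.L2_series_limit[of "\<lambda>j x. s (N (Suc j)) x - s (N j) x" a])
       (use a s in \<open>auto simp: s_def intro: sq_integrable_diff\<close>)
  \<comment> \<open>The block series begins after index \<open>N 0\<close>, so the first partial sum
    is added back.\<close>
  define h where "h x = g x + s (N 0) x" for x
  have h: "sq_integrable unit_leb h" unfolding h_def by (intro sq_integrable_add g s)
  have hs: "L2_norm unit_leb (\<lambda>x. h x - s (N J) x) \<le> (\<Sum>j. a (j + J))" for J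
  proof -
    have "g x - (\<Sum>j<J. s (N (Suc j)) x - s (N j) x) = h x - s (N J) x" for x
      using sum_lessThan_telescope[of "\<lambda>j. s (N j) x" J] by (simp add: h_def)
    then show ?thesis using g(2)[of J] by simp
  qed
  \<comment> \<open>From \<open>m0\<close> on, the partial sums all have the required inner product
    with \<open>e l\<close>, and Cauchy-Schwarz carries it to the limit.\<close>
  have coef: "L2_inner unit_leb h (e l) = wcoef e f l" if l: "1 \<le> l" for l
  proof -
    note el = complete_orthonormal_sq_integrable[OF e l]
    have lim: "(\<lambda>J. (\<Sum>j. a (j + J)) * L2_norm unit_leb (e l)) \<longlonglongrightarrow> 0"
      by (rule tendsto_mult_left_zero[OF suminf_exist_split2[OF a(1)]])
    obtain m0 where m0: "l \<le> N m0" using N(2) by blast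
    have ev: "eventually (\<lambda>J. norm (L2_inner unit_leb h (e l) - wcoef e f l)
        \<le> (\<Sum>j. a (j + J)) * L2_norm unit_leb (e l)) sequentially"
      using eventually_ge_at_top[of m0]
    proof eventually_elim
      case (elim J)
      then have "l \<le> N J" using N(1) m0 by (meson monoD order_trans)
      then have "L2_inner unit_leb (s (N J)) (e l) = wcoef e f l"
        using wavelet_sum_coefficient[OF e l, of "N J" "wcoef e f"] unfolding s_def by presburger
      then have "L2_inner unit_leb h (e l) - wcoef e f l = L2_inner unit_leb (\<lambda>x. h x - s (N J) x) (e l)"
        using L2_inner_diff_left[OF h s[of "N J"] el] by linarith
      also have "norm \<dots> \<le> L2_norm unit_leb (\<lambda>x. h x - s (N J) x) * L2_norm unit_leb (e l)"
        unfolding real_norm_def by (intro L2_inner_le_norm sq_integrable_diff h s el)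
      also have "\<dots> \<le> (\<Sum>j. a (j + J)) * L2_norm unit_leb (e l)"
        by (intro mult_right_mono hs) simp
      finally show ?case .
    qed
    have "((\<lambda>J. L2_inner unit_leb h (e l) - wcoef e f l) \<longlongrightarrow> 0) sequentially"
      by (rule Lim_null_comparison[OF ev lim])
    then show ?thesis by (simp add: LIMSEQ_const_iff)
  qed
  have "AE x in unit_leb. f x - h x = 0"
  proof -
    have "L2_inner unit_leb (\<lambda>x. f x - h x) (e l) = 0" if "1 \<le> l" for l
      using coef[OF that] L2_inner_diff_left[OF f h complete_orthonormal_sq_integrable[OF e that]]
      by (simp add: wcoef_def)
    then show ?thesis
      using e sq_integrable_diff[OF f h] unfolding complete_orthonormal_def by blast
  qed
  then have "L2_norm unit_leb (\<lambda>x. f x - s (N m) x) = L2_norm unit_leb (\<lambda>x. h x - s (N m) x)"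
    using sq_integrable_diff[OF f s[of "N m"]] sq_integrable_diff[OF h s[of "N m"]]
    by (intro L2_norm_cong_AE) (auto simp: sq_integrable_def)
  then show ?thesis using hs[of m] by (simp add: s_def)
qed

text \<open>The inner product of the partial sum with \<open>f\<close> is the squared norm of the
  partial sum; Cauchy-Schwarz then allows one factor to be cancelled.\<close>

lemma bessel_inequality:
  assumes e: "complete_orthonormal e" and f: "sq_integrable unit_leb f"
  shows "(\<Sum>l=1..n. (wcoef e f l)\<^sup>2) \<le> (L2_norm unit_leb f)\<^sup>2"
proof -
  let ?s = "wavelet_sum e n (wcoef e f)"
  have s: "sq_integrable unit_leb ?s" by (rule sq_integrable_wavelet_sum[OF e])
  have ns: "(L2_norm unit_leb ?s)\<^sup>2 = (\<Sum>l=1..n. (wcoef e f l)\<^sup>2)"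
    unfolding wavelet_sum_def[abs_def]
    using e by (intro L2_norm_orthonormal_sum) (auto simp: complete_orthonormal_def)
  have "L2_inner unit_leb ?s f = (\<Sum>l=1..n. wcoef e f l * L2_inner unit_leb (e l) f)"
    unfolding wavelet_sum_def[abs_def]
    using e f by (intro L2_inner_sum_left) (auto simp: complete_orthonormal_def)
  also have "\<dots> = (\<Sum>l=1..n. (wcoef e f l)\<^sup>2)"
    by (simp add: wcoef_def L2_inner_commute power2_eq_square)
  finally have "(L2_norm unit_leb ?s)\<^sup>2 = L2_inner unit_leb ?s f" using ns by simp
  also have "\<dots> \<le> L2_norm unit_leb ?s * L2_norm unit_leb f"
    using L2_inner_le_norm[OF s f] by linarith
  finally have le: "(L2_norm unit_leb ?s)\<^sup>2 \<le> L2_norm unit_leb ?s * L2_norm unit_leb f" .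
  have "L2_norm unit_leb ?s \<le> L2_norm unit_leb f"
  proof (cases "0 < L2_norm unit_leb ?s")
    case True
    then show ?thesis using le by (simp add: power2_eq_square)
  next
    case False
    then show ?thesis using L2_norm_nonneg[of unit_leb f] by linarith
  qed
  then show ?thesis unfolding ns[symmetric] by (intro power_mono) auto
qed

text \<open>Partial summation is an orthogonal projection, hence a contraction.\<close>

lemma L2_norm_wavelet_sum_diff:
  assumes e: "complete_orthonormal e" and f: "sq_integrable unit_leb f" and g: "sq_integrable unit_leb g"
  shows "L2_norm unit_leb (\<lambda>x. wavelet_sum e n (wcoef e f) x - wavelet_sum e n (wcoef e g) x)
    \<le> L2_norm unit_leb (\<lambda>x. f x - g x)"
proof -
  have "wcoef e f l - wcoef e g l = wcoef e (\<lambda>x. f x - g x) l" if "1 \<le> l" for l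
    unfolding wcoef_def using L2_inner_diff_left[OF f g complete_orthonormal_sq_integrable[OF e that]] by simp
  then have "(\<lambda>x. wavelet_sum e n (wcoef e f) x - wavelet_sum e n (wcoef e g) x) =
     (\<lambda>x. \<Sum>l=1..n. wcoef e (\<lambda>x. f x - g x) l * e l x)"
    by (intro ext) (simp add: wavelet_sum_def sum_subtractf[symmetric] left_diff_distrib[symmetric])
  then have "(L2_norm unit_leb (\<lambda>x. wavelet_sum e n (wcoef e f) x - wavelet_sum e n (wcoef e g) x))\<^sup>2
    = (\<Sum>l=1..n. (wcoef e (\<lambda>x. f x - g x) l)\<^sup>2)"
    using e by (simp only:) (intro L2_norm_orthonormal_sum, auto simp: complete_orthonormal_def)
  also have "\<dots> \<le> (L2_norm unit_leb (\<lambda>x. f x - g x))\<^sup>2"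
    by (rule bessel_inequality[OF e sq_integrable_diff[OF f g]])
  finally show ?thesis by (rule power2_le_imp_le) simp
qed

section \<open>Averages over cells of length 1/n\<close>

text \<open>Closed at both ends like the intervals in \<open>cell_average\<close>; neighbours share
  one grid point, a null set.\<close>

definition cell :: "nat \<Rightarrow> nat \<Rightarrow> real set" where
  "cell n i = {real i / real n..(real i + 1) / real n}"

lemma cell_subset: "i < n \<Longrightarrow> cell n i \<subseteq> {0..1}"
  by (auto simp: cell_def field_simps)

lemma cell_measurable [measurable]: "i < n \<Longrightarrow> cell n i \<in> sets unit_leb"
  using cell_subset[of i n] by (subst sets_restrict_space_iff) (auto simp: cell_def)

lemma measure_unit_leb_Icc:
  assumes "0 \<le> a" "a \<le> b" "b \<le> 1"
  shows "measure unit_leb {a..b} = b - a"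
  using assms by (subst measure_restrict_space) auto

lemma measure_cell: "i < n \<Longrightarrow> measure unit_leb (cell n i) = 1 / real n"
  unfolding cell_def by (subst measure_unit_leb_Icc) (auto simp: field_simps)

text \<open>At \<open>x = 1\<close> the floor would select a cell outside the unit interval, hence
  the strict bound. The same \<open>i\<close> serves all \<open>f\<close>, so averages of different
  functions can be compared at one point.\<close>

lemma cell_average_on_cell:
  assumes "0 \<le> x" "x < 1" "0 < n"
  obtains i where "i < n" "x \<in> cell n i"
    "\<And>f. cell_average n f x = real n * (LINT t:cell n i|unit_leb. f t)"
proof -
  define i where "i = nat \<lfloor>real n * x\<rfloor>"
  have i: "real_of_int \<lfloor>real n * x\<rfloor> = real i" using assms by (simp add: i_def)
  have le: "real i \<le> real n * x" "real n * x < real i + 1" using i by linarith+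
  have "real n * x < real n * 1" using assms by (intro mult_strict_left_mono) auto
  then have "i < n" using le by linarith
  moreover have "x \<in> cell n i" using le assms by (simp add: cell_def field_simps)
  moreover have "cell_average n f x = real n * (LINT t:cell n i|unit_leb. f t)" for f
  proof -
    have "real_of_int (\<lfloor>real n * x\<rfloor> + 1) = real i + 1" using i by simp
    then show ?thesis unfolding cell_average_def cell_def i by simp
  qed
  ultimately show ?thesis using that by blast
qed

lemma AE_unit_leb_not_in_finite:
  assumes "finite F"
  shows "AE x in unit_leb. x \<notin> F"
proof -
  have "F \<in> null_sets lebesgue"
    using assms finite_imp_null_set_lborel null_sets_completionI by blast
  then have "AE x in lebesgue. x \<notin> F" by (rule AE_not_in)
  then show ?thesis by (subst AE_restrict_space_iff) auto
qed

lemma AE_unit_leb_lt_1: "AE x in unit_leb. 0 \<le> x \<and> x < 1"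
proof -
  have "AE x in unit_leb. x \<notin> {1}" by (rule AE_unit_leb_not_in_finite) simp
  moreover have "AE x in unit_leb. x \<in> space unit_leb" by (rule AE_space)
  ultimately show ?thesis by eventually_elim auto
qed

lemma indicator_cells:
  assumes "0 \<le> x" "x \<le> 1" "0 < n" "x \<notin> (\<lambda>i. real i / real n) ` {..n}"
  shows "(\<Sum>i<n. indicator (cell n i) x) = (1::real)"
proof -
  have "x \<noteq> 1"
  proof
    assume "x = 1"
    then have "x = real n / real n" using assms(3) by simp
    then show False using assms(4) by blast
  qed
  then have "x < 1" using assms(2) by simp
  with cell_average_on_cell[OF assms(1) _ assms(3)] obtain i where i: "i < n" "x \<in> cell n i" by metis
  have "x \<notin> cell n k" if k: "k < n" "k \<noteq> i" for k
  proof
    assume "x \<in> cell n k"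
    then have b: "real k \<le> real n * x" "real n * x \<le> real k + 1" "real i \<le> real n * x" "real n * x \<le> real i + 1"
      using i assms(3) by (auto simp: cell_def field_simps)
    have "k = Suc i \<or> i = Suc k" using b k(2) by linarith
    then have "real n * x = real (max i k)" using b by auto
    then have "x = real (max i k) / real n" using assms(3) by (simp add: field_simps)
    then show False using assms(4) i k by auto
  qed
  then have "(\<Sum>k<n. indicator (cell n k) x) = (\<Sum>k<n. if k = i then 1 else (0::real))"
    using i by (intro sum.cong) (auto simp: indicator_def)
  then show ?thesis using i by simp
qed

lemma set_integrable_cell:
  fixes h :: "real \<Rightarrow> real"
  assumes "integrable unit_leb h" "i < n"
  shows "set_integrable unit_leb (cell n i) h"
  using assms unfolding set_integrable_def by (intro integrable_mult_indicator) auto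

lemma sum_cell_integrals:
  fixes h :: "real \<Rightarrow> real"
  assumes "integrable unit_leb h" "0 < n"
  shows "(\<Sum>i<n. (LINT t:cell n i|unit_leb. h t)) = (LINT t|unit_leb. h t)"
proof -
  have "(\<Sum>i<n. (LINT t:cell n i|unit_leb. h t)) = (LINT t|unit_leb. (\<Sum>i<n. indicator (cell n i) t *\<^sub>R h t))"
    unfolding set_lebesgue_integral_def
    using set_integrable_cell[OF assms(1)] unfolding set_integrable_def
    by (intro Bochner_Integration.integral_sum[symmetric]) auto
  also have "\<dots> = (LINT t|unit_leb. h t)"
  proof (rule integral_cong_AE)
    show "(\<lambda>t. \<Sum>i<n. indicator (cell n i) t *\<^sub>R h t) \<in> borel_measurable unit_leb"
      using set_integrable_cell[OF assms(1)] unfolding set_integrable_def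
      by (intro borel_measurable_sum) auto
    show "h \<in> borel_measurable unit_leb" using assms by auto
    have "AE t in unit_leb. t \<notin> (\<lambda>i. real i / real n) ` {..n}"
      by (rule AE_unit_leb_not_in_finite) simp
    then show "AE t in unit_leb. (\<Sum>i<n. indicator (cell n i) t *\<^sub>R h t) = h t"
      using AE_unit_leb_lt_1
    proof eventually_elim
      case (elim t)
      then show ?case
        using indicator_cells[of t n] assms(2) by (simp add: sum_distrib_right[symmetric])
    qed
  qed
  finally show ?thesis .
qed

lemma cell_average_measurable: "cell_average n f \<in> borel_measurable unit_leb"
proof -
  have "(\<lambda>x. \<lfloor>real n * x\<rfloor>) \<in> measurable borel (count_space UNIV)" by measurable
  then have "(\<lambda>x. real n * (LINT t:{\<lfloor>real n * x\<rfloor> / real n..(\<lfloor>real n * x\<rfloor> + 1) / real n}|unit_leb. f t)) \<in> borel_measurable borel"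
    by (rule measurable_compose[where f = "\<lambda>x. \<lfloor>real n * x\<rfloor>" and
          g = "\<lambda>i::int. real n * (LINT t:{of_int i / real n..of_int (i + 1) / real n}|unit_leb. f t)"]) simp
  then have "cell_average n f \<in> borel_measurable borel" unfolding cell_average_def[abs_def] .
  then show ?thesis by (intro measurable_restrict_space1 measurable_completion) simp
qed

text \<open>Almost everywhere the average is a step function whose value on a cell is
  \<open>n\<close> times the integral there, and the cell has measure \<open>1 / n\<close>.\<close>

lemma integral_cell_average:
  fixes h :: "real \<Rightarrow> real"
  assumes h: "integrable unit_leb h" and n: "0 < n"
  shows "integrable unit_leb (cell_average n h)"
    and "(LINT x|unit_leb. cell_average n h x) = (LINT x|unit_leb. h x)"
proof -
  let ?a = "\<lambda>i. LINT t:cell n i|unit_leb. h t"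
  let ?g = "\<lambda>x. \<Sum>i<n. real n * ?a i * indicator (cell n i) x"
  have cellint: "integrable unit_leb (\<lambda>x. real n * ?a i * indicator (cell n i) x)" if "i < n" for i
    using that by (intro integrable_mult_right) (simp add: unit_leb.emeasure_finite less_top[symmetric])
  have int: "integrable unit_leb ?g"
    by (intro Bochner_Integration.integrable_sum cellint) simp
  have "AE x in unit_leb. x \<notin> (\<lambda>i. real i / real n) ` {..n}"
    by (rule AE_unit_leb_not_in_finite) simp
  then have ae: "AE x in unit_leb. cell_average n h x = ?g x"
    using AE_unit_leb_lt_1
  proof eventually_elim
    case (elim x)
    then obtain i where i: "i < n" "x \<in> cell n i" "cell_average n h x = real n * ?a i"
      using cell_average_on_cell[of x n] n by metis
    \<comment> \<open>Off the grid exactly one cell contains \<open>x\<close>, so the step function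
      has a single active term.\<close>
    have "(\<Sum>k<n. indicator (cell n k) x) = (1::real)" using elim n by (intro indicator_cells) auto
    then have "indicator (cell n k) x = (if k = i then 1 else (0::real))" if "k < n" for k
    proof -
      have "(\<Sum>k\<in>{..<n} - {i}. indicator (cell n k) x) = (0::real)"
        using \<open>(\<Sum>k<n. indicator (cell n k) x) = (1::real)\<close> i by (simp add: sum_diff1)
      then show ?thesis using that i by (subst (asm) sum_nonneg_eq_0_iff) (auto simp: indicator_def)
    qed
    then have "?g x = (\<Sum>k<n. real n * ?a k * (if k = i then 1 else 0))" by (intro sum.cong) auto
    also have "\<dots> = cell_average n h x" using i by (simp add: if_distrib cong: if_cong)
    finally show ?case by simp
  qed
  show "integrable unit_leb (cell_average n h)"
    using int ae by (subst integrable_cong_AE[OF cell_average_measurable _ ae]) auto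
  have "(LINT x|unit_leb. cell_average n h x) = (LINT x|unit_leb. ?g x)"
    using int by (intro integral_cong_AE cell_average_measurable ae) auto
  also have "\<dots> = (\<Sum>i<n. ?a i)"
    using n cell_subset by (subst Bochner_Integration.integral_sum[OF cellint])
      (auto simp: measure_cell Int_absorb2 intro!: sum.cong)
  also have "\<dots> = (LINT x|unit_leb. h x)" by (rule sum_cell_integrals[OF h n])
  finally show "(LINT x|unit_leb. cell_average n h x) = (LINT x|unit_leb. h x)" .
qed

lemma set_integral_square_le:
  assumes h: "sq_integrable unit_leb h" and A: "A \<in> sets unit_leb"
  shows "(LINT t:A|unit_leb. \<bar>h t\<bar>)\<^sup>2 \<le> measure unit_leb A * (LINT t:A|unit_leb. (h t)\<^sup>2)"
proof -
  let ?one = "\<lambda>t. indicator A t :: real" and ?h = "\<lambda>t. indicator A t * \<bar>h t\<bar>"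
  have m: "?one \<in> borel_measurable unit_leb" using A by simp
  have one: "sq_integrable unit_leb ?one"
    unfolding sq_integrable_def using A m
    by (auto simp: power2_eq_square indicator_inter_arith[symmetric] unit_leb.emeasure_finite less_top[symmetric])
  have ind2: "(indicator A t)\<^sup>2 = (indicator A t :: real)" for t by (simp add: indicator_def)
  have sq: "sq_integrable unit_leb ?h"
  proof -
    have "integrable unit_leb (\<lambda>t. indicator A t *\<^sub>R (h t)\<^sup>2)"
      using h A by (intro integrable_mult_indicator) (auto simp: sq_integrable_def)
    moreover have "?h \<in> borel_measurable unit_leb"
      using h m by (intro borel_measurable_times borel_measurable_abs) (auto simp: sq_integrable_def)
    ultimately show ?thesis by (simp add: sq_integrable_def power_mult_distrib ind2)
  qed
  have "(LINT t:A|unit_leb. \<bar>h t\<bar>) = L2_inner unit_leb ?one ?h"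
    unfolding set_lebesgue_integral_def L2_inner_def by (intro Bochner_Integration.integral_cong) (auto simp: indicator_def)
  then have "\<bar>LINT t:A|unit_leb. \<bar>h t\<bar>\<bar> \<le> L2_norm unit_leb ?one * L2_norm unit_leb ?h"
    using L2_inner_le_norm[OF one sq] by simp
  then have "(LINT t:A|unit_leb. \<bar>h t\<bar>)\<^sup>2 \<le> (L2_norm unit_leb ?one * L2_norm unit_leb ?h)\<^sup>2"
    by (metis abs_ge_zero power2_abs power_mono)
  also have "\<dots> = measure unit_leb A * (LINT t:A|unit_leb. (h t)\<^sup>2)"
    using A unfolding power_mult_distrib L2_norm_square set_lebesgue_integral_def
    using sets.sets_into_space[OF A] by (simp add: ind2 power_mult_distrib Int_absorb2)
  finally show ?thesis .
qed

lemma abs_set_integral_le: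
  fixes h :: "real \<Rightarrow> real"
  shows "\<bar>LINT t:A|unit_leb. h t\<bar> \<le> (LINT t:A|unit_leb. \<bar>h t\<bar>)"
  using integral_norm_bound[of unit_leb "\<lambda>t. indicator A t *\<^sub>R h t"]
  unfolding set_lebesgue_integral_def by (simp add: abs_mult)

text \<open>Jensen's inequality on each cell bounds the square of the average by the average of the
  square, and averaging preserves the total integral.\<close>

lemma cell_average_contraction:
  assumes f: "sq_integrable unit_leb f" and n: "0 < n"
  shows "sq_integrable unit_leb (cell_average n f)"
    and "L2_norm unit_leb (cell_average n f) \<le> L2_norm unit_leb f"
proof -
  have int2: "integrable unit_leb (\<lambda>x. (f x)\<^sup>2)" using f by (simp add: sq_integrable_def)
  note ca = integral_cell_average[OF int2 n]
  have ae: "AE x in unit_leb. (cell_average n f x)\<^sup>2 \<le> cell_average n (\<lambda>x. (f x)\<^sup>2) x"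
    using AE_unit_leb_lt_1
  proof eventually_elim
    case (elim x)
    then obtain i where i: "i < n"
      "\<And>f. cell_average n f x = real n * (LINT t:cell n i|unit_leb. f t)"
      using cell_average_on_cell[of x n] n by metis
    have "(LINT t:cell n i|unit_leb. f t)\<^sup>2 \<le> (LINT t:cell n i|unit_leb. \<bar>f t\<bar>)\<^sup>2"
      using abs_set_integral_le[where A = "cell n i" and h = f] by (metis abs_ge_zero power2_abs power_mono)
    also have "\<dots> \<le> 1 / real n * (LINT t:cell n i|unit_leb. (f t)\<^sup>2)"
      using set_integral_square_le[OF f cell_measurable[OF i(1)]] measure_cell[OF i(1)] by simp
    finally have le: "(LINT t:cell n i|unit_leb. f t)\<^sup>2 \<le> 1 / real n * (LINT t:cell n i|unit_leb. (f t)\<^sup>2)" .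
    have "(real n * (LINT t:cell n i|unit_leb. f t))\<^sup>2 = (real n)\<^sup>2 * (LINT t:cell n i|unit_leb. f t)\<^sup>2"
      by (rule power_mult_distrib)
    also have "\<dots> \<le> (real n)\<^sup>2 * (1 / real n * (LINT t:cell n i|unit_leb. (f t)\<^sup>2))"
      by (intro mult_left_mono le) simp
    also have "\<dots> = real n * (LINT t:cell n i|unit_leb. (f t)\<^sup>2)"
      using n by (simp add: power2_eq_square[of "real n"])
    finally show ?case unfolding i(2) .
  qed
  have m2: "(\<lambda>x. (cell_average n f x)\<^sup>2) \<in> borel_measurable unit_leb"
    by (intro borel_measurable_power cell_average_measurable)
  have int: "integrable unit_leb (\<lambda>x. (cell_average n f x)\<^sup>2)"
    by (rule Bochner_Integration.integrable_bound[OF ca(1) m2]) (use ae in \<open>eventually_elim, auto\<close>)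
  then show "sq_integrable unit_leb (cell_average n f)"
    using cell_average_measurable by (simp add: sq_integrable_def)
  have "(LINT x|unit_leb. (cell_average n f x)\<^sup>2) \<le> (LINT x|unit_leb. (f x)\<^sup>2)"
    using integral_mono_AE[OF int ca(1) ae] ca(2) by simp
  then show "L2_norm unit_leb (cell_average n f) \<le> L2_norm unit_leb f"
    by (simp add: L2_norm_def)
qed

lemma cell_average_diff:
  assumes "integrable unit_leb f" "integrable unit_leb g" "0 \<le> x" "x < 1" "0 < n"
  shows "cell_average n (\<lambda>x. f x - g x) x = cell_average n f x - cell_average n g x"
proof -
  obtain i where "i < n" "\<And>f. cell_average n f x = real n * (LINT t:cell n i|unit_leb. f t)"
    using cell_average_on_cell[OF assms(3-5)] by metis
  then show ?thesis
    using set_integral_diff(2)[OF set_integrable_cell[OF assms(1)] set_integrable_cell[OF assms(2)], of i n]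
    by (simp add: right_diff_distrib)
qed

text \<open>Absolutely continuous functions on the unit interval whose derivative has norm at most
  \<open>D\<close>. Carrying a bound keeps the derivative existential, so sums and multiples avoid a
  canonical choice of it.\<close>

definition sobolev_bound :: "(real \<Rightarrow> real) \<Rightarrow> real \<Rightarrow> bool" where
  "sobolev_bound G D \<longleftrightarrow> (\<exists>G'. sq_integrable unit_leb G' \<and> L2_norm unit_leb G' \<le> D \<and>
     (\<forall>x y. 0 \<le> x \<and> x \<le> y \<and> y \<le> 1 \<longrightarrow> G y - G x = (LINT t:{x..y}|unit_leb. G' t)))"

text \<open>On a cell, \<open>G\<close> differs from its average by at most the integral of the
  absolute derivative over that cell. Cauchy-Schwarz yields one factor \<open>1 / n\<close>;
  rewriting the cell integral of the squared derivative as a cell average yields the other.\<close>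

lemma poincare_cell_average:
  assumes "sobolev_bound G D" and Gsq: "sq_integrable unit_leb G" and n: "0 < n"
  shows "L2_norm unit_leb (\<lambda>x. G x - cell_average n G x) \<le> D / real n"
proof -
  obtain G' where G': "sq_integrable unit_leb G'" "L2_norm unit_leb G' \<le> D"
    "\<And>x y. 0 \<le> x \<Longrightarrow> x \<le> y \<Longrightarrow> y \<le> 1 \<Longrightarrow> G y - G x = (LINT t:{x..y}|unit_leb. G' t)"
    using assms(1) by (auto simp: sobolev_bound_def)
  have absint: "integrable unit_leb (\<lambda>t. \<bar>G' t\<bar>)"
    using G'(1) by (intro integrable_abs unit_leb.sq_integrable_imp_integrable)
  have int2: "integrable unit_leb (\<lambda>x. (G' x)\<^sup>2)" using G' by (simp add: sq_integrable_def)
  have Gint: "integrable unit_leb G" by (rule unit_leb.sq_integrable_imp_integrable[OF Gsq])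
  note ca = integral_cell_average[OF int2 n]
  have osc_le: "\<bar>G y - G x\<bar> \<le> (LINT t:cell n i|unit_leb. \<bar>G' t\<bar>)"
    if "i < n" "x \<in> cell n i" "y \<in> cell n i" "x \<le> y" for i x y
  proof -
    have sub: "{x..y} \<subseteq> cell n i" using that by (auto simp: cell_def)
    have xy: "0 \<le> x" "y \<le> 1" using cell_subset[OF that(1)] that by auto
    have "{x..y} \<in> sets unit_leb" using xy by (subst sets_restrict_space_iff) auto
    then have "(LINT t:{x..y}|unit_leb. \<bar>G' t\<bar>) \<le> (LINT t:cell n i|unit_leb. \<bar>G' t\<bar>)"
      unfolding set_lebesgue_integral_def
      using absint that(1) sub
      by (intro integral_mono integrable_mult_indicator) (auto simp: indicator_def)
    then show ?thesis
      using abs_set_integral_le[where A = "{x..y}" and h = G'] G'(3)[OF xy(1) that(4) xy(2)] by simp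
  qed
  then have osc: "\<bar>G y - G x\<bar> \<le> (LINT t:cell n i|unit_leb. \<bar>G' t\<bar>)"
    if "i < n" "x \<in> cell n i" "y \<in> cell n i" for i x y
  proof (cases "x \<le> y")
    case False
    then show ?thesis using osc_le[OF that(1,3,2)] by (subst abs_minus_commute) simp
  qed (rule osc_le[OF that])
  have ae: "AE x in unit_leb. (G x - cell_average n G x)\<^sup>2 \<le> (1 / real n)\<^sup>2 * cell_average n (\<lambda>x. (G' x)\<^sup>2) x"
    using AE_unit_leb_lt_1
  proof eventually_elim
    case (elim x)
    then obtain i where i: "i < n" "x \<in> cell n i"
      "\<And>f. cell_average n f x = real n * (LINT t:cell n i|unit_leb. f t)"
      using cell_average_on_cell[of x n] n by metis
    let ?b = "LINT t:cell n i|unit_leb. \<bar>G' t\<bar>"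
    have const: "(LINT t:cell n i|unit_leb. c) = c / real n" for c :: real
      unfolding set_lebesgue_integral_def using i(1) cell_subset[OF i(1)]
      by (simp add: measure_cell Int_absorb2)
    have cint: "set_integrable unit_leb (cell n i) (\<lambda>_. c)" for c :: real
      using i(1) by (intro set_integrable_cell) auto
    \<comment> \<open>The number \<open>G x\<close> is its own average over the cell, so the
      difference becomes one integral.\<close>
    have "G x - cell_average n G x = real n * (LINT t:cell n i|unit_leb. G x - G t)"
      unfolding i(3) set_integral_diff(2)[OF cint set_integrable_cell[OF Gint i(1)]] const
      using n by (simp add: right_diff_distrib)
    also have "\<bar>\<dots>\<bar> \<le> real n * (LINT t:cell n i|unit_leb. ?b)"
    proof -
      have "\<bar>LINT t:cell n i|unit_leb. G x - G t\<bar> \<le> (LINT t:cell n i|unit_leb. \<bar>G x - G t\<bar>)"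
        by (rule abs_set_integral_le)
      also have "\<dots> \<le> (LINT t:cell n i|unit_leb. ?b)"
        using osc[OF i(1) _ i(2)] i(1) Gint
        by (intro set_integral_mono set_integrable_cell integrable_abs Bochner_Integration.integrable_diff)
           (auto simp: abs_minus_commute)
      finally show ?thesis by (simp add: abs_mult mult_left_mono)
    qed
    also have "\<dots> = ?b" unfolding const using n by simp
    finally have "(G x - cell_average n G x)\<^sup>2 \<le> ?b\<^sup>2" by (metis abs_ge_zero power2_abs power_mono)
    also have "\<dots> \<le> 1 / real n * (LINT t:cell n i|unit_leb. (G' t)\<^sup>2)"
      using set_integral_square_le[OF G'(1) cell_measurable[OF i(1)]] measure_cell[OF i(1)] by simp
    also have "\<dots> = (1 / real n)\<^sup>2 * cell_average n (\<lambda>x. (G' x)\<^sup>2) x"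
      unfolding i(3) using n by (simp add: power2_eq_square)
    finally show ?case .
  qed
  have sq: "sq_integrable unit_leb (\<lambda>x. G x - cell_average n G x)"
    by (intro sq_integrable_diff Gsq cell_average_contraction n)
  have "(LINT x|unit_leb. (G x - cell_average n G x)\<^sup>2) \<le> (LINT x|unit_leb. (1 / real n)\<^sup>2 * cell_average n (\<lambda>x. (G' x)\<^sup>2) x)"
    using sq ca(1) by (intro integral_mono_AE integrable_mult_right ae) (auto simp: sq_integrable_def)
  also have "\<dots> = (L2_norm unit_leb G' / real n)\<^sup>2"
    using ca(2) by (simp add: L2_norm_square power_divide)
  finally have "(L2_norm unit_leb (\<lambda>x. G x - cell_average n G x))\<^sup>2 \<le> (L2_norm unit_leb G' / real n)\<^sup>2"
    by (simp add: L2_norm_square)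
  then have "L2_norm unit_leb (\<lambda>x. G x - cell_average n G x) \<le> L2_norm unit_leb G' / real n"
    by (rule power2_le_imp_le) simp
  also have "\<dots> \<le> D / real n" using G'(2) by (intro divide_right_mono) auto
  finally show ?thesis .
qed

section \<open>Weak derivatives of wavelet sums\<close>

lemma sobolev_bound_mono: "sobolev_bound G D \<Longrightarrow> D \<le> E \<Longrightarrow> sobolev_bound G E"
  unfolding sobolev_bound_def by force

lemma sobolev_bound_cong:
  assumes "sobolev_bound G D" "\<And>x. 0 \<le> x \<Longrightarrow> x \<le> 1 \<Longrightarrow> H x = G x"
  shows "sobolev_bound H D"
  using assms unfolding sobolev_bound_def by (metis order_trans)

lemma sobolev_bound_zero: "sobolev_bound (\<lambda>_. 0) 0"
  unfolding sobolev_bound_def by (intro exI[of _ "\<lambda>_. 0"]) (simp add: set_lebesgue_integral_def)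

lemma sobolev_bound_nonneg: "sobolev_bound G D \<Longrightarrow> 0 \<le> D"
  unfolding sobolev_bound_def using L2_norm_nonneg order_trans by blast

lemma sobolev_bound_scale:
  assumes "sobolev_bound G D"
  shows "sobolev_bound (\<lambda>x. c * G x) (\<bar>c\<bar> * D)"
proof -
  obtain G' where G': "sq_integrable unit_leb G'" "L2_norm unit_leb G' \<le> D"
    "\<forall>x y. 0 \<le> x \<and> x \<le> y \<and> y \<le> 1 \<longrightarrow> G y - G x = (LINT t:{x..y}|unit_leb. G' t)"
    using assms by (auto simp: sobolev_bound_def)
  show ?thesis
    unfolding sobolev_bound_def
    using G' by (intro exI[of _ "\<lambda>x. c * G' x"])
      (auto simp: L2_norm_scale mult_left_mono right_diff_distrib[symmetric] intro: sq_integrable_scale)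
qed

lemma sobolev_bound_add:
  assumes "sobolev_bound G D" "sobolev_bound H E"
  shows "sobolev_bound (\<lambda>x. G x + H x) (D + E)"
proof -
  obtain G' where G': "sq_integrable unit_leb G'" "L2_norm unit_leb G' \<le> D"
    "\<And>x y. 0 \<le> x \<Longrightarrow> x \<le> y \<Longrightarrow> y \<le> 1 \<Longrightarrow> G y - G x = (LINT t:{x..y}|unit_leb. G' t)"
    using assms(1) by (auto simp: sobolev_bound_def)
  obtain H' where H': "sq_integrable unit_leb H'" "L2_norm unit_leb H' \<le> E"
    "\<And>x y. 0 \<le> x \<Longrightarrow> x \<le> y \<Longrightarrow> y \<le> 1 \<Longrightarrow> H y - H x = (LINT t:{x..y}|unit_leb. H' t)"
    using assms(2) by (auto simp: sobolev_bound_def)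
  show ?thesis
    unfolding sobolev_bound_def
  proof (intro exI[of _ "\<lambda>x. G' x + H' x"] conjI allI impI)
    show "sq_integrable unit_leb (\<lambda>x. G' x + H' x)" using G' H' by (intro sq_integrable_add)
    show "L2_norm unit_leb (\<lambda>x. G' x + H' x) \<le> D + E"
      using L2_norm_triangle[OF G'(1) H'(1)] G'(2) H'(2) by linarith
    fix x y :: real assume xy: "0 \<le> x \<and> x \<le> y \<and> y \<le> 1"
    then have "{x..y} \<in> sets unit_leb" by (subst sets_restrict_space_iff) auto
    then have "set_integrable unit_leb {x..y} G'" "set_integrable unit_leb {x..y} H'"
      unfolding set_integrable_def
      using unit_leb.sq_integrable_imp_integrable[OF G'(1)] unit_leb.sq_integrable_imp_integrable[OF H'(1)]
      by (auto intro!: integrable_mult_indicator simp del: real_scaleR_def)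
    from set_integral_add(2)[OF this]
    show "G y + H y - (G x + H x) = (LINT t:{x..y}|unit_leb. G' t + H' t)"
      using G'(3)[of x y] H'(3)[of x y] xy by linarith
  qed
qed

lemma sobolev_bound_sum:
  assumes "finite I" "\<And>i. i \<in> I \<Longrightarrow> sobolev_bound (G i) (D i)"
  shows "sobolev_bound (\<lambda>x. \<Sum>i\<in>I. G i x) (\<Sum>i\<in>I. D i)"
  using assms by (induction I rule: finite_induct) (auto intro: sobolev_bound_zero sobolev_bound_add)

text \<open>The counterpart of \<open>sobolev_bound\<close> on the whole line with a Borel
  derivative, where affine substitution is available.\<close>

definition weak_derivative :: "(real \<Rightarrow> real) \<Rightarrow> (real \<Rightarrow> real) \<Rightarrow> bool" where
  "weak_derivative G G' \<longleftrightarrow> sq_integrable lborel G' \<and> integrable lborel G' \<and>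
     (\<forall>x y. x \<le> y \<longrightarrow> G y - G x = (LINT t|lborel. indicator {x..y} t * G' t))"

lemma weak_derivative_sum:
  assumes "finite I" "\<And>i. i \<in> I \<Longrightarrow> weak_derivative (G i) (G' i)"
  shows "weak_derivative (\<lambda>x. \<Sum>i\<in>I. a i * G i x) (\<lambda>x. \<Sum>i\<in>I. a i * G' i x)"
  unfolding weak_derivative_def
proof (intro conjI allI impI)
  show "sq_integrable lborel (\<lambda>x. \<Sum>i\<in>I. a i * G' i x)" "integrable lborel (\<lambda>x. \<Sum>i\<in>I. a i * G' i x)"
    using assms unfolding weak_derivative_def
    by (auto intro!: sq_integrable_sum sq_integrable_scale Bochner_Integration.integrable_sum)
  fix x y :: real assume xy: "x \<le> y"
  have int: "integrable lborel (\<lambda>t. a i * (indicator {x..y} t * G' i t))" if "i \<in> I" for i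
  proof -
    have "integrable lborel (\<lambda>t. indicator {x..y} t *\<^sub>R G' i t)"
      using assms(2)[OF that] by (intro integrable_mult_indicator) (auto simp: weak_derivative_def)
    then show ?thesis by simp
  qed
  have "(\<Sum>i\<in>I. a i * G i y) - (\<Sum>i\<in>I. a i * G i x) = (\<Sum>i\<in>I. a i * (G i y - G i x))"
    by (simp add: sum_subtractf right_diff_distrib)
  also have "\<dots> = (\<Sum>i\<in>I. LINT t|lborel. a i * (indicator {x..y} t * G' i t))"
    using assms(2) xy by (intro sum.cong) (auto simp: weak_derivative_def)
  also have "\<dots> = (LINT t|lborel. (\<Sum>i\<in>I. a i * (indicator {x..y} t * G' i t)))"
    by (rule Bochner_Integration.integral_sum[symmetric, OF int])
  also have "\<dots> = (LINT t|lborel. indicator {x..y} t * (\<Sum>i\<in>I. a i * G' i t))"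
    by (simp add: sum_distrib_left mult_ac)
  finally show "(\<Sum>i\<in>I. a i * G i y) - (\<Sum>i\<in>I. a i * G i x) =
     (LINT t|lborel. indicator {x..y} t * (\<Sum>i\<in>I. a i * G' i t))" .
qed

text \<open>The chain rule contributes \<open>m\<^sup>2\<close> to the integral of the square, the
  substitution \<open>1 / m\<close>.\<close>

lemma weak_derivative_affine:
  assumes "weak_derivative G G'" "0 < m"
  shows "weak_derivative (\<lambda>x. G (m * x - s)) (\<lambda>x. m * G' (m * x - s))"
    and "(LINT x|lborel. (m * G' (m * x - s))\<^sup>2) = m * (LINT x|lborel. (G' x)\<^sup>2)"
proof -
  have G': "G' \<in> borel_measurable borel" "integrable lborel G'" "integrable lborel (\<lambda>x. (G' x)\<^sup>2)"
    "\<And>x y. x \<le> y \<Longrightarrow> G y - G x = (LINT t|lborel. indicator {x..y} t * G' t)"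
    using assms(1) by (auto simp: weak_derivative_def sq_integrable_def)
  note [measurable] = G'(1)
  have m: "m \<noteq> 0" using assms(2) by simp
  show "(LINT x|lborel. (m * G' (m * x - s))\<^sup>2) = m * (LINT x|lborel. (G' x)\<^sup>2)"
    unfolding lborel_integral_real_affine[OF m, where t = "- s" and f = "\<lambda>x. (G' x)\<^sup>2"]
    unfolding power_mult_distrib integral_mult_right_zero
    using assms(2) by (simp add: power2_eq_square[of m])
  have i1: "integrable lborel (\<lambda>x. G' (m * x - s))"
    using lborel_integrable_real_affine[OF G'(2) m, of "- s"] by simp
  have i2: "integrable lborel (\<lambda>x. (G' (m * x - s))\<^sup>2)"
    using lborel_integrable_real_affine[OF G'(3) m, of "- s"] by simp
  show "weak_derivative (\<lambda>x. G (m * x - s)) (\<lambda>x. m * G' (m * x - s))"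
    unfolding weak_derivative_def
  proof (intro conjI allI impI)
    show "sq_integrable lborel (\<lambda>x. m * G' (m * x - s))"
      using i2 by (intro sq_integrable_scale) (auto simp: sq_integrable_def)
    show "integrable lborel (\<lambda>x. m * G' (m * x - s))" using i1 by simp
    fix x y :: real assume "x \<le> y"
    then have "G (m * y - s) - G (m * x - s) = (LINT t|lborel. indicator {m * x - s..m * y - s} t * G' t)"
      using assms(2) by (intro G'(4)) simp
    also have "\<dots> = m * (LINT t|lborel. indicator {m * x - s..m * y - s} (- s + m * t) * G' (- s + m * t))"
      using lborel_integral_real_affine[OF m, where t = "- s" and f = "\<lambda>t. indicator {m * x - s..m * y - s} t * G' t"] assms(2)
      by simp
    also have "(\<lambda>t. indicator {m * x - s..m * y - s} (- s + m * t) * G' (- s + m * t)) =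
        (\<lambda>t. indicator {x..y} t * G' (m * t - s))"
      using assms(2) by (intro ext) (simp add: indicator_def)
    finally show "G (m * y - s) - G (m * x - s) = (LINT t|lborel. indicator {x..y} t * (m * G' (m * t - s)))"
      by (simp add: mult.left_commute)
  qed
qed

text \<open>The bridge between the completed measure on the unit interval and the Borel measure on
  the line.\<close>

lemma integral_unit_leb_lborel:
  fixes h :: "real \<Rightarrow> real"
  assumes "h \<in> borel_measurable borel"
  shows "integral\<^sup>L unit_leb h = (LINT x|lborel. indicator {0..1} x * h x)"
    and "integrable unit_leb h \<longleftrightarrow> integrable lborel (\<lambda>x. indicator {0..1} x * h x)"
proof -
  have m: "(\<lambda>x. indicator {0..1} x *\<^sub>R h x) \<in> borel_measurable lborel"
    using assms by (intro borel_measurable_scaleR) auto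
  have "integral\<^sup>L unit_leb h = integral\<^sup>L lebesgue (\<lambda>x. indicator {0..1} x *\<^sub>R h x)"
    by (rule integral_restrict_space) simp
  then show "integral\<^sup>L unit_leb h = (LINT x|lborel. indicator {0..1} x * h x)"
    unfolding integral_completion[OF m] by simp
  have "integrable unit_leb h \<longleftrightarrow> integrable lebesgue (\<lambda>x. indicator {0..1} x *\<^sub>R h x)"
    by (rule integrable_restrict_space) simp
  then show "integrable unit_leb h \<longleftrightarrow> integrable lborel (\<lambda>x. indicator {0..1} x * h x)"
    unfolding integrable_completion[OF m] by simp
qed

lemma weak_derivative_imp_sobolev_bound:
  assumes "weak_derivative G G'" "0 \<le> D" "(LINT x|lborel. (G' x)\<^sup>2) \<le> D\<^sup>2"
  shows "sobolev_bound G D"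
proof -
  have G': "G' \<in> borel_measurable borel" "integrable lborel G'" "integrable lborel (\<lambda>x. (G' x)\<^sup>2)"
    "\<And>x y. x \<le> y \<Longrightarrow> G y - G x = (LINT t|lborel. indicator {x..y} t * G' t)"
    using assms(1) by (auto simp: weak_derivative_def sq_integrable_def)
  note [measurable] = G'(1)
  have i: "integrable lborel (\<lambda>x. indicator {0..1} x * (G' x)\<^sup>2)"
    using integrable_mult_indicator[OF _ G'(3), of "{0..1}"] by simp
  show ?thesis
    unfolding sobolev_bound_def
  proof (intro exI[of _ G'] conjI allI impI)
    have "G' \<in> borel_measurable unit_leb"
      by (intro measurable_restrict_space1 measurable_completion) simp
    moreover have "integrable unit_leb (\<lambda>x. (G' x)\<^sup>2)"
      using i by (subst integral_unit_leb_lborel(2)) auto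
    ultimately show "sq_integrable unit_leb G'" by (simp add: sq_integrable_def)
    have "(L2_norm unit_leb G')\<^sup>2 = (LINT x|lborel. indicator {0..1} x * (G' x)\<^sup>2)"
      unfolding L2_norm_square by (rule integral_unit_leb_lborel) measurable
    also have "\<dots> \<le> (LINT x|lborel. (G' x)\<^sup>2)"
      by (intro integral_mono i G'(3)) (auto simp: indicator_def)
    also have "\<dots> \<le> D\<^sup>2" by fact
    finally show "L2_norm unit_leb G' \<le> D" using assms(2) by (rule power2_le_imp_le)
    fix x y :: real assume xy: "0 \<le> x \<and> x \<le> y \<and> y \<le> 1"
    have "(LINT t:{x..y}|unit_leb. G' t) = (LINT t|lborel. indicator {0..1} t * (indicator {x..y} t * G' t))"
      unfolding set_lebesgue_integral_def using integral_unit_leb_lborel(1)[of "\<lambda>t. indicator {x..y} t * G' t"] by simp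
    also have "\<dots> = (LINT t|lborel. indicator {x..y} t * G' t)"
      using xy by (intro Bochner_Integration.integral_cong) (auto simp: indicator_def)
    finally show "G y - G x = (LINT t:{x..y}|unit_leb. G' t)" using G'(4) xy by simp
  qed
qed

section \<open>Derivative bounds for dilated and boundary-adapted wavelets\<close>

text \<open>\<open>regular_wavelet\<close> offers a Lebesgue measurable derivative integrated in the
  gauge sense. A Borel representative replaces it and is cut off outside a support interval of
  \<open>w\<close>, which makes it integrable on the line.\<close>

lemma regular_wavelet_derivative:
  assumes "regular_wavelet w"
  obtains R w' where "0 < R" "weak_derivative w w'" "\<And>x. R < \<bar>x\<bar> \<Longrightarrow> w' x = 0"
proof -
  obtain R0 v where R0: "\<And>x. R0 < \<bar>x\<bar> \<Longrightarrow> w x = 0" and v: "sq_integrable lebesgue v"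
    and wv: "\<And>a b. a \<le> b \<Longrightarrow> (v has_integral (w b - w a)) {a..b}"
    using assms unfolding regular_wavelet_def by auto
  \<comment> \<open>Larger than the support bound, so that \<open>w\<close> also vanishes at the end
    points of \<open>{-R..R}\<close>.\<close>
  define R where "R = \<bar>R0\<bar> + 1"
  have R: "0 < R" "\<And>x. R \<le> \<bar>x\<bar> \<Longrightarrow> w x = 0" using R0 by (auto simp: R_def)
  have "v \<in> borel_measurable (completion lborel)" using v by (simp add: sq_integrable_def)
  then obtain u where u [measurable]: "u \<in> borel_measurable borel" and uv: "AE x in lborel. v x = u x"
    using completion_ex_borel_measurable_real[of v lborel] by auto
  have uv': "AE x in lebesgue. v x = u x" using uv by (rule AE_completion)
  have um: "u \<in> borel_measurable lebesgue" by (rule measurable_completion) simp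
  have "integrable lebesgue (\<lambda>x. (u x)\<^sup>2)"
    using v uv' um by (subst integrable_cong_AE[where g = "\<lambda>x. (v x)\<^sup>2"]) (auto simp: sq_integrable_def)
  then have u2: "integrable lborel (\<lambda>x. (u x)\<^sup>2)" by (subst (asm) integrable_completion) auto
  then have usq: "sq_integrable lborel u" by (simp add: sq_integrable_def)
  have uint: "integrable lborel (\<lambda>t. indicator {a..b} t * u t)" for a b
  proof -
    have "sq_integrable lborel (indicator {a..b} :: real \<Rightarrow> real)"
      unfolding sq_integrable_def by (simp add: power2_eq_square indicator_inter_arith[symmetric] emeasure_lborel_Icc_eq)
    from sq_integrable_product[OF this usq] show ?thesis .
  qed
  have wu: "w b - w a = (LINT t|lborel. indicator {a..b} t * u t)" if "a \<le> b" for a b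
  proof -
    have "((\<lambda>t. indicator {a..b} t * u t) has_integral (LINT t|lborel. indicator {a..b} t * u t)) UNIV"
      by (rule has_integral_integral_lborel[OF uint])
    then have "((\<lambda>t. if t \<in> {a..b} then u t else 0) has_integral (LINT t|lborel. indicator {a..b} t * u t)) UNIV"
      by (rule has_integral_eq[rotated]) (auto simp: indicator_def)
    then have 1: "(u has_integral (LINT t|lborel. indicator {a..b} t * u t)) {a..b}"
      unfolding has_integral_restrict_UNIV .
    obtain N where N: "N \<in> null_sets lebesgue" "{x. v x \<noteq> u x} \<subseteq> N"
      using uv' by (auto simp: eventually_ae_filter)
    then have "negligible N" by (simp add: negligible_iff_null_sets)
    then have "(u has_integral (w b - w a)) {a..b}"
    proof (rule has_integral_spike[OF _ _ wv[OF that]])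
      show "u x = v x" if "x \<in> {a..b} - N" for x
        using N(2) that by (metis (mono_tags, lifting) DiffE mem_Collect_eq subsetD)
    qed
    then show ?thesis using 1 has_integral_unique by blast
  qed
  define w' where "w' x = indicator {-R..R} x * u x" for x
  have sq: "sq_integrable lborel w'"
  proof -
    have "integrable lborel (\<lambda>x. indicator {-R..R} x *\<^sub>R (u x)\<^sup>2)" using u2 by (intro integrable_mult_indicator) auto
    moreover have "(w' x)\<^sup>2 = indicator {-R..R} x *\<^sub>R (u x)\<^sup>2" for x
      by (simp add: w'_def indicator_def)
    moreover have "w' \<in> borel_measurable lborel" unfolding w'_def[abs_def] by simp
    ultimately show ?thesis by (simp add: sq_integrable_def)
  qed
  have int: "integrable lborel w'" unfolding w'_def[abs_def] by (rule uint)
  have "w y - w x = (LINT t|lborel. indicator {x..y} t * w' t)" if xy: "x \<le> y" for x y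
  proof -
    \<comment> \<open>Clamping to \<open>{-R..R}\<close> leaves the values of \<open>w\<close>
      unchanged and moves every increment into the support interval.\<close>
    define cl where "cl z = max (- R) (min R z)" for z
    have clw: "w (cl z) = w z" for z
      using R by (cases "R \<le> \<bar>z\<bar>") (auto simp: cl_def max_def min_def)
    have "cl x \<le> cl y" using xy by (auto simp: cl_def)
    then have "w y - w x = (LINT t|lborel. indicator {cl x..cl y} t * u t)"
      using wu[of "cl x" "cl y"] clw by simp
    also have "\<dots> = (LINT t|lborel. indicator {x..y} t * w' t)"
    proof (rule integral_cong_AE)
      \<comment> \<open>The integrands can differ only at \<open>R\<close> and \<open>- R\<close>,
        where clamping may leave a one-point interval.\<close>
      have "AE t in lborel. t \<noteq> R \<and> t \<noteq> - R" by (intro AE_conjI AE_lborel_singleton)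
      then show "AE t in lborel. indicator {cl x..cl y} t * u t = indicator {x..y} t * w' t"
        by (eventually_elim) (use R(1) in \<open>auto simp: w'_def cl_def indicator_def max_def min_def split: if_splits\<close>)
    qed (auto simp: w'_def)
    finally show ?thesis .
  qed
  then have "weak_derivative w w'" using sq int by (simp add: weak_derivative_def)
  moreover have "w' x = 0" if "R < \<bar>x\<bar>" for x using that by (auto simp: w'_def indicator_def)
  ultimately show ?thesis using that R(1) by blast
qed

text \<open>Bounds how many translates of a function supported in \<open>{-R..R}\<close> are active
  at one point.\<close>

lemma card_nat_window:
  fixes z R :: real
  assumes "0 \<le> R"
  shows "real (card {k \<in> I. \<bar>z - real k\<bar> \<le> R}) \<le> 2 * R + 1"
proof -
  let ?S = "{k \<in> I. \<bar>z - real k\<bar> \<le> R}"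
  have "int ` ?S \<subseteq> {\<lceil>z - R\<rceil>..\<lfloor>z + R\<rfloor>}" by (auto simp: ceiling_le_iff le_floor_iff abs_le_iff)
  then have "card (int ` ?S) \<le> card {\<lceil>z - R\<rceil>..\<lfloor>z + R\<rfloor>}" by (intro card_mono) auto
  then have "card ?S \<le> nat (\<lfloor>z + R\<rfloor> - \<lceil>z - R\<rceil> + 1)" by (simp add: card_image)
  moreover have "real (nat (\<lfloor>z + R\<rfloor> - \<lceil>z - R\<rceil> + 1)) \<le> 2 * R + 1"
  proof (cases "0 \<le> \<lfloor>z + R\<rfloor> - \<lceil>z - R\<rceil> + 1")
    case True
    have "real_of_int \<lfloor>z + R\<rfloor> \<le> z + R" "z - R \<le> real_of_int \<lceil>z - R\<rceil>" by linarith+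
    moreover have "real (nat (\<lfloor>z + R\<rfloor> - \<lceil>z - R\<rceil> + 1)) = real_of_int (\<lfloor>z + R\<rfloor> - \<lceil>z - R\<rceil> + 1)"
      using True by simp
    ultimately show ?thesis unfolding of_int_diff of_int_add of_int_1 by linarith
  qed (use assms in simp)
  ultimately show ?thesis by linarith
qed

text \<open>Translates by integers of a compactly supported function overlap boundedly often, so the
  square of their sum is at most a constant times the sum of the squares.\<close>

lemma regular_wavelet_level_sum:
  assumes "regular_wavelet w"
  obtains C where "0 \<le> C"
    and "\<And>j (I :: nat set) b s. finite I \<Longrightarrow>
      sobolev_bound (\<lambda>x. \<Sum>k\<in>I. b k * (2 powr (real j / 2) * w (2 ^ j * x - (real k + s))))
        (C * 2 ^ j * sqrt (\<Sum>k\<in>I. (b k)\<^sup>2))"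
proof -
  obtain R w' where R: "0 < R" and w': "weak_derivative w w'" "\<And>x. R < \<bar>x\<bar> \<Longrightarrow> w' x = 0"
    using regular_wavelet_derivative[OF assms] by metis
  define V where "V = (LINT x|lborel. (w' x)\<^sup>2)"
  have V0: "0 \<le> V" unfolding V_def by (intro integral_nonneg_AE) auto
  define C where "C = sqrt ((2 * R + 1) * V)"
  have "sobolev_bound (\<lambda>x. \<Sum>k\<in>I. b k * (2 powr (real j / 2) * w (2 ^ j * x - (real k + s))))
        (C * 2 ^ j * sqrt (\<Sum>k\<in>I. (b k)\<^sup>2))" if I: "finite I" for j and I :: "nat set" and b s
  proof (rule weak_derivative_imp_sobolev_bound)
    let ?m = "2 ^ j :: real" and ?p = "2 powr (real j / 2) :: real"
    let ?d = "\<lambda>k x. ?m * w' (?m * x - (real k + s))"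
    have wd: "weak_derivative (\<lambda>x. w (?m * x - (real k + s))) (?d k)" for k
      by (rule weak_derivative_affine[OF w'(1)]) simp
    have "weak_derivative (\<lambda>x. \<Sum>k\<in>I. (b k * ?p) * w (?m * x - (real k + s))) (\<lambda>x. \<Sum>k\<in>I. (b k * ?p) * ?d k x)"
      by (rule weak_derivative_sum[OF I wd])
    then show wD: "weak_derivative (\<lambda>x. \<Sum>k\<in>I. b k * (?p * w (?m * x - (real k + s)))) (\<lambda>x. \<Sum>k\<in>I. (b k * ?p) * ?d k x)"
      by (simp only: mult.assoc)
    show "0 \<le> C * 2 ^ j * sqrt (\<Sum>k\<in>I. (b k)\<^sup>2)"
      using V0 R by (simp add: C_def sum_nonneg)
    \<comment> \<open>Cauchy-Schwarz over the at most \<open>2 * R + 1\<close> terms that do not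
      vanish at \<open>x\<close>.\<close>
    have pt: "(\<Sum>k\<in>I. (b k * ?p) * ?d k x)\<^sup>2 \<le> (2 * R + 1) * (\<Sum>k\<in>I. (b k * ?p)\<^sup>2 * (?d k x)\<^sup>2)" for x
    proof -
      let ?S = "{k \<in> I. \<bar>(?m * x - s) - real k\<bar> \<le> R}"
      have "?d k x = 0" if "k \<in> I - ?S" for k
        using that w'(2)[of "?m * x - (real k + s)"] by (auto simp: algebra_simps)
      then have "(\<Sum>k\<in>I. (b k * ?p) * ?d k x) = (\<Sum>k\<in>?S. (b k * ?p) * ?d k x)"
        using I by (intro sum.mono_neutral_right) auto
      then have "(\<Sum>k\<in>I. (b k * ?p) * ?d k x)\<^sup>2 \<le> (\<Sum>k\<in>?S. ((b k * ?p) * ?d k x)\<^sup>2) * real (card ?S)"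
        using sum_squared_le_sum_of_squares[of "\<lambda>k. (b k * ?p) * ?d k x" ?S] by simp
      also have "\<dots> \<le> (\<Sum>k\<in>I. ((b k * ?p) * ?d k x)\<^sup>2) * (2 * R + 1)"
        using I R card_nat_window[of R I "?m * x - s"] by (intro mult_mono sum_mono2) (auto intro: sum_nonneg)
      finally show ?thesis by (simp add: power_mult_distrib mult.commute)
    qed
    have dint: "integrable lborel (\<lambda>x. (?d k x)\<^sup>2)" for k
      using wd[of k] by (simp add: weak_derivative_def sq_integrable_def)
    have Sint: "integrable lborel (\<lambda>x. (\<Sum>k\<in>I. (b k * ?p) * ?d k x)\<^sup>2)"
      using wD unfolding weak_derivative_def sq_integrable_def by blast
    have "(LINT x|lborel. (\<Sum>k\<in>I. (b k * ?p) * ?d k x)\<^sup>2) \<le>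
      (LINT x|lborel. (2 * R + 1) * (\<Sum>k\<in>I. (b k * ?p)\<^sup>2 * (?d k x)\<^sup>2))"
      using pt by (intro integral_mono Sint integrable_mult_right Bochner_Integration.integrable_sum dint) auto
    also have "\<dots> = (2 * R + 1) * (\<Sum>k\<in>I. (b k * ?p)\<^sup>2 * (?m * V))"
    proof -
      have "(LINT x|lborel. (\<Sum>k\<in>I. (b k * ?p)\<^sup>2 * (?d k x)\<^sup>2)) = (\<Sum>k\<in>I. LINT x|lborel. (b k * ?p)\<^sup>2 * (?d k x)\<^sup>2)"
        by (intro Bochner_Integration.integral_sum integrable_mult_right dint)
      also have "\<dots> = (\<Sum>k\<in>I. (b k * ?p)\<^sup>2 * (?m * V))"
        unfolding integral_mult_right_zero V_def by (subst weak_derivative_affine(2)[OF w'(1)]) auto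
      finally show ?thesis unfolding integral_mult_right_zero by simp
    qed
    also have "\<dots> = (C * 2 ^ j * sqrt (\<Sum>k\<in>I. (b k)\<^sup>2))\<^sup>2"
    proof -
      \<comment> \<open>The squared normalisation supplies one factor \<open>2 ^ j\<close>, the
        dilated derivative the other.\<close>
      have p2: "?p\<^sup>2 = ?m" by (simp add: power2_eq_square powr_add[symmetric] powr_realpow)
      have "(\<Sum>k\<in>I. (b k * ?p)\<^sup>2 * (?m * V)) = (\<Sum>k\<in>I. (b k)\<^sup>2) * (?m * (?m * V))"
        unfolding power_mult_distrib p2 sum_distrib_right by (simp only: mult.assoc)
      moreover have "(C * 2 ^ j * sqrt (\<Sum>k\<in>I. (b k)\<^sup>2))\<^sup>2 = ((2 * R + 1) * V) * (?m * ?m) * (\<Sum>k\<in>I. (b k)\<^sup>2)"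
        using R V0 unfolding power_mult_distrib C_def
        by (simp add: sum_nonneg power2_eq_square[of "2 ^ j"])
      moreover have "r * (S * (m * (m * v))) = r * v * (m * m) * S" for r S m v :: real by simp
      ultimately show ?thesis by metis
    qed
    finally show "(LINT x|lborel. (\<Sum>k\<in>I. (b k * ?p) * ?d k x)\<^sup>2) \<le> (C * 2 ^ j * sqrt (\<Sum>k\<in>I. (b k)\<^sup>2))\<^sup>2" .
  qed
  moreover have "0 \<le> C" using R V0 by (simp add: C_def)
  ultimately show ?thesis using that by blast
qed

lemma sum_abs_le_sqrt_sum_squares:
  fixes b :: "'a \<Rightarrow> real"
  assumes "finite I" "i \<in> I"
  shows "\<bar>b i\<bar> \<le> sqrt (\<Sum>k\<in>I. (b k)\<^sup>2)"
proof (rule real_le_rsqrt)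
  show "\<bar>b i\<bar>\<^sup>2 \<le> (\<Sum>k\<in>I. (b k)\<^sup>2)"
    using assms by (simp add: member_le_sum[of i I "\<lambda>k. (b k)\<^sup>2"])
qed

text \<open>Triangle inequality, with each \<open>\<bar>b k\<bar>\<close> bounded by the norm over
  all of \<open>J\<close>. The sum of the \<open>D k\<close> is an acceptable price when
  \<open>I\<close> has boundedly many elements, as for edge functions.\<close>

lemma sobolev_bound_linear_combination:
  assumes "finite I" "\<And>k. k \<in> I \<Longrightarrow> sobolev_bound (G k) (D k)" and "finite J" "I \<subseteq> J"
  shows "sobolev_bound (\<lambda>x. \<Sum>k\<in>I. b k * G k x) ((\<Sum>k\<in>I. D k) * sqrt (\<Sum>k\<in>J. (b k)\<^sup>2))"
proof (rule sobolev_bound_mono)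
  show "sobolev_bound (\<lambda>x. \<Sum>k\<in>I. b k * G k x) (\<Sum>k\<in>I. \<bar>b k\<bar> * D k)"
    using assms(1,2) by (intro sobolev_bound_sum sobolev_bound_scale)
  have "\<bar>b k\<bar> * D k \<le> D k * sqrt (\<Sum>k\<in>J. (b k)\<^sup>2)" if "k \<in> I" for k
  proof -
    have "\<bar>b k\<bar> * D k \<le> sqrt (\<Sum>k\<in>J. (b k)\<^sup>2) * D k"
    proof (rule mult_right_mono)
      show "\<bar>b k\<bar> \<le> sqrt (\<Sum>k\<in>J. (b k)\<^sup>2)"
        using sum_abs_le_sqrt_sum_squares[of J k b] assms(3,4) that by blast
      show "0 \<le> D k" by (rule sobolev_bound_nonneg[OF assms(2)[OF that]])
    qed
    then show ?thesis by (simp only: mult.commute)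
  qed
  then show "(\<Sum>k\<in>I. \<bar>b k\<bar> * D k) \<le> (\<Sum>k\<in>I. D k) * sqrt (\<Sum>k\<in>J. (b k)\<^sup>2)"
    unfolding sum_distrib_right by (rule sum_mono)
qed

lemma regular_wavelet_dilate:
  assumes "regular_wavelet w"
  shows "\<exists>C. \<forall>j s. sobolev_bound (\<lambda>x. 2 powr (real j / 2) * w (2 ^ j * x - s)) (C * 2 ^ j)"
proof -
  obtain C where "0 \<le> C" and C: "\<And>j (I :: nat set) b s. finite I \<Longrightarrow>
      sobolev_bound (\<lambda>x. \<Sum>k\<in>I. b k * (2 powr (real j / 2) * w (2 ^ j * x - (real k + s))))
        (C * 2 ^ j * sqrt (\<Sum>k\<in>I. (b k)\<^sup>2))"
    using regular_wavelet_level_sum[OF assms] by blast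
  have "sobolev_bound (\<lambda>x. 2 powr (real j / 2) * w (2 ^ j * x - s)) (C * 2 ^ j)" for j s
    using C[of "{0}" "\<lambda>_. 1" j s] by simp
  then show ?thesis by blast
qed

text \<open>Interior functions are integer translates with bounded overlap. At most
  \<open>2 * K\<close> edge functions remain, each with derivative norm of order
  \<open>2 ^ j\<close>, and the triangle inequality suffices for them.\<close>

lemma adapted_family_level_sum:
  assumes fam: "adapted_family K J0 w W" and w: "regular_wavelet w"
  obtains C where "0 \<le> C" and "\<And>j b. J0 \<le> j \<Longrightarrow> 2 * K \<le> 2 ^ j \<Longrightarrow>
      sobolev_bound (\<lambda>x. \<Sum>k<2 ^ j. b k * W j k x) (C * 2 ^ j * sqrt (\<Sum>k<2 ^ j. (b k)\<^sup>2))"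
proof -
  obtain A B where reg: "\<And>i. i < 2 * K \<Longrightarrow> regular_wavelet (A i) \<and> regular_wavelet (B i)"
    and W: "\<And>j k x. J0 \<le> j \<Longrightarrow> 2 * K \<le> 2 ^ j \<Longrightarrow> k < 2 ^ j \<Longrightarrow> x \<in> {0..1} \<Longrightarrow> W j k x =
            (if K \<le> k \<and> k < 2 ^ j - K then dil w j (int k) x
             else let i = (if k < K then k else K + (2 ^ j - 1 - k))
                  in 2 powr (real j / 2) * (A i (2 ^ j * x) + B i (2 ^ j * (x - 1))))"
    using fam unfolding adapted_family_def by blast
  obtain C where C: "0 \<le> C" "\<And>j (I :: nat set) b s. finite I \<Longrightarrow>
      sobolev_bound (\<lambda>x. \<Sum>k\<in>I. b k * (2 powr (real j / 2) * w (2 ^ j * x - (real k + s))))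
        (C * 2 ^ j * sqrt (\<Sum>k\<in>I. (b k)\<^sup>2))"
    using regular_wavelet_level_sum[OF w] by blast
  have "\<forall>i. \<exists>c. i < 2 * K \<longrightarrow> (\<forall>j. sobolev_bound (\<lambda>x. 2 powr (real j / 2) * (A i (2 ^ j * x) + B i (2 ^ j * (x - 1)))) (c * 2 ^ j))"
  proof (intro allI)
    fix i
    show "\<exists>c. i < 2 * K \<longrightarrow> (\<forall>j. sobolev_bound (\<lambda>x. 2 powr (real j / 2) * (A i (2 ^ j * x) + B i (2 ^ j * (x - 1)))) (c * 2 ^ j))"
    proof (cases "i < 2 * K")
      case True
      obtain a where a: "\<And>j s. sobolev_bound (\<lambda>x. 2 powr (real j / 2) * A i (2 ^ j * x - s)) (a * 2 ^ j)"
        using regular_wavelet_dilate reg[OF True] by meson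
      obtain b where b: "\<And>j s. sobolev_bound (\<lambda>x. 2 powr (real j / 2) * B i (2 ^ j * x - s)) (b * 2 ^ j)"
        using regular_wavelet_dilate reg[OF True] by meson
      \<comment> \<open>The shift \<open>2 ^ j\<close> moves the anchor of \<open>B i\<close> to the
        end point 1.\<close>
      have "sobolev_bound (\<lambda>x. 2 powr (real j / 2) * (A i (2 ^ j * x) + B i (2 ^ j * (x - 1)))) ((a + b) * 2 ^ j)" for j
        using sobolev_bound_add[OF a[of j 0] b[of j "2 ^ j"]] by (simp add: algebra_simps)
      then show ?thesis by blast
    qed blast
  qed
  then obtain c where c: "\<And>i j. i < 2 * K \<Longrightarrow>
      sobolev_bound (\<lambda>x. 2 powr (real j / 2) * (A i (2 ^ j * x) + B i (2 ^ j * (x - 1)))) (c i * 2 ^ j)"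
    by metis
  have c0: "0 \<le> c i" if "i < 2 * K" for i using sobolev_bound_nonneg[OF c[OF that, of 0]] by simp
  define c' where "c' = (\<Sum>i<2 * K. c i)"
  have c'0: "0 \<le> c'" unfolding c'_def using c0 by (intro sum_nonneg) auto
  have c': "c i \<le> c'" if "i < 2 * K" for i
    unfolding c'_def using c0 that by (intro member_le_sum) auto
  define C' where "C' = C + real (2 * K) * c'"
  have "sobolev_bound (\<lambda>x. \<Sum>k<2 ^ j. b k * W j k x) (C' * 2 ^ j * sqrt (\<Sum>k<2 ^ j. (b k)\<^sup>2))"
    if j: "J0 \<le> j" "2 * K \<le> 2 ^ j" for j b
  proof -
    let ?I = "{K..<2 ^ j - K}"
    let ?E = "{..<(2::nat) ^ j} - ?I"
    let ?S = "sqrt (\<Sum>k<2 ^ j. (b k)\<^sup>2)"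
    define ix where "ix k = (if k < K then k else K + (2 ^ j - 1 - k))" for k
    define H where "H k x = 2 powr (real j / 2) * (A (ix k) (2 ^ j * x) + B (ix k) (2 ^ j * (x - 1)))" for k x
    have ix: "ix k < 2 * K" if "k \<in> ?E" for k using that j by (auto simp: ix_def)
    have sub: "?I \<subseteq> {..<(2::nat) ^ j}" by auto
    have "sobolev_bound (\<lambda>x. \<Sum>k\<in>?I. b k * (2 powr (real j / 2) * w (2 ^ j * x - (real k + 0))))
        (C * 2 ^ j * sqrt (\<Sum>k\<in>?I. (b k)\<^sup>2))"
      by (rule C(2)) simp
    moreover have "C * 2 ^ j * sqrt (\<Sum>k\<in>?I. (b k)\<^sup>2) \<le> C * 2 ^ j * ?S"
      using C(1) sub by (intro mult_left_mono real_sqrt_le_mono sum_mono2) auto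
    ultimately have int: "sobolev_bound (\<lambda>x. \<Sum>k\<in>?I. b k * (2 powr (real j / 2) * w (2 ^ j * x - (real k + 0)))) (C * 2 ^ j * ?S)"
      by (rule sobolev_bound_mono)
    have "sobolev_bound (\<lambda>x. \<Sum>k\<in>?E. b k * H k x) ((\<Sum>k\<in>?E. c (ix k) * 2 ^ j) * ?S)"
      unfolding H_def using c ix by (intro sobolev_bound_linear_combination) auto
    moreover have "(\<Sum>k\<in>?E. c (ix k) * 2 ^ j) * ?S \<le> real (2 * K) * c' * 2 ^ j * ?S"
    proof (intro mult_right_mono)
      have "(\<Sum>k\<in>?E. c (ix k) * 2 ^ j) \<le> (\<Sum>k\<in>?E. c' * 2 ^ j)"
        using c' ix by (intro sum_mono mult_right_mono) auto
      also have "\<dots> = real (card ?E) * (c' * 2 ^ j)" by simp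
      also have "card ?E = 2 ^ j - card ?I" using card_Diff_subset[OF _ sub] by simp
      also have "real (2 ^ j - card ?I) * (c' * 2 ^ j) \<le> real (2 * K) * (c' * 2 ^ j)"
        using j c'0 by (intro mult_right_mono) auto
      finally show "(\<Sum>k\<in>?E. c (ix k) * 2 ^ j) \<le> real (2 * K) * c' * 2 ^ j" by (simp add: mult.assoc)
    qed (simp add: sum_nonneg)
    ultimately have edge: "sobolev_bound (\<lambda>x. \<Sum>k\<in>?E. b k * H k x) (real (2 * K) * c' * 2 ^ j * ?S)"
      by (rule sobolev_bound_mono)
    from sobolev_bound_add[OF int edge]
    have "sobolev_bound (\<lambda>x. (\<Sum>k\<in>?I. b k * (2 powr (real j / 2) * w (2 ^ j * x - (real k + 0)))) + (\<Sum>k\<in>?E. b k * H k x))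
      (C' * 2 ^ j * ?S)"
      by (simp add: C'_def distrib_right)
    then show ?thesis
    proof (rule sobolev_bound_cong)
      fix x :: real assume x: "0 \<le> x" "x \<le> 1"
      have "(\<Sum>k<2 ^ j. b k * W j k x) = (\<Sum>k\<in>?E. b k * W j k x) + (\<Sum>k\<in>?I. b k * W j k x)"
        by (rule sum.subset_diff[OF sub]) simp
      also have "(\<Sum>k\<in>?I. b k * W j k x) = (\<Sum>k\<in>?I. b k * (2 powr (real j / 2) * w (2 ^ j * x - (real k + 0))))"
        using W[OF j] x by (intro sum.cong) (auto simp: dil_def)
      also have "(\<Sum>k\<in>?E. b k * W j k x) = (\<Sum>k\<in>?E. b k * H k x)"
        using W[OF j] x by (intro sum.cong) (auto simp: H_def ix_def Let_def)
      finally show "(\<Sum>k<2 ^ j. b k * W j k x) =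
        (\<Sum>k\<in>?I. b k * (2 powr (real j / 2) * w (2 ^ j * x - (real k + 0)))) + (\<Sum>k\<in>?E. b k * H k x)"
        by linarith
    qed
  qed
  moreover have "0 \<le> C'" using C(1) c'0 by (simp add: C'_def)
  ultimately show ?thesis using that by blast
qed

lemma adapted_family_member:
  assumes "adapted_family K J0 w W" "regular_wavelet w" "J0 \<le> j" "2 * K \<le> 2 ^ j" "k < 2 ^ j"
  shows "\<exists>D. sobolev_bound (W j k) D"
proof -
  obtain C where "sobolev_bound (\<lambda>x. \<Sum>m<2 ^ j. of_bool (m = k) * W j m x) (C * 2 ^ j * sqrt (\<Sum>m<2 ^ j. (of_bool (m = k))\<^sup>2))"
    using adapted_family_level_sum[OF assms(1,2)] assms(3,4) by meson
  moreover have "(\<Sum>m<2 ^ j. of_bool (m = k) * W j m x) = W j k x" for x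
    using assms(5) by (simp add: of_bool_def if_distrib[of "\<lambda>c. c * _"] cong: if_cong)
  ultimately show ?thesis by auto
qed

lemma two_scale_sobolev:
  assumes "\<forall>x\<in>{0..1}. G x = (\<Sum>m<(2::nat) ^ j. h m * F m x)" "\<And>m. m < 2 ^ j \<Longrightarrow> \<exists>D. sobolev_bound (F m) D"
  shows "\<exists>D. sobolev_bound G D"
proof -
  have "\<forall>m. \<exists>D. m < 2 ^ j \<longrightarrow> sobolev_bound (F m) D" using assms(2) by blast
  then obtain D where "\<And>m. m < 2 ^ j \<Longrightarrow> sobolev_bound (F m) (D m)" by metis
  then have "sobolev_bound (\<lambda>x. \<Sum>m<2 ^ j. h m * F m x) (\<Sum>m<2 ^ j. \<bar>h m\<bar> * D m)"
    by (intro sobolev_bound_sum sobolev_bound_scale) auto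
  then have "sobolev_bound G (\<Sum>m<2 ^ j. \<bar>h m\<bar> * D m)"
    by (rule sobolev_bound_cong) (use assms(1) in auto)
  then show ?thesis by blast
qed

text \<open>Coarse levels, where the boundary zones overlap, have no explicit form; the two-scale
  relations express them through finer levels. The bounds obtained carry no rate, which is enough
  for finitely many levels.\<close>

lemma boundary_adapted_sobolev:
  assumes ba: "boundary_adapted J0 \<phi> \<psi> \<Phi> \<Psi>" and reg: "regular_wavelet \<phi>" "regular_wavelet \<psi>"
    and "J0 \<le> j" "k < 2 ^ j"
  shows "(\<exists>D. sobolev_bound (\<Phi> j k) D) \<and> (\<exists>D. sobolev_bound (\<Psi> j k) D)"
proof -
  obtain K where K: "adapted_family K J0 \<phi> \<Phi>" "adapted_family K J0 \<psi> \<Psi>"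
    using ba by (auto simp: boundary_adapted_def)
  have two: "\<exists>h. \<forall>x\<in>{0..1}. \<Phi> j k x = (\<Sum>m<2 ^ Suc j. h m * \<Phi> (Suc j) m x)"
    "\<exists>h. \<forall>x\<in>{0..1}. \<Psi> j k x = (\<Sum>m<2 ^ Suc j. h m * \<Phi> (Suc j) m x)" if "J0 \<le> j" "k < 2 ^ j" for j k
    using ba that by (auto simp: boundary_adapted_def)
  have big: "2 * K \<le> 2 ^ j" if "K \<le> j" for j
  proof (cases K)
    case (Suc m)
    have "m < (2::nat) ^ m" by (rule less_exp)
    then have "Suc m \<le> 2 ^ m" by (rule Suc_leI)
    then have "2 * Suc m \<le> 2 * 2 ^ m" by (rule mult_le_mono2)
    then have "2 * K \<le> 2 ^ K" by (simp only: Suc power_Suc)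
    also have "(2::nat) ^ K \<le> 2 ^ j" using that by (intro power_increasing) auto
    finally show ?thesis .
  qed simp
  \<comment> \<open>Induction on \<open>K - j\<close>: at 0 the explicit form applies, and each step
    descends by one level.\<close>
  have \<Phi>: "\<forall>k<2 ^ j. \<exists>D. sobolev_bound (\<Phi> j k) D" if "J0 \<le> j" for j
    using that
  proof (induction "K - j" arbitrary: j)
    case 0
    then show ?case using adapted_family_member[OF K(1) reg(1)] big by simp
  next
    case (Suc d)
    have IH: "\<forall>k<2 ^ Suc j. \<exists>D. sobolev_bound (\<Phi> (Suc j) k) D"
      using Suc.hyps Suc.prems by (intro Suc.hyps(1)) auto
    show ?case
    proof (intro allI impI)
      fix k assume "k < (2::nat) ^ j"
      then obtain h where "\<forall>x\<in>{0..1}. \<Phi> j k x = (\<Sum>m<2 ^ Suc j. h m * \<Phi> (Suc j) m x)"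
        using two(1)[OF Suc.prems] by blast
      then show "\<exists>D. sobolev_bound (\<Phi> j k) D" by (rule two_scale_sobolev) (use IH in blast)
    qed
  qed
  obtain h where "\<forall>x\<in>{0..1}. \<Psi> j k x = (\<Sum>m<2 ^ Suc j. h m * \<Phi> (Suc j) m x)"
    using two(2)[OF assms(4,5)] by blast
  then have "\<exists>D. sobolev_bound (\<Psi> j k) D"
    by (rule two_scale_sobolev) (use \<Phi>[of "Suc j"] assms(4) in auto)
  then show ?thesis using \<Phi> assms(4,5) by blast
qed

text \<open>The father functions and the finitely many coarse levels are absorbed into the constant,
  so that one \<open>C\<close> serves everywhere.\<close>

lemma wavelet_basis_sobolev:
  assumes "wavelet_basis J0 \<phi> \<psi> e"
  obtains C where "0 \<le> C" and "\<And>l. l \<in> {1..2 ^ J0} \<Longrightarrow> sobolev_bound (e l) C"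
    and "\<And>j b. J0 \<le> j \<Longrightarrow> sobolev_bound (\<lambda>x. \<Sum>k<2 ^ j. b k * e (2 ^ j + k + 1) x)
        (C * 2 ^ j * sqrt (\<Sum>k<2 ^ j. (b k)\<^sup>2))"
proof -
  obtain \<Phi> \<Psi> where reg: "regular_wavelet \<phi>" "regular_wavelet \<psi>" and ba: "boundary_adapted J0 \<phi> \<psi> \<Phi> \<Psi>"
    and e: "\<And>k. k < 2 ^ J0 \<Longrightarrow> e (k + 1) = \<Phi> J0 k"
      "\<And>j k. J0 \<le> j \<Longrightarrow> k < 2 ^ j \<Longrightarrow> e (2 ^ j + k + 1) = \<Psi> j k"
    using assms unfolding wavelet_basis_def by blast
  obtain K where K: "adapted_family K J0 \<psi> \<Psi>" using ba by (auto simp: boundary_adapted_def)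
  obtain C1 where C1: "0 \<le> C1" "\<And>j b. J0 \<le> j \<Longrightarrow> 2 * K \<le> 2 ^ j \<Longrightarrow>
      sobolev_bound (\<lambda>x. \<Sum>k<2 ^ j. b k * \<Psi> j k x) (C1 * 2 ^ j * sqrt (\<Sum>k<2 ^ j. (b k)\<^sup>2))"
    using adapted_family_level_sum[OF K reg(2)] by blast
  have "\<forall>k. \<exists>D. k < 2 ^ J0 \<longrightarrow> sobolev_bound (\<Phi> J0 k) D"
    using boundary_adapted_sobolev[OF ba reg order_refl] by blast
  then obtain D where D: "\<And>k. k < 2 ^ J0 \<Longrightarrow> sobolev_bound (\<Phi> J0 k) (D k)" by metis
  have "\<forall>j k. \<exists>D. J0 \<le> j \<and> k < 2 ^ j \<longrightarrow> sobolev_bound (\<Psi> j k) D"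
    using boundary_adapted_sobolev[OF ba reg] by blast
  then obtain E where E: "\<And>j k. J0 \<le> j \<Longrightarrow> k < 2 ^ j \<Longrightarrow> sobolev_bound (\<Psi> j k) (E j k)" by metis
  define low where "low = {j. J0 \<le> j \<and> (2::nat) ^ j < 2 * K}"
  have finlow: "finite low"
  proof (rule finite_subset)
    show "low \<subseteq> {..<2 * K}"
    proof
      fix j assume "j \<in> low"
      then have "(2::nat) ^ j < 2 * K" by (simp only: low_def mem_Collect_eq)
      with less_exp[of j] have "j < 2 * K" by (rule less_trans)
      then show "j \<in> {..<2 * K}" by simp
    qed
  qed simp
  \<comment> \<open>Sums take the place of maxima: the terms are nonnegative, so each is at most the
    total.\<close>
  define C2 where "C2 = (\<Sum>j\<in>low. \<Sum>k<2 ^ j. E j k)"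
  define C3 where "C3 = (\<Sum>k<2 ^ J0. D k)"
  have inner0: "0 \<le> (\<Sum>k<2 ^ j. E j k)" if "J0 \<le> j" for j
    using E[OF that] sobolev_bound_nonneg by (intro sum_nonneg) force
  have "0 \<le> E j k" if "J0 \<le> j" "k < 2 ^ j" for j k by (rule sobolev_bound_nonneg[OF E[OF that]])
  then have C2: "0 \<le> C2" unfolding C2_def by (intro sum_nonneg) (auto simp: low_def)
  have C3: "0 \<le> C3" unfolding C3_def using D sobolev_bound_nonneg by (intro sum_nonneg) force
  define C where "C = C1 + C2 + C3"
  show ?thesis
  proof (rule that)
    show "0 \<le> C" using C1(1) C2 C3 by (simp add: C_def)
    fix l :: nat assume l: "l \<in> {1..2 ^ J0}"
    have "sobolev_bound (e l) (D (l - 1))" using e(1)[of "l - 1"] D[of "l - 1"] l by auto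
    moreover have "D (l - 1) \<le> C3"
      unfolding C3_def using D sobolev_bound_nonneg l by (intro member_le_sum) force+
    ultimately show "sobolev_bound (e l) C"
      using C1(1) C2 unfolding C_def by (meson add_increasing add_nonneg_nonneg order_trans sobolev_bound_mono order_refl)
  next
    fix j and b :: "nat \<Rightarrow> real" assume j: "J0 \<le> j"
    let ?S = "sqrt (\<Sum>k<2 ^ j. (b k)\<^sup>2)"
    have S0: "0 \<le> ?S" by (simp add: sum_nonneg)
    have "sobolev_bound (\<lambda>x. \<Sum>k<2 ^ j. b k * \<Psi> j k x) (C * 2 ^ j * ?S)"
    proof (cases "2 * K \<le> 2 ^ j")
      case True
      have "C1 * 2 ^ j * ?S \<le> C * 2 ^ j * ?S"
        using C2 C3 S0 by (intro mult_right_mono) (auto simp: C_def)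
      then show ?thesis using C1(2)[OF j True] sobolev_bound_mono by blast
    next
      case False
      then have jl: "j \<in> low" using j by (simp add: low_def)
      have "sobolev_bound (\<lambda>x. \<Sum>k<2 ^ j. b k * \<Psi> j k x) ((\<Sum>k<2 ^ j. E j k) * ?S)"
        using E[OF j] by (intro sobolev_bound_linear_combination) auto
      moreover have "(\<Sum>k<2 ^ j. E j k) * ?S \<le> C * 2 ^ j * ?S"
      proof (intro mult_right_mono S0)
        have "(\<Sum>k<2 ^ j. E j k) \<le> C2"
          unfolding C2_def using finlow jl inner0
          by (intro member_le_sum[where f = "\<lambda>j. \<Sum>k<2 ^ j. E j k"]) (auto simp: low_def)
        also have "C2 \<le> C * 1" using C1(1) C3 by (simp add: C_def)
        also have "C * 1 \<le> C * 2 ^ j" using C1(1) C2 C3 by (intro mult_left_mono) (auto simp: C_def)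
        finally show "(\<Sum>k<2 ^ j. E j k) \<le> C * 2 ^ j" .
      qed
      ultimately show ?thesis by (rule sobolev_bound_mono)
    qed
    then show "sobolev_bound (\<lambda>x. \<Sum>k<2 ^ j. b k * e (2 ^ j + k + 1) x) (C * 2 ^ j * ?S)"
      by (rule sobolev_bound_cong) (use e(2)[OF j] in \<open>auto intro!: sum.cong\<close>)
  qed
qed

section \<open>Coverage of functions\<close>

text \<open>What all Besov balls of the class share once \<open>p\<close>, \<open>q\<close> and
  \<open>s\<close> are eliminated; uniformity over the class becomes uniformity over this
  set.\<close>

definition smooth_coefficients :: "nat \<Rightarrow> (nat \<Rightarrow> real \<Rightarrow> real) \<Rightarrow> real \<Rightarrow> real \<Rightarrow> (real \<Rightarrow> real) \<Rightarrow> bool" where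
  "smooth_coefficients J0 e c \<gamma> f \<longleftrightarrow> sq_integrable unit_leb f \<and>
     (\<forall>l\<in>{1..2 ^ J0}. \<bar>wcoef e f l\<bar> \<le> c) \<and>
     (\<forall>j\<ge>J0. (\<Sum>k<2 ^ j. (wcoef e f (2 ^ j + k + 1))\<^sup>2) \<le> c\<^sup>2 * 2 powr (- 2 * \<gamma> * real j))"

lemma function_class_smooth_coefficients:
  assumes "f \<in> function_class J0 e \<eta> c" "0 \<le> c" "\<gamma> \<le> 1 / 2 + \<eta>"
  shows "smooth_coefficients J0 e c \<gamma> f"
proof -
  obtain p q s where pq: "1 \<le> p" "1 \<le> q" "1 / 2 + \<eta> \<le> besov_gamma p s"
    and f: "sq_integrable unit_leb f" "wcoef e f \<in> besov_body J0 p q s c"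
    using assms(1) by (auto simp: function_class_def besov_ball_def)
  have "(\<Sum>k<2 ^ j. (wcoef e f (2 ^ j + k + 1))\<^sup>2) \<le> c\<^sup>2 * 2 powr (- 2 * \<gamma> * real j)" if "J0 \<le> j" for j
  proof -
    have "(\<Sum>k<2 ^ j. (wcoef e f (2 ^ j + k + 1))\<^sup>2) \<le> c\<^sup>2 * 2 powr (- 2 * besov_gamma p s * real j)"
      by (rule besov_body_energy[OF f(2) pq(1,2) assms(2) that])
    also have "\<dots> \<le> c\<^sup>2 * 2 powr (- 2 * \<gamma> * real j)"
      using pq(3) assms(3) by (intro mult_left_mono powr_mono) (auto intro: mult_right_mono)
    finally show ?thesis .
  qed
  then show ?thesis
    using f(1) besov_father_bound[OF f(2) pq(1)] by (auto simp: smooth_coefficients_def)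
qed

lemma smooth_coefficientsD:
  assumes "smooth_coefficients J0 e c \<gamma> f"
  shows "sq_integrable unit_leb f"
    and "l \<in> {1..2 ^ J0} \<Longrightarrow> \<bar>wcoef e f l\<bar> \<le> c"
    and "J0 \<le> j \<Longrightarrow> (\<Sum>k<2 ^ j. (wcoef e f (2 ^ j + k + 1))\<^sup>2) \<le> c\<^sup>2 * 2 powr (- 2 * \<gamma> * real j)"
  using assms unfolding smooth_coefficients_def by blast+

lemma powr_mult_of_nat: "(2::real) powr (x * real i) = (2 powr x) ^ i"
  by (subst powr_powr[symmetric]) (rule powr_realpow, simp)

lemma sample_size_powr: "real (sample_size J1) powr x = (2 powr x) ^ (J1 + 1)"
proof -
  have "real (sample_size J1) = 2 powr real (J1 + 1)"
    unfolding sample_size_def by (subst powr_realpow) auto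
  then show ?thesis unfolding powr_mult_of_nat[symmetric] by (simp only: powr_powr mult.commute)
qed

lemma sqrt_powr_double:
  fixes c \<gamma> x :: real
  shows "sqrt (c\<^sup>2 * 2 powr (- 2 * \<gamma> * x)) = \<bar>c\<bar> * 2 powr (- \<gamma> * x)"
proof -
  have "2 powr (- 2 * \<gamma> * x) = (2::real) powr (- \<gamma> * x + - \<gamma> * x)"
    by (rule arg_cong[where f = "\<lambda>t. 2 powr t"]) (simp add: algebra_simps)
  also have "\<dots> = (2 powr (- \<gamma> * x))\<^sup>2" by (simp only: power2_eq_square powr_add)
  finally have eq: "2 powr (- 2 * \<gamma> * x) = (2 powr (- \<gamma> * x) :: real)\<^sup>2" .
  show ?thesis unfolding eq real_sqrt_mult by simp
qed

lemma wavelet_sum_level: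
  "wavelet_sum e (2 ^ Suc j) \<mu> x - wavelet_sum e (2 ^ j) \<mu> x = (\<Sum>k<2 ^ j. \<mu> (2 ^ j + k + 1) * e (2 ^ j + k + 1) x)"
proof -
  have "wavelet_sum e (sample_size j) \<mu> x =
      wavelet_sum e (2 ^ j) \<mu> x + (\<Sum>k<2 ^ j. \<mu> (2 ^ j + k + 1) * e (2 ^ j + k + 1) x)"
    unfolding wavelet_sum_def sum_father_wavelet[OF order_refl] sum_dyadic_levels[OF order_refl]
    by (simp only: atLeastAtMost_singleton sum.insert finite.emptyI empty_iff sum.empty add_0_right not_False_eq_True)
  then show ?thesis unfolding sample_size_def Suc_eq_plus1 by linarith
qed

text \<open>Level \<open>j\<close> of the expansion has norm at most
  \<open>c * 2 powr (- \<gamma> * j)\<close> by orthonormality, so the tail is a geometric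
  series.\<close>

lemma truncation_error:
  assumes e: "complete_orthonormal e" and f: "smooth_coefficients J0 e c \<gamma> f"
    and "0 \<le> c" "0 < \<gamma>" "J0 \<le> J1"
  shows "L2_norm unit_leb (\<lambda>x. f x - wavelet_sum e (sample_size J1) (wcoef e f) x)
    \<le> c / (1 - 2 powr (- \<gamma>)) * real (sample_size J1) powr (- \<gamma>)"
proof -
  define r where "r = 2 powr (- \<gamma>)"
  have r: "0 < r" "r < 1" using assms(4) by (auto simp: r_def powr_less_one)
  have rp: "2 powr (- \<gamma> * real i) = r ^ i" for i
    unfolding r_def by (rule powr_mult_of_nat)
  define a where "a m = c * r ^ (J0 + m)" for m
  have sm: "summable a" unfolding a_def power_add using r by (intro summable_mult summable_geometric) auto
  have fsq: "sq_integrable unit_leb f" using f by (simp add: smooth_coefficients_def)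
  have step: "L2_norm unit_leb (\<lambda>x. wavelet_sum e (2 ^ (J0 + Suc m)) (wcoef e f) x -
      wavelet_sum e (2 ^ (J0 + m)) (wcoef e f) x) \<le> a m" for m
  proof -
    let ?j = "J0 + m"
    have "(L2_norm unit_leb (\<lambda>x. \<Sum>k<2 ^ ?j. wcoef e f (2 ^ ?j + k + 1) * e (2 ^ ?j + k + 1) x))\<^sup>2 =
      (\<Sum>k<2 ^ ?j. (wcoef e f (2 ^ ?j + k + 1))\<^sup>2)"
      using e by (intro L2_norm_orthonormal_sum) (auto simp: complete_orthonormal_def)
    also have "\<dots> \<le> c\<^sup>2 * 2 powr (- 2 * \<gamma> * real ?j)"
      by (rule smooth_coefficientsD(3)[OF f]) simp
    finally have "L2_norm unit_leb (\<lambda>x. \<Sum>k<2 ^ ?j. wcoef e f (2 ^ ?j + k + 1) * e (2 ^ ?j + k + 1) x)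
      \<le> sqrt (c\<^sup>2 * 2 powr (- 2 * \<gamma> * real ?j))" by (rule real_le_rsqrt)
    also have "\<dots> = a m" unfolding sqrt_powr_double rp using assms(3) by (simp add: a_def)
    finally show ?thesis by (simp only: add_Suc_right wavelet_sum_level)
  qed
  have mono: "mono (\<lambda>m. (2::nat) ^ (J0 + m))" by (rule monoI) (simp add: power_increasing)
  have unb: "\<exists>m. l \<le> 2 ^ (J0 + m)" for l :: nat
  proof
    have "l < 2 ^ l" by (rule less_exp)
    also have "(2::nat) ^ l \<le> 2 ^ (J0 + l)" by (intro power_increasing) auto
    finally show "l \<le> 2 ^ (J0 + l)" by simp
  qed
  \<comment> \<open>Chosen so that \<open>2 ^ (J0 + m)\<close> is the sample size.\<close>
  define m where "m = J1 + 1 - J0"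
  have Jm: "J0 + m = J1 + 1" using assms(5) by (simp add: m_def)
  from wavelet_partial_sum_error[OF e fsq mono unb sm step, of m]
  have "L2_norm unit_leb (\<lambda>x. f x - wavelet_sum e (sample_size J1) (wcoef e f) x) \<le> (\<Sum>i. a (i + m))"
    unfolding Jm sample_size_def .
  also have "(\<Sum>i. a (i + m)) = (\<Sum>i. c * r ^ (J1 + 1) * r ^ i)"
  proof (rule suminf_cong)
    fix i
    have "J0 + (i + m) = J1 + 1 + i" using Jm by simp
    then show "a (i + m) = c * r ^ (J1 + 1) * r ^ i"
      unfolding a_def by (simp only: power_add mult.assoc)
  qed
  also have "\<dots> = c * r ^ (J1 + 1) * (1 / (1 - r))"
    using r by (subst suminf_mult) (auto simp: suminf_geometric intro: summable_geometric)
  also have "r ^ (J1 + 1) = real (sample_size J1) powr (- \<gamma>)"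
    unfolding sample_size_powr r_def ..
  finally show ?thesis by (simp add: r_def)
qed

text \<open>Level \<open>j\<close> has a derivative of norm of order
  \<open>2 ^ j * 2 powr (- \<gamma> * j)\<close>. For \<gamma> < 1 this grows geometrically, so the
  sum over levels is a constant multiple of the finest one.\<close>

lemma partial_sum_sobolev:
  assumes basis: "wavelet_basis J0 \<phi> \<psi> e" and \<gamma>: "0 < \<gamma>" "\<gamma> < 1" and c: "0 \<le> c"
  obtains C where "0 \<le> C" and "\<And>J1 f. J0 \<le> J1 \<Longrightarrow> smooth_coefficients J0 e c \<gamma> f \<Longrightarrow>
    sobolev_bound (wavelet_sum e (sample_size J1) (wcoef e f)) (C * real (sample_size J1) powr (1 - \<gamma>))"
proof -
  obtain C where C: "0 \<le> C" "\<And>l. l \<in> {1..2 ^ J0} \<Longrightarrow> sobolev_bound (e l) C"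
    "\<And>j b. J0 \<le> j \<Longrightarrow> sobolev_bound (\<lambda>x. \<Sum>k<2 ^ j. b k * e (2 ^ j + k + 1) x)
        (C * 2 ^ j * sqrt (\<Sum>k<2 ^ j. (b k)\<^sup>2))"
    using wavelet_basis_sobolev[OF basis] by blast
  define r where "r = 2 powr (1 - \<gamma>)"
  have r: "1 < r" using \<gamma> by (simp add: r_def)
  have rp: "2 ^ j * 2 powr (- \<gamma> * real j) = r ^ j" for j
  proof -
    have "(2::real) ^ j = 2 powr (1 * real j)" unfolding powr_mult_of_nat by simp
    then have "2 ^ j * 2 powr (- \<gamma> * real j) = (2::real) powr (1 * real j + - \<gamma> * real j)"
      by (simp only: powr_add)
    also have "\<dots> = 2 powr ((1 - \<gamma>) * real j)"
      by (rule arg_cong[where f = "\<lambda>t. 2 powr t"]) (simp add: algebra_simps)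
    finally show ?thesis unfolding r_def powr_mult_of_nat .
  qed
  \<comment> \<open>\<open>2 ^ J0\<close> counts the father functions, and
    \<open>1 / (r - 1)\<close> is the constant of the geometric sum.\<close>
  define C' where "C' = C * c * (2 ^ J0 + 1 / (r - 1))"
  have "sobolev_bound (wavelet_sum e (sample_size J1) (wcoef e f)) (C' * real (sample_size J1) powr (1 - \<gamma>))"
    if J: "J0 \<le> J1" and f: "smooth_coefficients J0 e c \<gamma> f" for J1 f
  proof -
    let ?\<theta> = "wcoef e f"
    have father: "sobolev_bound (\<lambda>x. \<Sum>l=1..2 ^ J0. ?\<theta> l * e l x) (\<Sum>l=1..(2::nat) ^ J0. c * C)"
    proof (intro sobolev_bound_sum)
      fix l :: nat assume l: "l \<in> {1..2 ^ J0}"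
      then have "\<bar>?\<theta> l\<bar> * C \<le> c * C" by (rule mult_right_mono[OF smooth_coefficientsD(2)[OF f] C(1)])
      then show "sobolev_bound (\<lambda>x. ?\<theta> l * e l x) (c * C)"
        by (rule sobolev_bound_mono[OF sobolev_bound_scale[OF C(2)[OF l]]])
    qed simp
    have mother: "sobolev_bound (\<lambda>x. \<Sum>j=J0..J1. \<Sum>k<2 ^ j. ?\<theta> (2 ^ j + k + 1) * e (2 ^ j + k + 1) x)
        (\<Sum>j=J0..J1. C * c * r ^ j)"
    proof (intro sobolev_bound_sum)
      fix j assume j: "j \<in> {J0..J1}"
      have "sqrt (\<Sum>k<2 ^ j. (?\<theta> (2 ^ j + k + 1))\<^sup>2) \<le> sqrt (c\<^sup>2 * 2 powr (- 2 * \<gamma> * real j))"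
        using j by (intro real_sqrt_le_mono smooth_coefficientsD(3)[OF f]) simp
      also have "\<dots> = c * 2 powr (- \<gamma> * real j)" unfolding sqrt_powr_double using c by simp
      finally have "C * 2 ^ j * sqrt (\<Sum>k<2 ^ j. (?\<theta> (2 ^ j + k + 1))\<^sup>2) \<le> C * 2 ^ j * (c * 2 powr (- \<gamma> * real j))"
        using C(1) by (intro mult_left_mono) auto
      also have "\<dots> = C * c * r ^ j" unfolding rp[symmetric] by simp
      finally show "sobolev_bound (\<lambda>x. \<Sum>k<2 ^ j. ?\<theta> (2 ^ j + k + 1) * e (2 ^ j + k + 1) x) (C * c * r ^ j)"
        using j by (intro sobolev_bound_mono[OF C(3)]) auto
    qed simp
    have sum_eq: "wavelet_sum e (sample_size J1) ?\<theta> = (\<lambda>x. (\<Sum>l=1..2 ^ J0. ?\<theta> l * e l x) +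
       (\<Sum>j=J0..J1. \<Sum>k<2 ^ j. ?\<theta> (2 ^ j + k + 1) * e (2 ^ j + k + 1) x))"
      unfolding wavelet_sum_def[abs_def] sum_father_wavelet[OF J] sum_dyadic_levels[OF J] ..
    have N: "real (sample_size J1) powr (1 - \<gamma>) = r ^ (J1 + 1)"
      unfolding sample_size_powr r_def ..
    show ?thesis
      unfolding sum_eq
    proof (rule sobolev_bound_mono[OF sobolev_bound_add[OF father mother]])
      have "(\<Sum>j=J0..J1. r ^ j) \<le> (\<Sum>j<J1 + 1. r ^ j)" using r by (intro sum_mono2) auto
      also have "\<dots> = (r ^ (J1 + 1) - 1) / (r - 1)" by (rule geometric_sum) (use r in simp)
      also have "\<dots> \<le> r ^ (J1 + 1) / (r - 1)" using r by (intro divide_right_mono) auto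
      finally have "C * c * (\<Sum>j=J0..J1. r ^ j) \<le> C * c * (r ^ (J1 + 1) / (r - 1))"
        using C(1) c by (intro mult_left_mono) auto
      moreover have "1 \<le> r ^ (J1 + 1)" using r by (intro one_le_power) simp
      then have "2 ^ J0 * (C * c) * 1 \<le> 2 ^ J0 * (C * c) * r ^ (J1 + 1)"
        using C(1) c by (intro mult_left_mono) auto
      ultimately show "(\<Sum>l=1..(2::nat) ^ J0. c * C) + (\<Sum>j=J0..J1. C * c * r ^ j) \<le>
        C' * real (sample_size J1) powr (1 - \<gamma>)"
      proof -
        assume "C * c * (\<Sum>j=J0..J1. r ^ j) \<le> C * c * (r ^ (J1 + 1) / (r - 1))"
          "2 ^ J0 * (C * c) * 1 \<le> 2 ^ J0 * (C * c) * r ^ (J1 + 1)"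
        moreover have "(\<Sum>l=1..(2::nat) ^ J0. c * C) = 2 ^ J0 * (C * c) * 1" by simp
        moreover have "(\<Sum>j=J0..J1. C * c * r ^ j) = C * c * (\<Sum>j=J0..J1. r ^ j)"
          by (rule sum_distrib_left[symmetric])
        moreover have "x * (p + 1 / d) * R = p * x * R + x * (R / d)" for x p d R :: real
          by (simp add: distrib_left distrib_right)
        note this[of "C * c" "2 ^ J0" "r - 1" "r ^ (J1 + 1)"]
        ultimately show ?thesis unfolding N C'_def by linarith
      qed
    qed
  qed
  moreover have "0 \<le> C'" using C(1) c r by (simp add: C'_def)
  ultimately show ?thesis using that by blast
qed

lemma wavelet_basis_complete: "wavelet_basis J0 \<phi> \<psi> e \<Longrightarrow> complete_orthonormal e"
  by (auto simp: wavelet_basis_def)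

text \<open>As \<gamma> < 1, \<open>f\<close> itself may lack a square integrable derivative. Its
  partial sum has one of norm \<open>O(n powr (1 - \<gamma>))\<close>, which cells of length
  \<open>1 / n\<close> turn into \<open>n powr (- \<gamma>)\<close>; the tail is already of this
  size, and averaging does not enlarge it.\<close>

lemma discretization_error:
  assumes basis: "wavelet_basis J0 \<phi> \<psi> e" and \<gamma>: "0 < \<gamma>" "\<gamma> < 1" and c: "0 \<le> c"
  obtains C where "0 \<le> C" and "\<And>J1 f. J0 \<le> J1 \<Longrightarrow> smooth_coefficients J0 e c \<gamma> f \<Longrightarrow>
    L2_norm unit_leb (\<lambda>x. f x - wavelet_sum e (sample_size J1) (wcoef e f) x) \<le> C * real (sample_size J1) powr (- \<gamma>) \<and>
    L2_norm unit_leb (\<lambda>x. f x - cell_average (sample_size J1) f x) \<le> C * real (sample_size J1) powr (- \<gamma>)"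
proof -
  note e = wavelet_basis_complete[OF basis]
  obtain C1 where C1: "0 \<le> C1" "\<And>J1 f. J0 \<le> J1 \<Longrightarrow> smooth_coefficients J0 e c \<gamma> f \<Longrightarrow>
    sobolev_bound (wavelet_sum e (sample_size J1) (wcoef e f)) (C1 * real (sample_size J1) powr (1 - \<gamma>))"
    using partial_sum_sobolev[OF assms] by metis
  define C2 where "C2 = c / (1 - 2 powr (- \<gamma>))"
  have C2: "0 \<le> C2" using \<gamma> c powr_less_one[of 2 "- \<gamma>"] by (simp add: C2_def)
  have "L2_norm unit_leb (\<lambda>x. f x - cell_average (sample_size J1) f x) \<le> (C1 + 2 * C2) * real (sample_size J1) powr (- \<gamma>)"
    "L2_norm unit_leb (\<lambda>x. f x - wavelet_sum e (sample_size J1) (wcoef e f) x) \<le> C2 * real (sample_size J1) powr (- \<gamma>)"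
    if J: "J0 \<le> J1" and f: "smooth_coefficients J0 e c \<gamma> f" for J1 f
  proof -
    let ?n = "sample_size J1"
    let ?s = "wavelet_sum e ?n (wcoef e f)"
    let ?r = "\<lambda>x. f x - ?s x"
    have n: "0 < ?n" by simp
    have fsq: "sq_integrable unit_leb f" using f by (simp add: smooth_coefficients_def)
    have ssq: "sq_integrable unit_leb ?s" by (rule sq_integrable_wavelet_sum[OF e])
    note rsq = sq_integrable_diff[OF fsq ssq]
    show rb: "L2_norm unit_leb ?r \<le> C2 * real ?n powr (- \<gamma>)"
      unfolding C2_def by (rule truncation_error[OF e f c \<gamma>(1) J])
    have "L2_norm unit_leb (\<lambda>x. ?s x - cell_average ?n ?s x) \<le> C1 * real ?n powr (1 - \<gamma>) / real ?n"
      by (rule poincare_cell_average[OF C1(2)[OF J f] ssq n])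
    also have "\<dots> = C1 * real ?n powr (- \<gamma>)"
      using n by (simp add: powr_diff powr_minus field_simps)
    finally have sb: "L2_norm unit_leb (\<lambda>x. ?s x - cell_average ?n ?s x) \<le> C1 * real ?n powr (- \<gamma>)" .
    note cs = cell_average_contraction[OF ssq n] and cr = cell_average_contraction[OF rsq n]
      and cf = cell_average_contraction[OF fsq n]
    have fi: "integrable unit_leb f" "integrable unit_leb ?s"
      by (auto intro: unit_leb.sq_integrable_imp_integrable fsq ssq)
    have ae: "AE x in unit_leb. f x - cell_average ?n f x = (?s x - cell_average ?n ?s x) + (?r x - cell_average ?n ?r x)"
      using AE_unit_leb_lt_1
    proof eventually_elim
      case (elim x)
      then show ?case using cell_average_diff[OF fi, of x ?n] n by simp
    qed
    have "L2_norm unit_leb (\<lambda>x. f x - cell_average ?n f x) =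
      L2_norm unit_leb (\<lambda>x. (?s x - cell_average ?n ?s x) + (?r x - cell_average ?n ?r x))"
      using sq_integrable_diff[OF fsq cf(1)] sq_integrable_add[OF sq_integrable_diff[OF ssq cs(1)] sq_integrable_diff[OF rsq cr(1)]]
      by (intro L2_norm_cong_AE ae) (simp_all only: sq_integrable_def)
    also have "\<dots> \<le> L2_norm unit_leb (\<lambda>x. ?s x - cell_average ?n ?s x) + L2_norm unit_leb (\<lambda>x. ?r x - cell_average ?n ?r x)"
      by (intro L2_norm_triangle sq_integrable_diff ssq cs(1) rsq cr(1) fsq)
    also have "L2_norm unit_leb (\<lambda>x. ?r x - cell_average ?n ?r x) \<le> L2_norm unit_leb ?r + L2_norm unit_leb (cell_average ?n ?r)"
      by (rule L2_norm_triangle_diff[OF rsq cr(1)])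
    finally show "L2_norm unit_leb (\<lambda>x. f x - cell_average ?n f x) \<le> (C1 + 2 * C2) * real ?n powr (- \<gamma>)"
      using sb rb cr(2) by (simp add: algebra_simps)
  qed
  note bounds = this
  have le: "C2 * real (sample_size J1) powr (- \<gamma>) \<le> (C1 + 2 * C2) * real (sample_size J1) powr (- \<gamma>)" for J1
    using C1(1) C2 by (intro mult_right_mono) auto
  show ?thesis
  proof (rule that[of "C1 + 2 * C2"])
    show "0 \<le> C1 + 2 * C2" using C1(1) C2 by simp
    fix J1 f assume "J0 \<le> J1" "smooth_coefficients J0 e c \<gamma> f"
    note b = bounds[OF this]
    show "L2_norm unit_leb (\<lambda>x. f x - wavelet_sum e (sample_size J1) (wcoef e f) x) \<le> (C1 + 2 * C2) * real (sample_size J1) powr (- \<gamma>) \<and>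
      L2_norm unit_leb (\<lambda>x. f x - cell_average (sample_size J1) f x) \<le> (C1 + 2 * C2) * real (sample_size J1) powr (- \<gamma>)"
      using order_trans[OF b(2) le] b(1) by (rule conjI)
  qed
qed

lemma sum_level_le_total:
  fixes g :: "nat \<Rightarrow> real"
  assumes "J0 \<le> J1" "j \<in> {J0..J1}" "\<And>l. 0 \<le> g l"
  shows "(\<Sum>k<2 ^ j. g (2 ^ j + k + 1)) \<le> (\<Sum>l=1..sample_size J1. g l)"
proof -
  have "(\<Sum>k<2 ^ j. g (2 ^ j + k + 1)) \<le> (\<Sum>j=J0..J1. \<Sum>k<2 ^ j. g (2 ^ j + k + 1))"
    using assms by (intro member_le_sum[where f = "\<lambda>j. \<Sum>k<2 ^ j. g (2 ^ j + k + 1)"]) (auto intro: sum_nonneg)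
  also have "\<dots> \<le> (\<Sum>l=1..2 ^ J0. g l) + (\<Sum>j=J0..J1. \<Sum>k<2 ^ j. g (2 ^ j + k + 1))"
    using assms by (simp add: sum_nonneg)
  finally show ?thesis unfolding sum_father_wavelet[OF assms(1)] sum_dyadic_levels[OF assms(1)] .
qed

text \<open>The discretisation error has no structure across levels, so Bessel's inequality bounds
  its coefficients at each level by its whole norm. As \<open>j \<le> J1\<close>, the resulting
  \<open>n powr (- 2 * \<gamma>)\<close> is at most
  \<open>2 powr (- 2 * \<gamma> * j)\<close>.\<close>

lemma discretized_energy:
  assumes e: "complete_orthonormal e" and f: "smooth_coefficients J0 e c \<gamma> f" and "0 \<le> \<gamma>" "0 \<le> C"
    and J: "J0 \<le> J1" "j \<in> {J0..J1}"
    and err: "L2_norm unit_leb (\<lambda>x. f x - cell_average (sample_size J1) f x) \<le> C * real (sample_size J1) powr (- \<gamma>)"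
  shows "(\<Sum>k<2 ^ j. (wcoef e (cell_average (sample_size J1) f) (2 ^ j + k + 1))\<^sup>2)
    \<le> (2 * c\<^sup>2 + 2 * C\<^sup>2) * 2 powr (- 2 * \<gamma> * real j)"
proof -
  let ?n = "sample_size J1"
  let ?q = "cell_average ?n f"
  have fsq: "sq_integrable unit_leb f" using f by (simp add: smooth_coefficients_def)
  have qsq: "sq_integrable unit_leb ?q" by (rule cell_average_contraction[OF fsq]) simp
  note dsq = sq_integrable_diff[OF fsq qsq]
  define d where "d = wcoef e (\<lambda>x. f x - ?q x)"
  have coef: "(wcoef e ?q l)\<^sup>2 \<le> 2 * (wcoef e f l)\<^sup>2 + 2 * (d l)\<^sup>2" if "1 \<le> l" for l
  proof -
    have "wcoef e ?q l = wcoef e f l - d l"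
      unfolding d_def wcoef_def L2_inner_diff_left[OF fsq qsq complete_orthonormal_sq_integrable[OF e that]] by simp
    moreover have "(a - b)\<^sup>2 \<le> 2 * a\<^sup>2 + 2 * b\<^sup>2" for a b :: real
      using zero_le_power2[of "a + b"] by (simp add: power2_sum power2_diff)
    ultimately show ?thesis by simp
  qed
  have "(\<Sum>k<2 ^ j. (d (2 ^ j + k + 1))\<^sup>2) \<le> (\<Sum>l=1..?n. (d l)\<^sup>2)"
    by (rule sum_level_le_total[OF J]) simp
  also have "\<dots> \<le> (L2_norm unit_leb (\<lambda>x. f x - ?q x))\<^sup>2"
    unfolding d_def by (rule bessel_inequality[OF e dsq])
  also have "\<dots> \<le> (C * real ?n powr (- \<gamma>))\<^sup>2" by (intro power_mono err) simp
  also have "\<dots> = C\<^sup>2 * real ?n powr (- 2 * \<gamma>)"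
    by (simp add: power_mult_distrib power2_eq_square powr_add[symmetric])
  also have "\<dots> \<le> C\<^sup>2 * 2 powr (- 2 * \<gamma> * real j)"
  proof (intro mult_left_mono)
    have "real ?n powr (- 2 * \<gamma>) = 2 powr (- 2 * \<gamma> * real (J1 + 1))"
      unfolding sample_size_powr by (rule powr_mult_of_nat[symmetric])
    also have "\<dots> \<le> 2 powr (- 2 * \<gamma> * real j)"
      using J assms(3) by (intro powr_mono) (auto intro: mult_left_mono)
    finally show "real ?n powr (- 2 * \<gamma>) \<le> 2 powr (- 2 * \<gamma> * real j)" .
  qed simp
  finally have d: "(\<Sum>k<2 ^ j. (d (2 ^ j + k + 1))\<^sup>2) \<le> C\<^sup>2 * 2 powr (- 2 * \<gamma> * real j)" .
  have "(\<Sum>k<2 ^ j. (wcoef e ?q (2 ^ j + k + 1))\<^sup>2) \<le>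
     (\<Sum>k<2 ^ j. 2 * (wcoef e f (2 ^ j + k + 1))\<^sup>2 + 2 * (d (2 ^ j + k + 1))\<^sup>2)"
    by (intro sum_mono coef) simp
  also have "\<dots> = 2 * (\<Sum>k<2 ^ j. (wcoef e f (2 ^ j + k + 1))\<^sup>2) + 2 * (\<Sum>k<2 ^ j. (d (2 ^ j + k + 1))\<^sup>2)"
    by (simp only: sum.distrib sum_distrib_left)
  also have "\<dots> \<le> 2 * (c\<^sup>2 * 2 powr (- 2 * \<gamma> * real j)) + 2 * (C\<^sup>2 * 2 powr (- 2 * \<gamma> * real j))"
    using J d by (intro add_mono mult_left_mono smooth_coefficientsD(3)[OF f]) auto
  finally show ?thesis by (simp add: distrib_right mult.assoc)
qed

section \<open>Distance to the confidence set and coverage of the function\<close>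

text \<open>Pythagoras: the truncation error is orthogonal to the first \<open>n\<close> basis
  functions.\<close>

lemma wavelet_sum_distance:
  assumes e: "complete_orthonormal e" and f: "sq_integrable unit_leb f"
  shows "(L2_norm unit_leb (\<lambda>x. f x - wavelet_sum e n \<mu> x))\<^sup>2 =
    (L2_norm unit_leb (\<lambda>x. f x - wavelet_sum e n (wcoef e f) x))\<^sup>2 + (\<Sum>l=1..n. (wcoef e f l - \<mu> l)\<^sup>2)"
proof -
  let ?s = "wavelet_sum e n (wcoef e f)" and ?d = "wavelet_sum e n (\<lambda>l. wcoef e f l - \<mu> l)"
  let ?r = "\<lambda>x. f x - ?s x"
  have ssq: "sq_integrable unit_leb ?s" and dsq: "sq_integrable unit_leb ?d"
    by (rule sq_integrable_wavelet_sum[OF e])+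
  note rsq = sq_integrable_diff[OF f ssq]
  have orth: "L2_inner unit_leb ?r ?d = 0"
  proof -
    have "L2_inner unit_leb ?r (e l) = 0" if "l \<in> {1..n}" for l
      using that L2_inner_diff_left[OF f ssq complete_orthonormal_sq_integrable[OF e, of l]]
        wavelet_sum_coefficient[OF e, of l n "wcoef e f"] by (simp add: wcoef_def)
    moreover have "L2_inner unit_leb ?d ?r = (\<Sum>l=1..n. (wcoef e f l - \<mu> l) * L2_inner unit_leb (e l) ?r)"
      unfolding wavelet_sum_def[of e n "\<lambda>l. wcoef e f l - \<mu> l", abs_def]
      using e rsq by (intro L2_inner_sum_left) (auto simp: complete_orthonormal_def)
    ultimately show ?thesis by (simp add: L2_inner_commute)
  qed
  have dn: "(L2_norm unit_leb ?d)\<^sup>2 = (\<Sum>l=1..n. (wcoef e f l - \<mu> l)\<^sup>2)"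
    unfolding wavelet_sum_def[abs_def]
    using e by (intro L2_norm_orthonormal_sum) (auto simp: complete_orthonormal_def)
  have pt: "f x - wavelet_sum e n \<mu> x = ?r x + ?d x" for x
    by (simp add: wavelet_sum_def left_diff_distrib sum_subtractf)
  have "(L2_norm unit_leb (\<lambda>x. f x - wavelet_sum e n \<mu> x))\<^sup>2 = (LINT x|unit_leb. (?r x)\<^sup>2 + ((?d x)\<^sup>2 + 2 * (?r x * ?d x)))"
    unfolding L2_norm_square pt by (simp only: power2_sum add.assoc mult.assoc)
  also have "\<dots> = (L2_norm unit_leb ?r)\<^sup>2 + ((L2_norm unit_leb ?d)\<^sup>2 + 2 * L2_inner unit_leb ?r ?d)"
    using rsq dsq sq_integrable_product[OF rsq dsq]
    unfolding sq_integrable_def L2_norm_square L2_inner_def by (simp only: Bochner_Integration.integral_add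
        Bochner_Integration.integrable_add integrable_mult_right integral_mult_right_zero)
  finally show ?thesis using orth dn by simp
qed

lemma sum_eq_L2_set: "(\<Sum>l\<in>I. (x l)\<^sup>2) = (L2_set x I)\<^sup>2"
  by (simp add: L2_set_def sum_nonneg)

text \<open>The nearest point of a ball lies on the segment to its centre, so the distance to the
  confidence set is explicit; this makes the coverage event measurable.\<close>

lemma distance_to_conf_A_le_iff:
  fixes J0 J1 :: nat and \<sigma> \<alpha> :: real and lam :: "nat \<Rightarrow> (nat \<Rightarrow> real) \<Rightarrow> nat \<Rightarrow> real"
    and y :: "nat \<Rightarrow> real"
  assumes e: "complete_orthonormal e" and f: "sq_integrable unit_leb f" and b: "0 \<le> b"
  defines "n \<equiv> sample_size J1"
  defines "T \<equiv> L2_norm unit_leb (\<lambda>x. f x - wavelet_sum e n (wcoef e f) x)"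
  defines "h \<equiv> soft_estimate J0 (lam J1 y) y" and "s \<equiv> sq_radius \<sigma> \<alpha> J0 J1 (lam J1 y) y"
  shows "(INF g\<in>conf_A e \<sigma> \<alpha> J0 lam J1 y. ennreal (L2_norm unit_leb (\<lambda>x. f x - g x))) \<le> ennreal b \<longleftrightarrow>
    0 \<le> s \<and> T\<^sup>2 + (max 0 (sqrt (\<Sum>l=1..n. (wcoef e f l - h l)\<^sup>2) - sqrt s))\<^sup>2 \<le> b\<^sup>2"
    (is "?I \<le> _ \<longleftrightarrow> _")
proof -
  let ?\<theta> = "wcoef e f"
  define \<Delta> where "\<Delta> = sqrt (\<Sum>l=1..n. (?\<theta> l - h l)\<^sup>2)"
  have \<Delta>: "0 \<le> \<Delta>" "\<Delta>\<^sup>2 = (\<Sum>l=1..n. (?\<theta> l - h l)\<^sup>2)" by (simp_all add: \<Delta>_def sum_nonneg)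
  have D: "conf_D \<sigma> \<alpha> J0 lam J1 y = {\<mu> \<in> {1..n} \<rightarrow>\<^sub>E UNIV. (\<Sum>l=1..n. (\<mu> l - h l)\<^sup>2) \<le> s}"
    by (simp add: conf_D_def n_def h_def s_def)
  show ?thesis
    unfolding \<Delta>_def[symmetric]
  proof
    assume le: "?I \<le> ennreal b"
    \<comment> \<open>A negative squared radius leaves \<open>conf_A\<close> empty, and the infimum
      over the empty set is infinite.\<close>
    have s0: "0 \<le> s"
    proof (rule ccontr)
      assume "\<not> 0 \<le> s"
      moreover have "0 \<le> (\<Sum>l=1..n. (\<mu> l - h l)\<^sup>2)" for \<mu> by (simp add: sum_nonneg)
      ultimately have "conf_D \<sigma> \<alpha> J0 lam J1 y = {}" unfolding D by (auto simp: not_le) (meson le_less_trans not_le)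
      then have "?I = \<top>" by (simp add: conf_A_def)
      then show False using le by (simp add: top_unique)
    qed
    \<comment> \<open>The explicit distance, with the truncation error and the excess over the
      radius as orthogonal parts.\<close>
    define v where "v = sqrt (T\<^sup>2 + (max 0 (\<Delta> - sqrt s))\<^sup>2)"
    have "ennreal v \<le> ?I"
    proof (rule INF_greatest)
      fix g assume "g \<in> conf_A e \<sigma> \<alpha> J0 lam J1 y"
      then obtain \<mu> where \<mu>: "\<mu> \<in> conf_D \<sigma> \<alpha> J0 lam J1 y" and g: "g = wavelet_sum e n \<mu>"
        by (auto simp: conf_A_def n_def)
      have "L2_set (\<lambda>l. \<mu> l - h l) {1..n} \<le> sqrt s"
        using \<mu> unfolding D L2_set_def by simp
      moreover have "\<Delta> \<le> L2_set (\<lambda>l. ?\<theta> l - \<mu> l) {1..n} + L2_set (\<lambda>l. \<mu> l - h l) {1..n}"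
        using L2_set_triangle_ineq[of "\<lambda>l. ?\<theta> l - \<mu> l" "\<lambda>l. \<mu> l - h l" "{1..n}"]
        by (simp add: \<Delta>_def L2_set_def)
      moreover have "0 \<le> L2_set (\<lambda>l. ?\<theta> l - \<mu> l) {1..n}" by (rule L2_set_nonneg)
      ultimately have "max 0 (\<Delta> - sqrt s) \<le> L2_set (\<lambda>l. ?\<theta> l - \<mu> l) {1..n}" by linarith
      then have "(max 0 (\<Delta> - sqrt s))\<^sup>2 \<le> (L2_set (\<lambda>l. ?\<theta> l - \<mu> l) {1..n})\<^sup>2" by (intro power_mono) auto
      then have "T\<^sup>2 + (max 0 (\<Delta> - sqrt s))\<^sup>2 \<le> (L2_norm unit_leb (\<lambda>x. f x - g x))\<^sup>2"
        unfolding g wavelet_sum_distance[OF e f, of n \<mu>] T_def sum_eq_L2_set by linarith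
      then have "v \<le> L2_norm unit_leb (\<lambda>x. f x - g x)" unfolding v_def by (intro real_le_lsqrt) auto
      then show "ennreal v \<le> ennreal (L2_norm unit_leb (\<lambda>x. f x - g x))" by (rule ennreal_leI)
    qed
    then have "ennreal v \<le> ennreal b" using le by (rule order_trans)
    then have "v \<le> b" using b by (simp add: ennreal_le_iff)
    then have "v\<^sup>2 \<le> b\<^sup>2" by (intro power_mono) (auto simp: v_def)
    then show "0 \<le> s \<and> T\<^sup>2 + (max 0 (\<Delta> - sqrt s))\<^sup>2 \<le> b\<^sup>2" using s0 by (simp add: v_def)
  next
    assume H: "0 \<le> s \<and> T\<^sup>2 + (max 0 (\<Delta> - sqrt s))\<^sup>2 \<le> b\<^sup>2"
    \<comment> \<open>The fraction of the way from the centre \<open>h\<close> to the coefficients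
      that stays in the ball; the first case also covers \<open>\<Delta> = 0\<close>.\<close>
    define k where "k = (if \<Delta> \<le> sqrt s then 1 else sqrt s / \<Delta>)"
    have k: "(k * \<Delta>)\<^sup>2 \<le> s" "(1 - k) * \<Delta> = max 0 (\<Delta> - sqrt s)"
    proof -
      have "0 \<le> k * \<Delta>" "k * \<Delta> \<le> sqrt s" using \<Delta>(1) H by (auto simp: k_def)
      then have "(k * \<Delta>)\<^sup>2 \<le> (sqrt s)\<^sup>2" by (intro power_mono)
      then show "(k * \<Delta>)\<^sup>2 \<le> s" using H by simp
      show "(1 - k) * \<Delta> = max 0 (\<Delta> - sqrt s)" using \<Delta>(1) H by (auto simp: k_def field_simps)
    qed
    define \<mu> where "\<mu> = (\<lambda>l\<in>{1..n}. h l + k * (?\<theta> l - h l))"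
    have "(\<Sum>l=1..n. (\<mu> l - h l)\<^sup>2) = (\<Sum>l=1..n. k\<^sup>2 * (?\<theta> l - h l)\<^sup>2)"
      by (intro sum.cong) (auto simp: \<mu>_def power_mult_distrib)
    also have "\<dots> = (k * \<Delta>)\<^sup>2" by (simp only: sum_distrib_left[symmetric] \<Delta>(2)[symmetric] power_mult_distrib)
    finally have "\<mu> \<in> conf_D \<sigma> \<alpha> J0 lam J1 y" unfolding D using k(1) by (simp add: \<mu>_def)
    then have mem: "wavelet_sum e n \<mu> \<in> conf_A e \<sigma> \<alpha> J0 lam J1 y" by (auto simp: conf_A_def n_def)
    have "(\<Sum>l=1..n. (?\<theta> l - \<mu> l)\<^sup>2) = (\<Sum>l=1..n. (1 - k)\<^sup>2 * (?\<theta> l - h l)\<^sup>2)"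
    proof (intro sum.cong refl)
      fix l assume "l \<in> {1..n}"
      then have "?\<theta> l - \<mu> l = (1 - k) * (?\<theta> l - h l)" by (simp add: \<mu>_def algebra_simps)
      then show "(?\<theta> l - \<mu> l)\<^sup>2 = (1 - k)\<^sup>2 * (?\<theta> l - h l)\<^sup>2" by (simp only: power_mult_distrib)
    qed
    also have "\<dots> = (max 0 (\<Delta> - sqrt s))\<^sup>2"
      by (simp only: sum_distrib_left[symmetric] \<Delta>(2)[symmetric] k(2)[symmetric] power_mult_distrib)
    finally have "(L2_norm unit_leb (\<lambda>x. f x - wavelet_sum e n \<mu> x))\<^sup>2 \<le> b\<^sup>2"
      unfolding wavelet_sum_distance[OF e f, of n \<mu>] T_def[symmetric] using H by simp
    then have "L2_norm unit_leb (\<lambda>x. f x - wavelet_sum e n \<mu> x) \<le> b" using b by (rule power2_le_imp_le)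
    then have "ennreal (L2_norm unit_leb (\<lambda>x. f x - wavelet_sum e n \<mu> x)) \<le> ennreal b" by (rule ennreal_leI)
    with INF_lower[OF mem, of "\<lambda>g. ennreal (L2_norm unit_leb (\<lambda>x. f x - g x))"]
    show "?I \<le> ennreal b" by (rule order_trans)
  qed
qed

text \<open>The infimum runs over an uncountable set, so measurability is read off the explicit form
  of the distance.\<close>

lemma conf_C_event_measurable:
  assumes e: "complete_orthonormal e" and f: "f \<in> function_class J0 e \<eta> c" "0 \<le> \<delta>"
    and thr: "global_thresholds \<sigma> \<rho> J0 lam \<or> levelwise_thresholds \<sigma> \<rho> J0 lam" and J: "J0 \<le> J1"
  shows "{y \<in> space (data_space (sample_size J1)). f \<in> conf_C e \<sigma> \<alpha> J0 lam \<eta> c \<delta> J1 y}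
    \<in> sets (data_space (sample_size J1))"
proof -
  have fsq: "sq_integrable unit_leb f" using f(1) by (auto simp: function_class_def besov_ball_def)
  let ?n = "sample_size J1" and ?b = "\<delta> / sqrt (real (sample_size J1))"
  have b: "0 \<le> ?b" using f(2) by simp
  note lm = threshold_selection(1)[OF thr J]
  let ?s = "\<lambda>y. sq_radius \<sigma> \<alpha> J0 J1 (lam J1 y) y"
  let ?d = "\<lambda>y. \<Sum>l=1..?n. (wcoef e f l - soft_estimate J0 (lam J1 y) y l)\<^sup>2"
  let ?T = "L2_norm unit_leb (\<lambda>x. f x - wavelet_sum e ?n (wcoef e f) x)"
  have [measurable]: "?s \<in> borel_measurable (data_space ?n)" by (intro sq_radius_measurable lm)
  have [measurable]: "?d \<in> borel_measurable (data_space ?n)"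
    by (intro borel_measurable_sum borel_measurable_power borel_measurable_diff borel_measurable_const
        soft_estimate_measurable lm)
  have "{y \<in> space (data_space ?n). 0 \<le> ?s y \<and> ?T\<^sup>2 + (max 0 (sqrt (?d y) - sqrt (?s y)))\<^sup>2 \<le> ?b\<^sup>2}
    \<in> sets (data_space ?n)" by measurable
  then show ?thesis
    unfolding conf_C_def using f(1) by (simp add: distance_to_conf_A_le_iff[OF e fsq b])
qed

lemma prob_space_coef_law:
  assumes "0 < \<sigma>" "0 < n"
  shows "prob_space (coef_law \<sigma> n \<mu>)"
  unfolding coef_law_eq_distr[OF assms]
  by (intro gauss.prob_space_distr measurable_restrict) measurable

lemma sets_coef_law: "sets (coef_law \<sigma> n \<mu>) = sets (data_space n)"
  unfolding coef_law_def by (intro sets_PiM_cong) auto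

text \<open>Under this law the coefficients of the cell averages are covered with asymptotically
  nominal probability. On that event their wavelet sum belongs to \<open>conf_A\<close> and is close
  enough to \<open>f\<close>; being an inclusion of events, this gives a one-sided bound.\<close>

lemma coverage_conf_C:
  assumes \<sigma>: "0 < \<sigma>" and \<alpha>: "0 < \<alpha>" "\<alpha> < 1" and \<rho>: "1 / sqrt 2 < \<rho>" "\<rho> < 1"
    and basis: "wavelet_basis J0 \<phi> \<psi> e"
    and thr: "global_thresholds \<sigma> \<rho> J0 lam \<or> levelwise_thresholds \<sigma> \<rho> J0 lam"
    and \<eta>: "0 < \<eta>" and c: "0 < c" and \<delta>: "0 < \<delta>"
  shows "ereal (1 - \<alpha>) \<le> liminf (\<lambda>J1. INF f\<in>function_class J0 e \<eta> c.
          ereal (cover_prob \<sigma> (sample_size J1)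
            (wcoef e (cell_average (sample_size J1) f)) f
            (conf_C e \<sigma> \<alpha> J0 lam \<eta> c \<delta> J1)))"
proof -
  note e = wavelet_basis_complete[OF basis]
  \<comment> \<open>Capped at 3/4, because the derivative bound for partial sums requires \<gamma> <
    1.\<close>
  define \<gamma> where "\<gamma> = 1 / 2 + min \<eta> (1 / 4)"
  have \<gamma>: "1 / 2 < \<gamma>" "0 < \<gamma>" "\<gamma> < 1" "\<gamma> \<le> 1 / 2 + \<eta>" using \<eta> by (auto simp: \<gamma>_def)
  obtain C where C: "0 \<le> C" "\<And>J1 f. J0 \<le> J1 \<Longrightarrow> smooth_coefficients J0 e c \<gamma> f \<Longrightarrow>
    L2_norm unit_leb (\<lambda>x. f x - wavelet_sum e (sample_size J1) (wcoef e f) x) \<le> C * real (sample_size J1) powr (- \<gamma>) \<and>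
    L2_norm unit_leb (\<lambda>x. f x - cell_average (sample_size J1) f x) \<le> C * real (sample_size J1) powr (- \<gamma>)"
    using discretization_error[OF basis \<gamma>(2,3) less_imp_le[OF c]] by blast
  have "((\<lambda>N. 2 * C * N powr (1 / 2 - \<gamma>)) \<longlongrightarrow> 2 * C * 0) at_top"
  proof (intro tendsto_mult tendsto_const)
    show "((\<lambda>N::real. N powr (1 / 2 - \<gamma>)) \<longlongrightarrow> 0) at_top" using \<gamma> by real_asymp
  qed
  then have "((\<lambda>J1. 2 * C * real (sample_size J1) powr (1 / 2 - \<gamma>)) \<longlongrightarrow> 2 * C * 0) sequentially"
    by (rule filterlim_compose[OF _ filterlim_sample_size])
  then have "eventually (\<lambda>J1. 2 * C * real (sample_size J1) powr (1 / 2 - \<gamma>) < \<delta>) sequentially"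
    by (rule order_tendstoD) (use \<delta> in simp)
  \<comment> \<open>Twice the error: once for truncating \<open>f\<close>, once for replacing it by
    its averages, which the projection does not enlarge.\<close>
  then have close: "eventually (\<lambda>J1. 2 * (C * real (sample_size J1) powr (- \<gamma>)) \<le> \<delta> / sqrt (real (sample_size J1))) sequentially"
  proof eventually_elim
    case (elim J1)
    have "real (sample_size J1) powr (1 / 2 - \<gamma>) = sqrt (real (sample_size J1)) * real (sample_size J1) powr (- \<gamma>)"
      by (simp add: powr_half_sqrt[symmetric] powr_add[symmetric])
    then show ?case using elim by (simp add: field_simps)
  qed
  show ?thesis
    unfolding le_Liminf_iff
  proof (intro allI impI)
    fix a assume "a < ereal (1 - \<alpha>)"
    \<comment> \<open>A real number strictly between: the infimum keeps only weak bounds, and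
      \<open>a\<close> may be minus infinity.\<close>
    then obtain z where z: "a < ereal z" "ereal z < ereal (1 - \<alpha>)" using ereal_dense2 by blast
    then have z1: "0 < 1 - \<alpha> - z" by simp
    have c2: "0 \<le> 2 * c\<^sup>2 + 2 * C\<^sup>2" by simp
    from coverage_uniform[OF \<sigma> \<alpha> \<rho> thr \<gamma>(1) c2 z1] close eventually_ge_at_top[of J0]
    show "eventually (\<lambda>J1. a < (INF f\<in>function_class J0 e \<eta> c.
          ereal (cover_prob \<sigma> (sample_size J1) (wcoef e (cell_average (sample_size J1) f)) f
            (conf_C e \<sigma> \<alpha> J0 lam \<eta> c \<delta> J1)))) sequentially"
    proof eventually_elim
      case (elim J1)
      let ?n = "sample_size J1"
      have "ereal z \<le> (INF f\<in>function_class J0 e \<eta> c.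
          ereal (cover_prob \<sigma> ?n (wcoef e (cell_average ?n f)) f (conf_C e \<sigma> \<alpha> J0 lam \<eta> c \<delta> J1)))"
      proof (rule INF_greatest)
        fix f assume f: "f \<in> function_class J0 e \<eta> c"
        let ?q = "cell_average ?n f"
        let ?\<mu> = "wcoef e ?q"
        let ?L = "coef_law \<sigma> ?n ?\<mu>"
        have sm: "smooth_coefficients J0 e c \<gamma> f"
          using function_class_smooth_coefficients[OF f less_imp_le[OF c] \<gamma>(4)] .
        have fsq: "sq_integrable unit_leb f" using sm by (simp add: smooth_coefficients_def)
        have qsq: "sq_integrable unit_leb ?q" by (rule cell_average_contraction[OF fsq]) simp
        note err = C(2)[OF elim(3) sm]
        have energy: "\<forall>j\<in>{J0..J1}. (\<Sum>k<2 ^ j. (?\<mu> (2 ^ j + k + 1))\<^sup>2) \<le> (2 * c\<^sup>2 + 2 * C\<^sup>2) * 2 powr (- 2 * \<gamma> * real j)"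
          using \<gamma> C(1) err elim(3) by (intro ballI discretized_energy[OF e sm]) auto
        let ?E = "{y \<in> space (data_space ?n). (\<Sum>l=1..?n. (?\<mu> l - soft_estimate J0 (lam J1 y) y l)\<^sup>2)
          \<le> sq_radius \<sigma> \<alpha> J0 J1 (lam J1 y) y}"
        let ?F = "{y \<in> space (data_space ?n). f \<in> conf_C e \<sigma> \<alpha> J0 lam \<eta> c \<delta> J1 y}"
        interpret L: prob_space ?L by (rule prob_space_coef_law[OF \<sigma>]) simp
        have "?E \<subseteq> ?F"
        proof
          fix y assume y: "y \<in> ?E"
          have "restrict ?\<mu> {1..?n} \<in> conf_D \<sigma> \<alpha> J0 lam J1 y" using y by (simp add: conf_D_def)
          moreover have "wavelet_sum e ?n (restrict ?\<mu> {1..?n}) = wavelet_sum e ?n ?\<mu>"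
            by (intro ext) (simp add: wavelet_sum_def)
          ultimately have mem: "wavelet_sum e ?n ?\<mu> \<in> conf_A e \<sigma> \<alpha> J0 lam J1 y"
            unfolding conf_A_def by (metis image_eqI)
          let ?s = "wavelet_sum e ?n (wcoef e f)"
          have ssq: "sq_integrable unit_leb ?s" "sq_integrable unit_leb (wavelet_sum e ?n ?\<mu>)"
            by (rule sq_integrable_wavelet_sum[OF e])+
          have "L2_norm unit_leb (\<lambda>x. (f x - ?s x) + (?s x - wavelet_sum e ?n ?\<mu> x)) \<le>
             L2_norm unit_leb (\<lambda>x. f x - ?s x) + L2_norm unit_leb (\<lambda>x. ?s x - wavelet_sum e ?n ?\<mu> x)"
            by (intro L2_norm_triangle sq_integrable_diff fsq ssq)
          also have "L2_norm unit_leb (\<lambda>x. ?s x - wavelet_sum e ?n ?\<mu> x) \<le> L2_norm unit_leb (\<lambda>x. f x - ?q x)"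
            by (rule L2_norm_wavelet_sum_diff[OF e fsq qsq])
          finally have "L2_norm unit_leb (\<lambda>x. f x - wavelet_sum e ?n ?\<mu> x) \<le> \<delta> / sqrt (real ?n)"
            using err elim(2) by simp
          then have "ennreal (L2_norm unit_leb (\<lambda>x. f x - wavelet_sum e ?n ?\<mu> x)) \<le> ennreal (\<delta> / sqrt (real ?n))"
            by (rule ennreal_leI)
          with INF_lower[OF mem, of "\<lambda>g. ennreal (L2_norm unit_leb (\<lambda>x. f x - g x))"]
          have "(INF g\<in>conf_A e \<sigma> \<alpha> J0 lam J1 y. ennreal (L2_norm unit_leb (\<lambda>x. f x - g x))) \<le> ennreal (\<delta> / sqrt (real ?n))"
            by (rule order_trans)
          then show "y \<in> ?F" using f y by (simp add: conf_C_def)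
        qed
        moreover have "?F \<in> sets ?L"
          unfolding sets_coef_law using \<delta> elim(3) by (intro conf_C_event_measurable[OF e f _ thr]) auto
        ultimately have "measure ?L ?E \<le> measure ?L ?F" by (intro L.finite_measure_mono)
        moreover have "\<bar>measure ?L ?E - (1 - \<alpha>)\<bar> < 1 - \<alpha> - z" using elim(1) energy by blast
        ultimately have "z \<le> measure ?L ?F" by linarith
        then show "ereal z \<le> ereal (cover_prob \<sigma> ?n ?\<mu> f (conf_C e \<sigma> \<alpha> J0 lam \<eta> c \<delta> J1))"
          by (simp add: cover_prob_def)
      qed
      with z(1) show ?case by (rule less_le_trans)
    qed
  qed
qed

theorem theorem3p2:
  fixes \<sigma> \<alpha> \<rho> :: real and J0 :: nat and \<phi> \<psi> :: "real \<Rightarrow> real"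
    and e :: "nat \<Rightarrow> real \<Rightarrow> real"
    and lam :: "nat \<Rightarrow> (nat \<Rightarrow> real) \<Rightarrow> nat \<Rightarrow> real"
  assumes "0 < \<sigma>" and "0 < \<alpha>" and "\<alpha> < 1" and "1 / sqrt 2 < \<rho>" and "\<rho> < 1"
    and "wavelet_basis J0 \<phi> \<psi> e"
    and "global_thresholds \<sigma> \<rho> J0 lam \<or> levelwise_thresholds \<sigma> \<rho> J0 lam"
  shows
    "(\<forall>p q s c. 1 \<le> p \<and> 1 \<le> q \<and> 1/2 < besov_gamma p s \<and> 0 < c \<longrightarrow>
       (\<lambda>J1. SUP \<mu>\<in>truncated_body (sample_size J1) (besov_body J0 p q s c).
          \<bar>cover_prob \<sigma> (sample_size J1) \<mu> \<mu> (conf_D \<sigma> \<alpha> J0 lam J1) - (1 - \<alpha>)\<bar>)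
        \<longlonglongrightarrow> 0) \<and>
     (\<forall>p q s c. 1 \<le> p \<and> 1 \<le> q \<and> 1/2 < besov_gamma p s \<and> 0 < c \<longrightarrow>
       (\<lambda>J1. SUP \<mu>\<in>truncated_body (sample_size J1) (besov_body J0 p q s c).
          \<bar>cover_prob \<sigma> (sample_size J1) \<mu> (wavelet_sum e (sample_size J1) \<mu>)
             (conf_A e \<sigma> \<alpha> J0 lam J1) - (1 - \<alpha>)\<bar>)
        \<longlonglongrightarrow> 0) \<and>
     (\<forall>\<eta> c \<delta>. 0 < \<eta> \<and> 0 < c \<and> 0 < \<delta> \<longrightarrow>
       ereal (1 - \<alpha>) \<le> liminf (\<lambda>J1. INF f\<in>function_class J0 e \<eta> c.
          ereal (cover_prob \<sigma> (sample_size J1)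
            (wcoef e (cell_average (sample_size J1) f)) f
            (conf_C e \<sigma> \<alpha> J0 lam \<eta> c \<delta> J1))))"
proof (intro conjI allI impI; elim conjE)
  fix p q s c :: real
  assume pq: "1 \<le> p" "1 \<le> q" "1 / 2 < besov_gamma p s" "0 < c"
  show D: "(\<lambda>J1. SUP \<mu>\<in>truncated_body (sample_size J1) (besov_body J0 p q s c).
          \<bar>cover_prob \<sigma> (sample_size J1) \<mu> \<mu> (conf_D \<sigma> \<alpha> J0 lam J1) - (1 - \<alpha>)\<bar>) \<longlonglongrightarrow> 0"
    by (rule coverage_besov_body[OF assms(1-5,7) pq])
  \<comment> \<open>The two coverage probabilities agree for each sample size, not only in the
    limit.\<close>
  have "(SUP \<mu>\<in>truncated_body (sample_size J1) (besov_body J0 p q s c).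
          \<bar>cover_prob \<sigma> (sample_size J1) \<mu> (wavelet_sum e (sample_size J1) \<mu>)
             (conf_A e \<sigma> \<alpha> J0 lam J1) - (1 - \<alpha>)\<bar>) =
      (SUP \<mu>\<in>truncated_body (sample_size J1) (besov_body J0 p q s c).
          \<bar>cover_prob \<sigma> (sample_size J1) \<mu> \<mu> (conf_D \<sigma> \<alpha> J0 lam J1) - (1 - \<alpha>)\<bar>)" for J1
    by (intro SUP_cong refl) (simp only: cover_prob_conf_A[OF wavelet_basis_complete[OF assms(6)]])
  then show "(\<lambda>J1. SUP \<mu>\<in>truncated_body (sample_size J1) (besov_body J0 p q s c).
          \<bar>cover_prob \<sigma> (sample_size J1) \<mu> (wavelet_sum e (sample_size J1) \<mu>)
             (conf_A e \<sigma> \<alpha> J0 lam J1) - (1 - \<alpha>)\<bar>) \<longlonglongrightarrow> 0"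
    using D by (simp only:)
next
  fix \<eta> c \<delta> :: real
  assume "0 < \<eta>" "0 < c" "0 < \<delta>"
  then show "ereal (1 - \<alpha>) \<le> liminf (\<lambda>J1. INF f\<in>function_class J0 e \<eta> c.
          ereal (cover_prob \<sigma> (sample_size J1)
            (wcoef e (cell_average (sample_size J1) f)) f
            (conf_C e \<sigma> \<alpha> J0 lam \<eta> c \<delta> J1)))"
    by (rule coverage_conf_C[OF assms])
qed

end
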